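(* Let $d \geq 2$ and let $G$ be a geographical threshold graph (GTG) on $n$ nodes in the $d$-dimensional toric unit cube $[0,1]^d$ with threshold function $\theta_n = cn/\log n$, and assume $G$ is connected. Suppose the weight distribution satisfies $\mathbb{P}[W \geq x] = O(1/x^{d+\nu})$ for some constant $\nu > 0$, and \[ c \leq \frac{1}{d+3} \min \left\{ \sup_{\alpha \in (0,1/2]} \alpha F^{-1}(\alpha),\ \sup_{\alpha \in (1/2,1)} (1-\alpha) F^{-1}(\alpha) \right\}. \] Then, with high probability, the mixing time of the simple random walk on $G$ satisfies $\tau(1/n) = O\big(n^{2/d} (\log n)^{(d-2)/d}\big)$.
   Context: GTG model: $n$ nodes are placed independently and uniformly at random in the toric unit cube $[0,1]^d$ (distances $r_{ij}$ are toric Euclidean distances). Each node $i$ independently receives a non-negative weight $w_i$ drawn from a continuous probability density $f$ on $\mathbb{R}^+$ with finite mean $\mu$ and finite variance; $F(x)=\mathbb{P}[W\le x]=\int_0^x f(w)\,dw$ is its cdf and $F^{-1}(p)=\inf\{x\in\mathbb{R}^+ : p\le F(x)\}$ the quantile function. Nodes $i,j$ are adjacent iff $(w_i+w_j)/r_{ij}^d \geq \theta_n$. The tail condition $\mathbb{P}[W\ge x]=O(1/x^{d+\nu})$ means there are constants $W_0, C$ with $\mathbb{P}[W\ge x]\le C x^{-(d+\nu)}$ for all $x\ge W_0$. Simple random walk: from node $i$ move to a uniformly random neighbor. Its stationary distribution is $\pi_k=\deg(k)/2|E(G)|$. With $P^t(i,\cdot)$ the distribution at time $t$ started from $i$, $\Delta_i(t)=\frac12\sum_j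 |P^t(i,j)-\pi_j|$, $\tau_i(\delta)=\min\{t : \Delta_i(t')\le\delta \ \forall t'\ge t\}$, and $\tau(\delta)=\max_i \tau_i(\delta)$. "With high probability" (whp) means with probability $1-o(1)$ as $n\to\infty$. *)

theory Defs
  imports "HOL-Probability.Probability"
begin

definition torus_dist :: "real^'d \<Rightarrow> real^'d \<Rightarrow> real" where
  "torus_dist x y = sqrt (\<Sum>k\<in>UNIV. (min \<bar>x$k - y$k\<bar> (1 - \<bar>x$k - y$k\<bar>))\<^sup>2)"

definition gtg_adj :: "nat \<Rightarrow> real \<Rightarrow> (nat \<Rightarrow> real^'d) \<Rightarrow> (nat \<Rightarrow> real) \<Rightarrow> nat \<Rightarrow> nat \<Rightarrow> bool" where
  "gtg_adj n \<theta> X w i j \<longleftrightarrow> i < n \<and> j < n \<and> i \<noteq> j \<and>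
     (w i + w j) / (torus_dist (X i) (X j)) ^ CARD('d) \<ge> \<theta>"

definition graph_connected :: "nat \<Rightarrow> (nat \<Rightarrow> nat \<Rightarrow> bool) \<Rightarrow> bool" where
  "graph_connected n A \<longleftrightarrow> (\<forall>i<n. \<forall>j<n. A\<^sup>*\<^sup>* i j)"

definition deg :: "nat \<Rightarrow> (nat \<Rightarrow> nat \<Rightarrow> bool) \<Rightarrow> nat \<Rightarrow> nat" where
  "deg n A i = card {j. j < n \<and> A i j}"

definition srw_step :: "nat \<Rightarrow> (nat \<Rightarrow> nat \<Rightarrow> bool) \<Rightarrow> nat \<Rightarrow> nat \<Rightarrow> real" where
  "srw_step n A i j = (if A i j then 1 / real (deg n A i) else 0)"

fun srw_pow :: "nat \<Rightarrow> (nat \<Rightarrow> nat \<Rightarrow> bool) \<Rightarrow> nat \<Rightarrow> nat \<Rightarrow> nat \<Rightarrow> real" where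
  "srw_pow n A 0 i j = (if i = j then 1 else 0)"
| "srw_pow n A (Suc t) i j = (\<Sum>k<n. srw_pow n A t i k * srw_step n A k j)"

text \<open>Stationary distribution pi_k = deg(k) / 2|E| (and 2|E| = sum of degrees).\<close>
definition srw_stat :: "nat \<Rightarrow> (nat \<Rightarrow> nat \<Rightarrow> bool) \<Rightarrow> nat \<Rightarrow> real" where
  "srw_stat n A k = real (deg n A k) / (\<Sum>l<n. real (deg n A l))"

definition tv_from :: "nat \<Rightarrow> (nat \<Rightarrow> nat \<Rightarrow> bool) \<Rightarrow> nat \<Rightarrow> nat \<Rightarrow> real" where
  "tv_from n A i t = 1/2 * (\<Sum>j<n. \<bar>srw_pow n A t i j - srw_stat n A j\<bar>)"

text \<open>tau_i(delta) (infinite if the set is empty) and tau(delta) = max_i tau_i(delta).\<close>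
definition mix_time_from :: "nat \<Rightarrow> (nat \<Rightarrow> nat \<Rightarrow> bool) \<Rightarrow> real \<Rightarrow> nat \<Rightarrow> enat" where
  "mix_time_from n A \<delta> i = Inf (enat ` {t. \<forall>t'\<ge>t. tv_from n A i t' \<le> \<delta>})"

definition mix_time :: "nat \<Rightarrow> (nat \<Rightarrow> nat \<Rightarrow> bool) \<Rightarrow> real \<Rightarrow> enat" where
  "mix_time n A \<delta> = Sup (mix_time_from n A \<delta> ` {..<n})"

definition weight_cdf :: "(real \<Rightarrow> real) \<Rightarrow> real \<Rightarrow> real" where
  "weight_cdf f x = measure (density lborel f) {0..x}"

definition weight_quantile :: "(real \<Rightarrow> real) \<Rightarrow> real \<Rightarrow> real" where
  "weight_quantile f p = Inf {x. 0 \<le> x \<and> p \<le> weight_cdf f x}"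

definition gtg_space :: "(real \<Rightarrow> real) \<Rightarrow> nat \<Rightarrow> (nat \<Rightarrow> (real^'d) \<times> real) measure" where
  "gtg_space f n = PiM {..<n} (\<lambda>_. uniform_measure lborel (cbox 0 One) \<Otimes>\<^sub>M density lborel f)"

definition gtg_graph :: "nat \<Rightarrow> real \<Rightarrow> (nat \<Rightarrow> (real^'d) \<times> real) \<Rightarrow> nat \<Rightarrow> nat \<Rightarrow> bool" where
  "gtg_graph n \<theta> \<omega> = gtg_adj n \<theta> (\<lambda>i. fst (\<omega> i)) (\<lambda>i. snd (\<omega> i))"

end

theory Submission
  imports Defs "HOL-Real_Asymp.Real_Asymp"
begin

text \<open>
  The walk mixes in time \<open>O(\<Lambda> log n)\<close> as soon as \<open>\<Sum> deg(v) g(v)\<^sup>2 \<le> \<Lambda> \<Sum> (g(u) \<mp> g(v))\<^sup>2\<close>, the sums on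
  the right running over the edges (for mean-zero \<open>g\<close> in the case of the sign \<open>-\<close>), so it suffices to
  take \<open>\<Lambda>\<close> of order \<open>(n / log n) powr (2 / d)\<close>.

  The cube is cut into cells of volume about \<open>\<delta> log n / n\<close>, with \<open>\<delta>\<close> so small that a node of weight at
  least \<open>ws\<close> (a set of weights of positive probability) sees its own cell and all neighbouring cells. A
  cell is good if it contains at least \<open>h \<approx> \<eta> log n\<close> such heavy nodes. It fails to be good with probability
  \<open>n powr - a\<close>, where \<open>a > 0\<close> may be small, so bad cells exist in general, but no window of bounded size
  contains more than a constant number \<open>K\<close> of them. In a block of \<open>(2 K + 1) ^ d\<close> cells there is therefore a
  hyperplane of good cells in every direction; since \<open>d \<ge> 2\<close>, these hyperplanes connect to each other and
  to those of the neighbouring blocks. Averaging \<open>g\<close> over heavy nodes thus gives a function on the full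
  grid of blocks whose Dirichlet energy is at most a constant times \<open>1 / h\<^sup>2\<close> times that of \<open>g\<close>.

  The remaining nodes are attached to the hubs crudely. A node that is not adjacent to a hub has bounded
  weight and lies in a block with a bad cell, so its component outside the hub neighbourhood is confined
  to a bounded window, and connectedness of the graph provides the way out. The loss is polylogarithmic
  times the largest weight \<open>T\<close>, which the tail condition bounds by \<open>n powr \<gamma>\<close> with \<open>\<gamma> < 1 / d\<close>; this
  stays below \<open>\<Lambda>\<close>. Only on the coarse scale (blocks grouped \<open>p\<close> by \<open>p\<close>, out of \<open>p\<^sup>2\<close> per side) is a sharp
  bound for the total weight needed, and there it follows from a Chernoff bound.
\<close>

subsection \<open>Mixing time from Poincare inequalities\<close>

text \<open>The walk is not lazy, so the spectrum near -1 must be excluded as well as that near 1.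
  Hence the sign \<open>\<sigma>\<close> in the estimates; a triangle of heavy nodes in one cell
  settles the sign -1. \<open>\<Lambda>\<close> is a constant times p^4, with p^(2 d) of order n /
  log n. No logarithm is lost in it: averaging over pairs of heavy nodes gains h^2, of which one h
  is spent on degrees and one on the number of nodes per cell. Cells cannot be enlarged to make all
  of them good, since heavy nodes must still see the neighbouring cells. Instead K + 1 cells are
  treated jointly, which multiplies the exponent of the failure probability. The second scale is
  there because of T. A factor T is too much at the Poincare constant p^4 of the whole grid, but it
  can be afforded at the constant p^2 of one coarse cube, as T is at most p^2, that is, of order at
  most (n / log n)^(1/d). This asks for an exponent of T below 1 / d, while the union bound over the
  nodes asks for one above 1 / (d + \<open>\<nu>\<close>).\<close>

locale walk_graph =
  fixes n :: nat and A :: "nat \<Rightarrow> nat \<Rightarrow> bool"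
  assumes sym: "A i j \<Longrightarrow> A j i"
    and vert: "A i j \<Longrightarrow> i < n \<and> j < n"
begin

declare sum_of_bool_eq [simp del] sum_of_bool_mult_eq [simp del] sum_mult_of_bool_eq [simp del]

text \<open>The sum runs over ordered pairs, so each edge counts twice. For \<open>\<sigma>\<close>
  = 1 or -1 and P the transition operator \<open>markov\<close> this is 2 <g, (I -
  \<open>\<sigma>\<close> P) g> in the inner product \<open>ip\<close>, whose weight, the degree, is
  the unnormalised stationary measure.\<close>

definition energy :: "real \<Rightarrow> (nat \<Rightarrow> real) \<Rightarrow> real" where
  "energy \<sigma> g = (\<Sum>u<n. \<Sum>v<n. if A u v then (g u - \<sigma> * g v)\<^sup>2 else 0)"

definition ip :: "(nat \<Rightarrow> real) \<Rightarrow> (nat \<Rightarrow> real) \<Rightarrow> real" where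
  "ip f g = (\<Sum>i<n. real (deg n A i) * f i * g i)"

definition cross :: "(nat \<Rightarrow> real) \<Rightarrow> (nat \<Rightarrow> real) \<Rightarrow> real" where
  "cross f g = (\<Sum>u<n. \<Sum>v<n. of_bool (A u v) * f u * g v)"

definition markov :: "(nat \<Rightarrow> real) \<Rightarrow> nat \<Rightarrow> real" where
  "markov f i = (\<Sum>j<n. of_bool (A i j) * f j) / real (deg n A i)"

lemma adj_commute: "A i j \<longleftrightarrow> A j i"
  using sym by blast

lemma deg_eq_sum: "real (deg n A i) = (\<Sum>j<n. of_bool (A i j))"
proof -
  have "{j. j < n \<and> A i j} = {..<n} \<inter> {j. A i j}" by auto
  then show ?thesis unfolding deg_def by (simp add: sum_of_bool_eq)
qed

lemma cross_commute: "cross f g = cross g f"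
proof -
  have "cross f g = (\<Sum>v<n. \<Sum>u<n. of_bool (A u v) * f u * g v)"
    unfolding cross_def by (rule sum.swap)
  also have "\<dots> = cross g f"
    unfolding cross_def by (intro sum.cong refl) (simp add: adj_commute mult_ac)
  finally show ?thesis .
qed

lemma sum_deg_left:
  "(\<Sum>u<n. \<Sum>v<n. of_bool (A u v) * F u) = (\<Sum>u<n. real (deg n A u) * F u)" for F :: "nat \<Rightarrow> real"
  by (simp add: deg_eq_sum sum_distrib_right)

lemma sum_deg_right:
  "(\<Sum>u<n. \<Sum>v<n. of_bool (A u v) * F v) = (\<Sum>u<n. real (deg n A u) * F u)" for F :: "nat \<Rightarrow> real"
proof -
  have "(\<Sum>u<n. \<Sum>v<n. of_bool (A u v) * F v) = (\<Sum>v<n. \<Sum>u<n. of_bool (A u v) * F v)"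
    by (rule sum.swap)
  also have "\<dots> = (\<Sum>v<n. \<Sum>u<n. of_bool (A v u) * F v)"
    by (simp add: adj_commute)
  finally show ?thesis by (simp add: sum_deg_left)
qed

lemma energy_eq:
  assumes "\<sigma>\<^sup>2 = 1"
  shows "energy \<sigma> g = 2 * ip g g - 2 * \<sigma> * cross g g"
proof -
  have "energy \<sigma> g = (\<Sum>u<n. \<Sum>v<n. of_bool (A u v) * (g u)\<^sup>2 + of_bool (A u v) * (g v)\<^sup>2
       - 2 * \<sigma> * (of_bool (A u v) * g u * g v))"
    unfolding energy_def using assms
    by (intro sum.cong refl) (auto simp: power2_diff power_mult_distrib algebra_simps)
  also have "\<dots> = 2 * ip g g - 2 * \<sigma> * cross g g"
    unfolding sum.distrib sum_subtractf sum_deg_left sum_deg_right ip_def cross_def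
    by (simp add: sum_distrib_left power2_eq_square mult_ac)
  finally show ?thesis .
qed

lemma energy_nonneg: "0 \<le> energy \<sigma> g"
  unfolding energy_def by (intro sum_nonneg) auto

lemma ip_nonneg: "0 \<le> ip f f"
  unfolding ip_def by (intro sum_nonneg) (auto simp: mult.assoc)

lemma ip_add_left: "ip (\<lambda>i. a * f i + b * g i) k = a * ip f k + b * ip g k"
  unfolding ip_def by (simp add: sum_distrib_left sum.distrib[symmetric] algebra_simps)

lemma ip_commute: "ip f g = ip g f"
  unfolding ip_def by (simp add: mult_ac)

lemma cross_add_left: "cross (\<lambda>i. a * f i + b * g i) k = a * cross f k + b * cross g k"
  unfolding cross_def by (simp add: sum_distrib_left sum.distrib[symmetric] algebra_simps)

lemma ip_bilinear:
  "ip (\<lambda>i. a * f i + b * g i) (\<lambda>i. a * f i + b * g i) = a\<^sup>2 * ip f f + 2 * a * b * ip f g + b\<^sup>2 * ip g g"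
proof -
  have r: "ip k (\<lambda>i. a * f i + b * g i) = a * ip k f + b * ip k g" for k
    using ip_add_left[of a f b g k] by (simp add: ip_commute)
  show ?thesis
    unfolding ip_add_left r using ip_commute[of g f] by (simp add: power2_eq_square algebra_simps)
qed

lemma cross_bilinear:
  "cross (\<lambda>i. a * f i + b * g i) (\<lambda>i. a * f i + b * g i) = a\<^sup>2 * cross f f + 2 * a * b * cross f g + b\<^sup>2 * cross g g"
proof -
  have r: "cross k (\<lambda>i. a * f i + b * g i) = a * cross k f + b * cross k g" for k
    using cross_add_left[of a f b g k] by (simp add: cross_commute)
  show ?thesis
    unfolding cross_add_left r using cross_commute[of g f] by (simp add: power2_eq_square algebra_simps)
qed

section \<open>Contraction in the degree-weighted norm and the mixing time\<close>

context
  assumes deg_pos: "\<And>i. i < n \<Longrightarrow> 0 < deg n A i"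
begin

lemma ip_markov: "ip (markov f) g = cross f g"
proof -
  have "ip (markov f) g = (\<Sum>i<n. (\<Sum>j<n. of_bool (A i j) * f j) * g i)"
    unfolding ip_def markov_def by (intro sum.cong refl) (use deg_pos in force)
  also have "\<dots> = cross g f"
    unfolding cross_def by (simp add: sum_distrib_left sum_distrib_right mult_ac)
  finally show ?thesis by (simp add: cross_commute)
qed

lemma ip_markov_one: "ip (markov f) (\<lambda>_. 1) = ip f (\<lambda>_. 1)"
  by (simp add: ip_markov cross_commute[of f]) 
     (simp add: cross_def ip_def sum_deg_right)

text \<open>The two inequalities place P between \<open>- \<beta>\<close> and \<open>\<beta>\<close>
  as a quadratic form on the functions of mean zero, a space that P preserves. For a self-adjoint P
  this bounds the norm by \<open>\<beta>\<close>; no eigenvectors are used.\<close>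

lemma markov_contraction:
  assumes \<Lambda>: "\<Lambda> \<ge> 1"
    and gap: "\<And>g. ip g (\<lambda>_. 1) = 0 \<Longrightarrow> ip g g \<le> \<Lambda> * energy 1 g"
    and antigap: "\<And>g. ip g g \<le> \<Lambda> * energy (-1) g"
    and z: "ip z (\<lambda>_. 1) = 0"
  shows "ip (markov z) (markov z) \<le> (1 - 1 / (2 * \<Lambda>))\<^sup>2 * ip z z"
proof -
  define \<beta> where "\<beta> = 1 - 1 / (2 * \<Lambda>)"
  have \<beta>: "\<beta> > 0" using \<Lambda> by (simp add: \<beta>_def field_simps)
  define y where "y = markov z"
  have y1: "ip y (\<lambda>_. 1) = 0" using ip_markov_one z y_def by simp
  have up: "cross g g \<le> \<beta> * ip g g" if "ip g (\<lambda>_. 1) = 0" for g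
    using gap[OF that] \<Lambda> unfolding energy_eq[of 1 g, simplified] \<beta>_def
    by (simp add: field_simps)
  have lo: "- cross g g \<le> \<beta> * ip g g" for g
    using antigap[of g] \<Lambda> unfolding energy_eq[of "-1" g, simplified] \<beta>_def
    by (simp add: field_simps)
  have v1: "ip (\<lambda>i. \<beta> * z i + 1 * y i) (\<lambda>_. 1) = 0"
    unfolding ip_add_left using z y1 by simp
  have zy: "cross z y = ip y y" "ip z y = cross z z" 
    using ip_markov[of z y] ip_markov[of z z] ip_commute[of z y] by (simp_all add: y_def)
  text \<open>Positivity of \<open>\<beta> - P\<close> and \<open>\<beta> + P\<close> gives positivity of
    \<open>(\<beta> + P)(\<beta> - P)(\<beta> + P) + (\<beta> - P)(\<beta> + P)(\<beta> - P) = 2\<beta>(\<beta>\<^sup>2 - P\<^sup>2)\<close>.\<close>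
  have "\<beta>\<^sup>2 * cross z z + 2 * \<beta> * ip y y + cross y y
      \<le> \<beta> * (\<beta>\<^sup>2 * ip z z + 2 * \<beta> * ip z y + ip y y)"
    using up[OF v1] unfolding cross_bilinear ip_bilinear zy(1) by simp
  moreover have "- (\<beta>\<^sup>2 * cross z z - 2 * \<beta> * ip y y + cross y y)
      \<le> \<beta> * (\<beta>\<^sup>2 * ip z z - 2 * \<beta> * ip z y + ip y y)"
    using lo[of "\<lambda>i. \<beta> * z i + (-1) * y i"] unfolding cross_bilinear ip_bilinear zy(1) by simp
  ultimately have "4 * \<beta> * ip y y \<le> 2 * \<beta> * (\<beta>\<^sup>2 * ip z z + ip y y)"
    by (simp add: algebra_simps)
  then have "\<beta> * ip y y \<le> \<beta> * (\<beta>\<^sup>2 * ip z z)" by (simp add: algebra_simps)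
  then show ?thesis using \<beta> by (simp add: y_def \<beta>_def)
qed

text \<open>By reversibility the density of the law at time t with respect to the degrees evolves by
  \<open>markov\<close> itself. Its distance from the constant density contracts, and Cauchy-Schwarz
  passes from the weighted l2 norm to total variation at the cost of sqrt S, which is at most
  n.\<close>

lemma tv_from_le:
  assumes \<Lambda>: "\<Lambda> \<ge> 1"
    and gap: "\<And>g. ip g (\<lambda>_. 1) = 0 \<Longrightarrow> ip g g \<le> \<Lambda> * energy 1 g"
    and antigap: "\<And>g. ip g g \<le> \<Lambda> * energy (-1) g"
    and i: "i < n"
  shows "tv_from n A i t \<le> 1 / 2 * real n * (1 - 1 / (2 * \<Lambda>)) ^ t"
proof -
  define \<beta> where "\<beta> = 1 - 1 / (2 * \<Lambda>)"
  have \<beta>: "\<beta> > 0" using \<Lambda> by (simp add: \<beta>_def field_simps)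
  define S where "S = (\<Sum>l<n. real (deg n A l))"
  have "S \<ge> real (deg n A i)"
    unfolding S_def by (rule member_le_sum) (use i in auto)
  then have S: "S > 0" using deg_pos[OF i] by linarith
  have Sn: "S \<le> (real n)\<^sup>2"
  proof -
    have "deg n A l \<le> n" for l
      unfolding deg_def using card_mono[of "{..<n}" "{j. j < n \<and> A l j}"] by fastforce
    then have "S \<le> (\<Sum>l<n. real n)" unfolding S_def by (intro sum_mono) simp
    then show ?thesis by (simp add: power2_eq_square)
  qed
  define z where "z = (\<lambda>t j. srw_pow n A t i j / real (deg n A j) - 1 / S)"
  have step: "z (Suc t) j = markov (z t) j" if j: "j < n" for t j
  proof -
    have "markov (z t) j = (\<Sum>k<n. of_bool (A j k) * (srw_pow n A t i k / real (deg n A k))) / real (deg n A j)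
        - (\<Sum>k<n. of_bool (A j k)) * (1 / S) / real (deg n A j)"
      unfolding markov_def z_def
      by (simp add: sum_subtractf diff_divide_distrib sum_divide_distrib right_diff_distrib)
    also have "\<dots> = (\<Sum>k<n. of_bool (A j k) * (srw_pow n A t i k / real (deg n A k))) / real (deg n A j) - 1 / S"
      using deg_pos[OF j] by (simp add: deg_eq_sum[symmetric])
    also have "(\<Sum>k<n. of_bool (A j k) * (srw_pow n A t i k / real (deg n A k)))
        = (\<Sum>k<n. srw_pow n A t i k * srw_step n A k j)"
      unfolding srw_step_def by (intro sum.cong refl) (auto simp: adj_commute)
    finally show ?thesis by (simp add: z_def)
  qed
  have cong: "ip f g = ip f' g'" if "\<And>i. i < n \<Longrightarrow> f i = f' i" "\<And>i. i < n \<Longrightarrow> g i = g' i" for f f' g g'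
    unfolding ip_def using that by (intro sum.cong) auto
  have z0: "real (deg n A j) * z 0 j = of_bool (i = j) - real (deg n A j) / S" if "j < n" for j
    using deg_pos[OF that] by (simp add: z_def field_simps)
  have mean: "ip (z t) (\<lambda>_. 1) = 0" for t
  proof (induction t)
    case 0
    have "ip (z 0) (\<lambda>_. 1) = (\<Sum>j<n. of_bool (i = j) - real (deg n A j) / S)"
      unfolding ip_def using z0 by (intro sum.cong) auto
    also have "\<dots> = 0"
      using i S by (simp add: sum_subtractf sum_divide_distrib[symmetric] S_def[symmetric] of_bool_def)
    finally show ?case .
  next
    case (Suc t)
    have "ip (z (Suc t)) (\<lambda>_. 1) = ip (markov (z t)) (\<lambda>_. 1)" by (rule cong) (auto simp: step)
    then show ?case using Suc ip_markov_one by simp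
  qed
  have bnd: "ip (z t) (z t) \<le> (\<beta> ^ t)\<^sup>2" for t
  proof (induction t)
    case 0
    \<comment> \<open>Since z 0 has mean zero, the constant part of one factor drops out. What
      remains is z 0 i, which is at most 1 / deg i.\<close>
    have "ip (z 0) (z 0) = (\<Sum>j<n. (of_bool (i = j) - real (deg n A j) / S) * z 0 j)"
      unfolding ip_def using z0 by (intro sum.cong) auto
    also have "\<dots> = (\<Sum>j<n. of_bool (i = j) * z 0 j) - (\<Sum>j<n. real (deg n A j) * z 0 j * 1) / S"
      by (simp add: sum_subtractf[symmetric] sum_divide_distrib left_diff_distrib)
    also have "(\<Sum>j<n. real (deg n A j) * z 0 j * 1) = 0" using mean[of 0] by (simp add: ip_def)
    also have "(\<Sum>j<n. of_bool (i = j) * z 0 j) = (\<Sum>j<n. if i = j then z 0 j else 0)"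
      by (intro sum.cong) auto
    also have "\<dots> = z 0 i" using i by simp
    also have "z 0 i - 0 / S \<le> 1"
    proof -
      have "1 / real (deg n A i) \<le> 1" "0 < 1 / S" using S deg_pos[OF i] by auto
      moreover have "z 0 i - 0 / S = 1 / real (deg n A i) - 1 / S" by (simp add: z_def)
      ultimately show ?thesis by linarith
    qed
    finally show ?case by simp
  next
    case (Suc t)
    have "ip (z (Suc t)) (z (Suc t)) = ip (markov (z t)) (markov (z t))" by (rule cong) (auto simp: step)
    also have "\<dots> \<le> \<beta>\<^sup>2 * ip (z t) (z t)"
      unfolding \<beta>_def by (rule markov_contraction[OF \<Lambda> gap antigap mean])
    also have "\<dots> \<le> \<beta>\<^sup>2 * (\<beta> ^ t)\<^sup>2" using Suc by (intro mult_left_mono) auto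
    finally show ?case by (simp add: power_mult_distrib)
  qed
  have "(\<Sum>j<n. \<bar>srw_pow n A t i j - srw_stat n A j\<bar>) = (\<Sum>j<n. sqrt (deg n A j) * (sqrt (deg n A j) * \<bar>z t j\<bar>))"
  proof (intro sum.cong refl)
    fix j assume "j \<in> {..<n}"
    then have "srw_pow n A t i j - srw_stat n A j = real (deg n A j) * z t j"
      using deg_pos[of j] by (simp add: z_def srw_stat_def S_def field_simps)
    then show "\<bar>srw_pow n A t i j - srw_stat n A j\<bar> = sqrt (deg n A j) * (sqrt (deg n A j) * \<bar>z t j\<bar>)"
      by (simp add: abs_mult)
  qed
  also have "\<dots> \<le> L2_set (\<lambda>j. sqrt (deg n A j)) {..<n} * L2_set (\<lambda>j. sqrt (deg n A j) * \<bar>z t j\<bar>) {..<n}"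
    using L2_set_mult_ineq[of "\<lambda>j. sqrt (deg n A j)" "\<lambda>j. sqrt (deg n A j) * \<bar>z t j\<bar>" "{..<n}"] by simp
  also have "L2_set (\<lambda>j. sqrt (deg n A j)) {..<n} = sqrt S"
    by (simp add: L2_set_def S_def)
  also have "L2_set (\<lambda>j. sqrt (deg n A j) * \<bar>z t j\<bar>) {..<n} = sqrt (ip (z t) (z t))"
    by (simp add: L2_set_def ip_def power_mult_distrib power2_eq_square[of "z t _"] mult.assoc)
  also have "sqrt S * sqrt (ip (z t) (z t)) \<le> real n * \<beta> ^ t"
  proof (intro mult_mono)
    show "sqrt S \<le> real n" using Sn by (simp add: real_le_lsqrt S less_imp_le)
    show "sqrt (ip (z t) (z t)) \<le> \<beta> ^ t" using bnd[of t] \<beta> by (simp add: real_le_lsqrt ip_nonneg)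
  qed (use \<beta> ip_nonneg in auto)
  finally show ?thesis unfolding tv_from_def \<beta>_def by simp
qed

text \<open>After 4 \<open>\<Lambda>\<close> ln n steps the contraction factor is at most n^-2,
  which pays for the prefactor n / 2 and leaves at most 1 / n. Rounding up to an integer time is
  absorbed by the constant 5, as \<open>\<Lambda>\<close> ln n is at least 1.\<close>

lemma mix_time_le:
  assumes \<Lambda>: "\<Lambda> \<ge> 1"
    and gap: "\<And>g. ip g (\<lambda>_. 1) = 0 \<Longrightarrow> ip g g \<le> \<Lambda> * energy 1 g"
    and antigap: "\<And>g. ip g g \<le> \<Lambda> * energy (-1) g"
    and n: "exp 1 \<le> real n"
  shows "\<exists>m. mix_time n A (1 / real n) = enat m \<and> real m \<le> 5 * \<Lambda> * ln (real n)"
proof -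
  have npos: "real n > 0" using n exp_gt_zero[of "1::real"] by linarith
  have ln1: "ln (real n) \<ge> 1" using n npos by (simp add: ln_ge_iff)
  define t0 where "t0 = nat \<lceil>4 * \<Lambda> * ln (real n)\<rceil>"
  have t0: "4 * \<Lambda> * ln (real n) \<le> real t0" unfolding t0_def by linarith
  have "0 \<le> 4 * \<Lambda> * ln (real n)" using \<Lambda> ln1 by simp
  then have "real t0 \<le> 4 * \<Lambda> * ln (real n) + 1" unfolding t0_def by linarith
  moreover have "1 * 1 \<le> \<Lambda> * ln (real n)" using \<Lambda> ln1 by (intro mult_mono) auto
  ultimately have t0_le: "real t0 \<le> 5 * \<Lambda> * ln (real n)" by simp
  have tv: "tv_from n A i t \<le> 1 / real n" if "i < n" "t \<ge> t0" for i t
  proof -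
    have "(1 - 1 / (2 * \<Lambda>)) ^ t \<le> exp (- (1 / (2 * \<Lambda>))) ^ t"
      using \<Lambda> exp_ge_add_one_self[of "- (1 / (2 * \<Lambda>))"] by (intro power_mono) (auto simp: field_simps)
    also have "\<dots> = exp (- (real t / (2 * \<Lambda>)))" by (simp add: exp_of_nat_mult[symmetric])
    also have "\<dots> \<le> exp (- (2 * ln (real n)))"
    proof -
      have "4 * \<Lambda> * ln (real n) \<le> real t" using t0 that by linarith
      then show ?thesis using \<Lambda> by (simp add: field_simps)
    qed
    also have "\<dots> = 1 / (real n)\<^sup>2" using npos
      by (simp add: exp_minus exp_double power2_eq_square field_simps)
    finally have "1 / 2 * real n * (1 - 1 / (2 * \<Lambda>)) ^ t \<le> 1 / 2 * real n * (1 / (real n)\<^sup>2)"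
      using npos by (intro mult_left_mono) auto
    also have "\<dots> \<le> 1 / real n" using npos by (simp add: power2_eq_square field_simps)
    finally show ?thesis using tv_from_le[OF \<Lambda> gap antigap that(1), of t] by linarith
  qed
  have "mix_time_from n A (1 / real n) i \<le> enat t0" if "i < n" for i
    unfolding mix_time_from_def by (rule Inf_lower) (use tv that in auto)
  then have "mix_time n A (1 / real n) \<le> enat t0"
    unfolding mix_time_def by (intro Sup_least) auto
  then obtain m where "mix_time n A (1 / real n) = enat m" "m \<le> t0"
    by (cases "mix_time n A (1 / real n)") auto
  then show ?thesis using t0_le by (intro exI[of _ m]) auto
qed

end

end

subsection \<open>Poincare inequalities on grids\<close>

definition grid :: "nat \<Rightarrow> ('d::finite \<Rightarrow> nat) set" where
  "grid L = {x. \<forall>k. x k < L}"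

lemma prod_fun_eq_PiE: "{x. \<forall>k. x k \<in> S k} = PiE UNIV S" for S :: "'d \<Rightarrow> nat set"
  by (auto simp: PiE_def extensional_def)

lemma card_prod_fun: "card {x. \<forall>k. x k \<in> S k} = (\<Prod>k\<in>UNIV. card (S k))"
  for S :: "'d::finite \<Rightarrow> nat set"
  unfolding prod_fun_eq_PiE by (rule card_PiE) simp

lemma finite_prod_fun: "(\<And>k. finite (S k)) \<Longrightarrow> finite {x. \<forall>k. x k \<in> S k}"
  for S :: "'d::finite \<Rightarrow> nat set"
  unfolding prod_fun_eq_PiE by (rule finite_PiE) auto

lemma finite_grid [simp]: "finite (grid L :: ('d::finite \<Rightarrow> nat) set)"
  using finite_prod_fun[of "\<lambda>_::'d. {..<L}"] by (simp add: grid_def)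

lemma card_grid: "card (grid L :: ('d::finite \<Rightarrow> nat) set) = L ^ CARD('d)"
  using card_prod_fun[of "\<lambda>_::'d. {..<L}"] by (simp add: grid_def)

text \<open>Nearest-neighbour energy in direction k without wrap-around: treating the torus as a box
  only discards edges, and the Poincare constant keeps its order.\<close>

definition grad :: "nat \<Rightarrow> (('d::finite \<Rightarrow> nat) \<Rightarrow> real) \<Rightarrow> 'd \<Rightarrow> real" where
  "grad L H k = (\<Sum>x\<in>grid L. if x k + 1 < L then (H (x(k := x k + 1)) - H x)\<^sup>2 else 0)"

lemma grad_nonneg: "0 \<le> grad L H k"
  unfolding grad_def by (intro sum_nonneg) auto

lemma power2_sum_le: "(x + y)\<^sup>2 \<le> 2 * x\<^sup>2 + 2 * y\<^sup>2" for x y :: real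
  using zero_le_power2[of "x - y"] by (simp add: power2_eq_square algebra_simps)

text \<open>Telescoping and Cauchy-Schwarz. The sum is enlarged to the whole line, so that the bound
  no longer depends on the end points.\<close>

lemma line_variation:
  fixes \<phi> :: "nat \<Rightarrow> real"
  assumes "a < L" "b < L"
  shows "(\<phi> a - \<phi> b)\<^sup>2 \<le> real L * (\<Sum>t<L. if t + 1 < L then (\<phi> (t + 1) - \<phi> t)\<^sup>2 else 0)"
proof -
  have main: "(\<phi> b - \<phi> a)\<^sup>2 \<le> real L * (\<Sum>t<L. if t + 1 < L then (\<phi> (t + 1) - \<phi> t)\<^sup>2 else 0)"
    if "a \<le> b" "b < L" for a b
  proof -
    have "\<phi> b - \<phi> a = (\<Sum>t=a..<b. \<phi> (Suc t) - \<phi> t)"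
      using sum_Suc_diff'[OF that(1), of \<phi>] by simp
    then have "(\<phi> b - \<phi> a)\<^sup>2 \<le> real (card {a..<b}) * (\<Sum>t=a..<b. (\<phi> (Suc t) - \<phi> t)\<^sup>2)"
      using sum_squared_le_sum_of_squares[of "\<lambda>t. \<phi> (Suc t) - \<phi> t" "{a..<b}"]
      by (simp add: mult.commute)
    also have "\<dots> \<le> real L * (\<Sum>t<L. if t + 1 < L then (\<phi> (t + 1) - \<phi> t)\<^sup>2 else 0)"
    proof (intro mult_mono)
      have "(\<Sum>t=a..<b. (\<phi> (Suc t) - \<phi> t)\<^sup>2) = (\<Sum>t=a..<b. if t + 1 < L then (\<phi> (t + 1) - \<phi> t)\<^sup>2 else 0)"
        using that by (intro sum.cong) auto
      also have "\<dots> \<le> (\<Sum>t<L. if t + 1 < L then (\<phi> (t + 1) - \<phi> t)\<^sup>2 else 0)"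
        using that by (intro sum_mono2) auto
      finally show "(\<Sum>t=a..<b. (\<phi> (Suc t) - \<phi> t)\<^sup>2) \<le> (\<Sum>t<L. if t + 1 < L then (\<phi> (t + 1) - \<phi> t)\<^sup>2 else 0)" .
    qed (use that in \<open>auto intro!: sum_nonneg\<close>)
    finally show ?thesis .
  qed
  show ?thesis
  proof (cases "a \<le> b")
    case True
    then show ?thesis using main[of a b] assms by (simp add: power2_commute)
  next
    case False
    then show ?thesis using main[of b a] assms by simp
  qed
qed

text \<open>Exchanging the coordinate z k with t is an involution on the pairs (z, t), and it
  removes t from the summand.\<close>

lemma sum_grid_resample:
  fixes F :: "('d::finite \<Rightarrow> nat) \<Rightarrow> real"
  shows "(\<Sum>z\<in>grid L. \<Sum>t<L. F (z(k := t))) = real L * (\<Sum>z\<in>grid L. F z)"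
proof -
  have "(\<Sum>z\<in>grid L. \<Sum>t<L. F (z(k := t))) = (\<Sum>(z, t)\<in>grid L \<times> {..<L}. F (z(k := t)))"
    by (simp add: sum.cartesian_product)
  also have "\<dots> = (\<Sum>(z, t)\<in>grid L \<times> {..<L}. F z)"
    by (rule sum.reindex_bij_witness[where i = "\<lambda>(z, t). (z(k := t), z k)" and j = "\<lambda>(z, t). (z(k := t), z k)"])
       (auto simp: grid_def)
  also have "\<dots> = (\<Sum>z\<in>grid L. \<Sum>t<L. F z)" by (rule sum.cartesian_product[symmetric])
  finally show ?thesis by (simp add: sum_distrib_left)
qed

text \<open>Coordinates are resampled one at a time: with the coordinates in \<open>S\<close> already replaced,
  the mixed point is again uniformly distributed, so replacing one more costs a line variation.\<close>

lemma grid_poincare_partial: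
  fixes H :: "('d::finite \<Rightarrow> nat) \<Rightarrow> real" and S :: "'d set"
  shows "(\<Sum>x\<in>grid L. \<Sum>y\<in>grid L. (H x - H (override_on x y S))\<^sup>2)
    \<le> 2 ^ card S * real L ^ (CARD('d) + 2) * (\<Sum>k\<in>S. grad L H k)"
proof (induction rule: finite_induct[OF finite[of S]])
  case 1
  then show ?case by simp
next
  case insert: (2 k S)
  let ?D = "\<lambda>S. \<Sum>x\<in>grid L. \<Sum>y\<in>grid L. (H x - H (override_on x y S))\<^sup>2"
  let ?E = "\<Sum>x\<in>grid L. \<Sum>y\<in>grid L. (H (override_on x y S) - H (override_on x y (insert k S)))\<^sup>2"
  have "?D (insert k S) \<le> (\<Sum>x\<in>grid L. \<Sum>y\<in>grid L. 2 * (H x - H (override_on x y S))\<^sup>2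
      + 2 * (H (override_on x y S) - H (override_on x y (insert k S)))\<^sup>2)"
  proof (intro sum_mono)
    fix x y
    show "(H x - H (override_on x y (insert k S)))\<^sup>2 \<le> 2 * (H x - H (override_on x y S))\<^sup>2
      + 2 * (H (override_on x y S) - H (override_on x y (insert k S)))\<^sup>2"
      using power2_sum_le[of "H x - H (override_on x y S)" "H (override_on x y S) - H (override_on x y (insert k S))"]
      by simp
  qed
  also have "\<dots> = 2 * ?D S + 2 * ?E"
    by (simp add: sum.distrib sum_distrib_left)
  also have "?E = (\<Sum>z\<in>grid L. \<Sum>y\<in>grid L. (H z - H (z(k := y k)))\<^sup>2)"
  proof -
    have "?E = (\<Sum>(x, y)\<in>grid L \<times> grid L. (H (override_on x y S) - H (override_on x y (insert k S)))\<^sup>2)"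
      by (simp add: sum.cartesian_product)
    \<comment> \<open>Exchanging the coordinates in S between x and y is an involution; it makes the
      mixed point a free grid point z. The coordinate y k is untouched because k is not in
      S.\<close>
    also have "\<dots> = (\<Sum>(z, y)\<in>grid L \<times> grid L. (H z - H (z(k := y k)))\<^sup>2)"
    proof (rule sum.reindex_bij_witness[where i = "\<lambda>(x, y). (override_on x y S, override_on y x S)"
          and j = "\<lambda>(x, y). (override_on x y S, override_on y x S)"], goal_cases)
      case (5 a)
      obtain x y where a: "a = (x, y)" by fastforce
      have "override_on x y (insert k S) = (override_on x y S)(k := y k)"
        by (auto simp: override_on_def)
      then show ?case using insert a by (simp add: override_on_def)
    qed (auto simp: grid_def override_on_def fun_eq_iff)
    finally show ?thesis by (simp add: sum.cartesian_product)
  qed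
  also have "\<dots> \<le> (\<Sum>z\<in>grid L. \<Sum>y\<in>(grid L :: ('d \<Rightarrow> nat) set).
      real L * (\<Sum>t<L. if t + 1 < L then (H (z(k := t + 1)) - H (z(k := t)))\<^sup>2 else 0))"
  proof (intro sum_mono)
    fix z y :: "'d \<Rightarrow> nat" assume "z \<in> grid L" "y \<in> grid L"
    then show "(H z - H (z(k := y k)))\<^sup>2 \<le> real L * (\<Sum>t<L. if t + 1 < L then (H (z(k := t + 1)) - H (z(k := t)))\<^sup>2 else 0)"
      using line_variation[of "z k" L "y k" "\<lambda>t. H (z(k := t))"] by (simp add: grid_def)
  qed
  also have "\<dots> = real L ^ CARD('d) * (real L * (real L * grad L H k))"
  proof -
    have "(\<Sum>z\<in>grid L. \<Sum>t<L. if t + 1 < L then (H (z(k := t + 1)) - H (z(k := t)))\<^sup>2 else 0) = real L * grad L H k"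
      unfolding grad_def
      using sum_grid_resample[of "\<lambda>x. if x k + 1 < L then (H (x(k := x k + 1)) - H x)\<^sup>2 else 0" k L]
      unfolding fun_upd_upd fun_upd_same .
    then show ?thesis by (simp add: card_grid sum_distrib_left[symmetric])
  qed
  also have "2 * ?D S + 2 * (real L ^ CARD('d) * (real L * (real L * grad L H k)))
      \<le> 2 * (2 ^ card S * real L ^ (CARD('d) + 2) * (\<Sum>k\<in>S. grad L H k))
        + 2 * 2 ^ card S * real L ^ (CARD('d) + 2) * grad L H k"
  proof (intro add_mono)
    have "real L ^ CARD('d) * (real L * (real L * grad L H k)) = 1 * (real L ^ (CARD('d) + 2) * grad L H k)"
      by (simp add: power_add power2_eq_square)
    also have "\<dots> \<le> 2 ^ card S * (real L ^ (CARD('d) + 2) * grad L H k)"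
      by (rule mult_right_mono) (auto simp: grad_nonneg)
    finally show "2 * (real L ^ CARD('d) * (real L * (real L * grad L H k)))
        \<le> 2 * 2 ^ card S * real L ^ (CARD('d) + 2) * grad L H k" by simp
  qed (use insert in auto)
  also have "\<dots> = 2 ^ card (insert k S) * real L ^ (CARD('d) + 2) * (\<Sum>k\<in>insert k S. grad L H k)"
    using insert by (simp add: algebra_simps)
  finally show ?case by simp
qed

definition grid_mean :: "nat \<Rightarrow> (('d::finite \<Rightarrow> nat) \<Rightarrow> real) \<Rightarrow> real" where
  "grid_mean L H = (\<Sum>y\<in>grid L. H y) / real L ^ CARD('d)"

lemma jensen_grid_mean:
  fixes H :: "('d::finite \<Rightarrow> nat) \<Rightarrow> real"
  assumes "L > 0"
  shows "(c - grid_mean L H)\<^sup>2 \<le> (\<Sum>y\<in>grid L. (c - H y)\<^sup>2) / real L ^ CARD('d)"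
proof -
  let ?N = "real L ^ CARD('d)"
  have N: "?N > 0" using assms by simp
  have "?N * (c - grid_mean L H) = (\<Sum>y\<in>grid L. c - H y)"
    using N by (simp add: sum_subtractf card_grid grid_mean_def right_diff_distrib)
  then have "(?N * (c - grid_mean L H))\<^sup>2 \<le> ?N * (\<Sum>y\<in>grid L. (c - H y)\<^sup>2)"
    using sum_squared_le_sum_of_squares[of "\<lambda>y. c - H y" "grid L"] by (simp add: card_grid mult.commute)
  then have "?N * (?N * (c - grid_mean L H)\<^sup>2) \<le> ?N * (\<Sum>y\<in>grid L. (c - H y)\<^sup>2)"
    by (simp add: power2_eq_square mult_ac)
  then have "?N * (c - grid_mean L H)\<^sup>2 \<le> (\<Sum>y\<in>grid L. (c - H y)\<^sup>2)"
    using N by simp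
  then show ?thesis using N by (simp add: field_simps)
qed

text \<open>Jensen replaces the mean by an average over all y, so the pairwise bound with every
  coordinate resampled applies; dividing by L^d leaves the factor L^2.\<close>

lemma grid_poincare:
  fixes H :: "('d::finite \<Rightarrow> nat) \<Rightarrow> real"
  assumes "L > 0"
  shows "(\<Sum>x\<in>grid L. (H x - grid_mean L H)\<^sup>2)
    \<le> 2 ^ CARD('d) * (real L)\<^sup>2 * (\<Sum>k\<in>UNIV. grad L H k)"
proof -
  let ?N = "real L ^ CARD('d)"
  have N: "?N > 0" using assms by simp
  have "(\<Sum>x\<in>grid L. (H x - grid_mean L H)\<^sup>2) \<le> (\<Sum>x\<in>grid L. (\<Sum>y\<in>grid L. (H x - H y)\<^sup>2) / ?N)"
    by (intro sum_mono jensen_grid_mean assms)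
  also have "\<dots> = (\<Sum>x\<in>grid L. \<Sum>y\<in>grid L. (H x - H y)\<^sup>2) / ?N"
    by (simp add: sum_divide_distrib)
  also have "\<dots> \<le> (2 ^ CARD('d) * real L ^ (CARD('d) + 2) * (\<Sum>k\<in>UNIV. grad L H k)) / ?N"
    using grid_poincare_partial[of H UNIV L] N by (intro divide_right_mono) (auto simp: override_on_def)
  also have "\<dots> = 2 ^ CARD('d) * (real L)\<^sup>2 * (\<Sum>k\<in>UNIV. grad L H k)"
    using N assms by (simp add: power_add power2_eq_square)
  finally show ?thesis .
qed

section \<open>Coarse blocks and the two-scale inequality\<close>

lemma sum_grid_blocks:
  fixes F :: "('d::finite \<Rightarrow> nat) \<Rightarrow> real"
  assumes p: "p > 0"
  shows "(\<Sum>x\<in>grid (p * q). F x) = (\<Sum>C\<in>grid q. \<Sum>r\<in>grid p. F (\<lambda>k. p * C k + r k))"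
proof -
  have "(\<Sum>x\<in>grid (p * q). F x) = (\<Sum>(C, r)\<in>grid q \<times> grid p. F (\<lambda>k. p * C k + r k))"
  proof (rule sum.reindex_bij_witness[where i = "\<lambda>(C, r) k. p * C k + r k"
        and j = "\<lambda>x. (\<lambda>k. x k div p, \<lambda>k. x k mod p)"], goal_cases)
    case (2 x)
    then show ?case using p by (auto simp: grid_def less_mult_imp_div_less mult.commute)
  next
    case (4 b)
    obtain C r where b: "b = (C, r)" by fastforce
    have "p * C k + r k < p * q" for k
    proof -
      have "C k < q" "r k < p" using 4 b by (auto simp: grid_def)
      then have "p * C k + r k < p * (C k + 1)" by simp
      also have "\<dots> \<le> p * q" using \<open>C k < q\<close> by (intro mult_le_mono2) simp
      finally show ?thesis .
    qed
    then show ?case using b by (simp add: grid_def)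
  qed (use p in \<open>auto simp: grid_def fun_eq_iff\<close>)
  then show ?thesis by (simp add: sum.cartesian_product)
qed

text \<open>A step inside a block is a step of the full grid; the steps leading from one block to
  the next are dropped.\<close>

lemma sum_coarse_grad:
  fixes H :: "('d::finite \<Rightarrow> nat) \<Rightarrow> real"
  assumes p: "p > 0"
  shows "(\<Sum>C\<in>grid q. grad p (\<lambda>r. H (\<lambda>k. p * C k + r k)) k) \<le> grad (p * q) H k"
proof -
  have "(\<Sum>C\<in>grid q. grad p (\<lambda>r. H (\<lambda>k. p * C k + r k)) k)
    \<le> (\<Sum>C\<in>grid q. \<Sum>r\<in>grid p. (\<lambda>x. if x k + 1 < p * q then (H (x(k := x k + 1)) - H x)\<^sup>2 else 0) (\<lambda>k. p * C k + r k))"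
    unfolding grad_def
  proof (intro sum_mono)
    fix C r :: "'d \<Rightarrow> nat" assume C: "C \<in> grid q" and "r \<in> grid p"
    have "p * C k + r k + 1 < p * q" if "r k + 1 < p"
    proof -
      have "p * C k + r k + 1 < p * (C k + 1)" using that by simp
      also have "\<dots> \<le> p * q" using C by (intro mult_le_mono2) (auto simp: grid_def Suc_le_eq)
      finally show ?thesis .
    qed
    moreover have "(\<lambda>l. p * C l + (r(k := r k + 1)) l) = (\<lambda>l. p * C l + r l)(k := p * C k + r k + 1)"
      by (auto simp: fun_eq_iff)
    ultimately show "(if r k + 1 < p then (H (\<lambda>l. p * C l + (r(k := r k + 1)) l) - H (\<lambda>k. p * C k + r k))\<^sup>2 else 0)
      \<le> (\<lambda>x. if x k + 1 < p * q then (H (x(k := x k + 1)) - H x)\<^sup>2 else 0) (\<lambda>k. p * C k + r k)"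
      by simp
  qed
  also have "\<dots> = grad (p * q) H k" unfolding grad_def sum_grid_blocks[OF p] ..
  finally show ?thesis .
qed

text \<open>The weights \<open>\<mu>\<close> need only be spread out on the coarse scale \<open>p\<close>; on the fine scale the crude
  bound \<open>m1\<close> is multiplied by the much smaller Poincare constant \<open>p\<^sup>2\<close> of a coarse block.\<close>

lemma two_scale_poincare:
  fixes H :: "('d::finite \<Rightarrow> nat) \<Rightarrow> real" and Q :: "'v \<Rightarrow> 'd \<Rightarrow> nat" and \<mu> :: "'v \<Rightarrow> real"
  assumes p: "p > 0" and V: "finite V"
    and Q: "\<And>v. v \<in> V \<Longrightarrow> Q v \<in> grid (p * p)"
    and m1: "\<And>x. x \<in> grid (p * p) \<Longrightarrow> (\<Sum>v\<in>{v\<in>V. Q v = x}. \<mu> v) \<le> m1"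
    and m2: "\<And>C. C \<in> grid p \<Longrightarrow> (\<Sum>v\<in>{v\<in>V. (\<lambda>k. Q v k div p) = C}. \<mu> v) \<le> m2"
    and \<mu>: "\<And>v. v \<in> V \<Longrightarrow> 0 \<le> \<mu> v"
  shows "(\<Sum>v\<in>V. \<mu> v * (H (Q v) - grid_mean (p * p) H)\<^sup>2)
    \<le> 2 * 2 ^ CARD('d) * (m1 * (real p)\<^sup>2 + m2 * real p ^ 4 / real p ^ CARD('d)) * (\<Sum>k\<in>UNIV. grad (p * p) H k)"
proof -
  let ?a = "grid_mean (p * p) H" and ?G = "\<Sum>k\<in>UNIV. grad (p * p) H k" and ?P = "real p ^ CARD('d)"
  have P: "?P > 0" using p by simp
  define Hc where "Hc C = (\<lambda>r. H (\<lambda>k. p * C k + r k))" for C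
  define c where "c x = (\<lambda>k. x k div p)" for x :: "'d \<Rightarrow> nat"
  have c: "c x \<in> grid p" if "x \<in> grid (p * p)" for x
    using that p by (auto simp: grid_def c_def less_mult_imp_div_less)
  \<comment> \<open>The first part is the deviation from the mean of the coarse block containing Q
    v, the second the deviation of that mean from the global one.\<close>
  have "(\<Sum>v\<in>V. \<mu> v * (H (Q v) - ?a)\<^sup>2)
      \<le> (\<Sum>v\<in>V. \<mu> v * (2 * (H (Q v) - grid_mean p (Hc (c (Q v))))\<^sup>2 + 2 * (grid_mean p (Hc (c (Q v))) - ?a)\<^sup>2))"
    using power2_sum_le[of "H (Q v) - grid_mean p (Hc (c (Q v)))" "grid_mean p (Hc (c (Q v))) - ?a" for v]
    by (intro sum_mono mult_left_mono \<mu>) auto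
  also have "\<dots> = 2 * (\<Sum>v\<in>V. \<mu> v * (H (Q v) - grid_mean p (Hc (c (Q v))))\<^sup>2)
       + 2 * (\<Sum>v\<in>V. \<mu> v * (grid_mean p (Hc (c (Q v))) - ?a)\<^sup>2)"
    by (simp add: sum.distrib sum_distrib_left algebra_simps)
  also have "(\<Sum>v\<in>V. \<mu> v * (H (Q v) - grid_mean p (Hc (c (Q v))))\<^sup>2)
      = (\<Sum>x\<in>grid (p * p). \<Sum>v\<in>{v\<in>V. Q v = x}. \<mu> v * (H (Q v) - grid_mean p (Hc (c (Q v))))\<^sup>2)"
    using Q by (intro sum.group[symmetric] V) auto
  also have "\<dots> = (\<Sum>x\<in>grid (p * p). (\<Sum>v\<in>{v\<in>V. Q v = x}. \<mu> v) * (H x - grid_mean p (Hc (c x)))\<^sup>2)"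
    by (simp add: sum_distrib_right)
  also have "\<dots> \<le> (\<Sum>x\<in>grid (p * p). m1 * (H x - grid_mean p (Hc (c x)))\<^sup>2)"
    by (intro sum_mono mult_right_mono m1) auto
  also have "\<dots> = m1 * (\<Sum>C\<in>grid p. \<Sum>r\<in>grid p. (Hc C r - grid_mean p (Hc C))\<^sup>2)"
  proof -
    have e: "c (\<lambda>k. p * C k + r k) = C" if "r \<in> grid p" for C r
      using that p by (auto simp: c_def grid_def)
    show ?thesis unfolding sum_distrib_left[symmetric] sum_grid_blocks[OF p]
      by (intro arg_cong[where f = "\<lambda>x. m1 * x"] sum.cong refl) (simp add: e Hc_def)
  qed
  also have "\<dots> \<le> m1 * (2 ^ CARD('d) * (real p)\<^sup>2 * ?G)"
  proof (rule mult_left_mono)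
    have "(\<Sum>C\<in>grid p. \<Sum>r\<in>grid p. (Hc C r - grid_mean p (Hc C))\<^sup>2)
        \<le> (\<Sum>C\<in>grid p. 2 ^ CARD('d) * (real p)\<^sup>2 * (\<Sum>k\<in>UNIV. grad p (Hc C) k))"
      by (intro sum_mono grid_poincare p)
    also have "\<dots> = 2 ^ CARD('d) * (real p)\<^sup>2 * (\<Sum>k\<in>UNIV. \<Sum>C\<in>grid p. grad p (Hc C) k)"
      by (simp add: sum_distrib_left[symmetric] sum.swap[of _ UNIV])
    also have "\<dots> \<le> 2 ^ CARD('d) * (real p)\<^sup>2 * ?G"
      unfolding Hc_def by (intro mult_left_mono sum_mono sum_coarse_grad p) auto
    finally show "(\<Sum>C\<in>grid p. \<Sum>r\<in>grid p. (Hc C r - grid_mean p (Hc C))\<^sup>2) \<le> 2 ^ CARD('d) * (real p)\<^sup>2 * ?G" .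
    have "(\<lambda>_::'d. 0) \<in> grid (p * p)" using p by (auto simp: grid_def)
    moreover have "0 \<le> (\<Sum>v\<in>{v\<in>V. Q v = (\<lambda>_. 0)}. \<mu> v)" by (intro sum_nonneg) (auto simp: \<mu>)
    ultimately show "0 \<le> m1" using m1[of "\<lambda>_. 0"] by linarith
  qed
  also have "(\<Sum>v\<in>V. \<mu> v * (grid_mean p (Hc (c (Q v))) - ?a)\<^sup>2)
      = (\<Sum>C\<in>grid p. \<Sum>v\<in>{v\<in>V. c (Q v) = C}. \<mu> v * (grid_mean p (Hc (c (Q v))) - ?a)\<^sup>2)"
    using Q c by (intro sum.group[symmetric] V) auto
  also have "\<dots> = (\<Sum>C\<in>grid p. (\<Sum>v\<in>{v\<in>V. c (Q v) = C}. \<mu> v) * (?a - grid_mean p (Hc C))\<^sup>2)"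
    by (simp add: sum_distrib_right power2_commute)
  \<comment> \<open>By Jensen the squared deviation of a block mean is at most its average over the
    block, so m2 enters divided by the p^d points of a block.\<close>
  also have "\<dots> \<le> (\<Sum>C\<in>grid p. m2 * ((\<Sum>r\<in>grid p. (?a - Hc C r)\<^sup>2) / ?P))"
  proof (intro sum_mono mult_mono jensen_grid_mean p)
    fix C :: "'d \<Rightarrow> nat" assume C: "C \<in> grid p"
    show "(\<Sum>v\<in>{v\<in>V. c (Q v) = C}. \<mu> v) \<le> m2" using m2[OF C] by (simp add: c_def)
    moreover have "0 \<le> (\<Sum>v\<in>{v\<in>V. c (Q v) = C}. \<mu> v)" by (intro sum_nonneg) (auto simp: \<mu>)
    ultimately show "0 \<le> m2" by linarith
  qed auto
  also have "\<dots> = m2 / ?P * (\<Sum>x\<in>grid (p * p). (H x - ?a)\<^sup>2)"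
    unfolding sum_grid_blocks[OF p] Hc_def 
    by (simp add: sum_distrib_left sum_divide_distrib power2_commute)
  also have "\<dots> \<le> m2 / ?P * (2 ^ CARD('d) * (real (p * p))\<^sup>2 * ?G)"
  proof (intro mult_left_mono grid_poincare)
    have "0 \<le> (\<Sum>v\<in>{v\<in>V. (\<lambda>k. Q v k div p) = (\<lambda>_. 0)}. \<mu> v)" by (intro sum_nonneg) (auto simp: \<mu>)
    then have "0 \<le> m2" using m2[of "\<lambda>_. 0"] p by (simp add: grid_def)
    then show "0 \<le> m2 / ?P" by simp
  qed (use p in auto)
  finally show ?thesis by (simp add: power4_eq_xxxx power2_eq_square algebra_simps add_divide_distrib)
qed

subsection \<open>Cells of the torus\<close>

text \<open>A condition of the form \<open>int m - int q \<le> \<bar>_\<bar>\<close> accounts for the wrap-around of the torus.\<close>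

definition near :: "nat \<Rightarrow> nat \<Rightarrow> ('d \<Rightarrow> nat) \<Rightarrow> ('d \<Rightarrow> nat) \<Rightarrow> bool" where
  "near m q a b \<longleftrightarrow> (\<forall>k. \<bar>int (a k) - int (b k)\<bar> \<le> int q \<or> int m - int q \<le> \<bar>int (a k) - int (b k)\<bar>)"

lemma near_refl [simp]: "near m q a a"
  by (simp add: near_def)

lemma near_sym: "near m q a b \<longleftrightarrow> near m q b a"
  by (simp add: near_def abs_minus_commute)

lemma near_mono: "near m q a b \<Longrightarrow> q \<le> r \<Longrightarrow> near m r a b"
  unfolding near_def by (smt (verit) of_nat_le_iff)

text \<open>Triangle inequality for the cyclic distance. Membership in the grid rules out
  differences of m or more, which \<open>near\<close> would accept for every q.\<close>

lemma near_trans: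
  assumes "near m q a b" "near m r b c" "a \<in> grid m" "b \<in> grid m" "c \<in> grid m"
  shows "near m (q + r) a c"
  unfolding near_def
proof
  fix k
  have "\<bar>int (a k) - int (b k)\<bar> \<le> int q \<or> int m - int q \<le> \<bar>int (a k) - int (b k)\<bar>"
    "\<bar>int (b k) - int (c k)\<bar> \<le> int r \<or> int m - int r \<le> \<bar>int (b k) - int (c k)\<bar>"
    "a k < m" "b k < m" "c k < m"
    using assms by (auto simp: near_def grid_def)
  then show "\<bar>int (a k) - int (c k)\<bar> \<le> int (q + r) \<or> int m - int (q + r) \<le> \<bar>int (a k) - int (c k)\<bar>"
    by linarith
qed

lemma card_near:
  fixes b :: "'d::finite \<Rightarrow> nat"
  assumes "b \<in> grid m"
  shows "card {c \<in> grid m. near m q b c} \<le> (6 * q + 3) ^ CARD('d)"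
proof -
  \<comment> \<open>The interval of radius q around b k and its two translates by m cover the
    wrap-around: 3 (2 q + 1) = 6 q + 3 values in each coordinate.\<close>
  define I where "I k e = {int (b k) + e * int m - int q .. int (b k) + e * int m + int q}" for k and e :: int
  define S where "S k = nat ` (I k (-1) \<union> I k 0 \<union> I k 1)" for k
  have cS: "card (S k) \<le> 6 * q + 3" for k
  proof -
    have "card (S k) \<le> card (I k (-1) \<union> I k 0 \<union> I k 1)"
      unfolding S_def by (rule card_image_le) (auto simp: I_def)
    also have "\<dots> \<le> card (I k (-1)) + card (I k 0) + card (I k 1)"
      by (meson add_mono card_Un_le le_refl order_trans)
    also have "\<dots> \<le> 6 * q + 3" by (simp add: I_def)
    finally show ?thesis .
  qed
  have fS: "finite (S k)" for k by (auto simp: S_def I_def)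
  have "{c \<in> grid m. near m q b c} \<subseteq> {c. \<forall>k. c k \<in> S k}"
  proof safe
    fix c :: "'d \<Rightarrow> nat" and k
    assume c: "near m q b c"
    have S: "c k \<in> S k" if "int (c k) \<in> I k e" "e \<in> {-1, 0, 1}" for e
      unfolding S_def by (intro image_eqI[of _ _ "int (c k)"]) (use that in auto)
    have "\<bar>int (b k) - int (c k)\<bar> \<le> int q \<or> int m - int q \<le> \<bar>int (b k) - int (c k)\<bar>"
      using c by (auto simp: near_def)
    moreover assume "c \<in> grid m"
    then have "c k < m" by (simp add: grid_def)
    moreover have "b k < m" using assms by (simp add: grid_def)
    ultimately have "int (c k) \<in> I k 0 \<or> int (c k) \<in> I k 1 \<or> int (c k) \<in> I k (-1)"
      unfolding I_def by auto
    then show "c k \<in> S k" using S by blast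
  qed
  then have "card {c \<in> grid m. near m q b c} \<le> card {c. \<forall>k. c k \<in> S k}"
    by (intro card_mono finite_prod_fun fS)
  also have "\<dots> \<le> (\<Prod>k\<in>(UNIV :: 'd set). 6 * q + 3)"
    unfolding card_prod_fun by (intro prod_mono) (use cS in auto)
  finally show ?thesis by simp
qed

section \<open>Paths, exits and integer roots\<close>

lemma interval_connected:
  fixes lo hi :: "'d::finite \<Rightarrow> nat"
  defines "P \<equiv> {b. \<forall>k. lo k \<le> b k \<and> b k \<le> hi k}"
  assumes "x \<in> P" "y \<in> P"
  shows "(x, y) \<in> {(u, v). u \<in> P \<and> v \<in> P \<and> near m 1 u v}\<^sup>*"
  using \<open>x \<in> P\<close>
proof (induction "\<Sum>k\<in>UNIV. nat \<bar>int (x k) - int (y k)\<bar>" arbitrary: x rule: less_induct)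
  case less
  show ?case
  proof (cases "x = y")
    case False
    then obtain k where k: "x k \<noteq> y k" by auto
    \<comment> \<open>Moving one coordinate by one towards y stays in the box and lowers the l1
      distance, which is the induction measure.\<close>
    define z where "z = x(k := (if x k < y k then x k + 1 else x k - 1))"
    have "lo l \<le> z l \<and> z l \<le> hi l" for l
    proof -
      have "lo l \<le> x l" "x l \<le> hi l" "lo l \<le> y l" "y l \<le> hi l"
        using less.prems \<open>y \<in> P\<close> unfolding P_def by auto
      then show ?thesis using k by (cases "l = k") (auto simp: z_def)
    qed
    then have z: "z \<in> P" by (simp add: P_def)
    have "(\<Sum>k\<in>UNIV. nat \<bar>int (z k) - int (y k)\<bar>) < (\<Sum>k\<in>UNIV. nat \<bar>int (x k) - int (y k)\<bar>)"
      by (rule sum_strict_mono_ex1) (use k in \<open>auto simp: z_def intro!: exI[of _ k]\<close>)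
    then have "(z, y) \<in> {(u, v). u \<in> P \<and> v \<in> P \<and> near m 1 u v}\<^sup>*" using less.hyps z by blast
    moreover have "near m 1 x z" using k unfolding near_def z_def by auto
    ultimately show ?thesis using less.prems z by (intro converse_rtrancl_into_rtrancl[of x z]) auto
  qed simp
qed

text \<open>The factor \<open>(card R)\<^sup>2\<close> is wasteful, but needs no control over repeated edges of the path.\<close>

lemma rtrancl_diff_le:
  fixes f :: "'a \<Rightarrow> real"
  assumes "finite R" and "(x, y) \<in> R\<^sup>*" and \<sigma>: "\<sigma>\<^sup>2 = 1"
  shows "\<exists>s. s\<^sup>2 = 1 \<and> (\<sigma> = 1 \<longrightarrow> s = 1) \<and>
    (f x - s * f y)\<^sup>2 \<le> (real (card R))\<^sup>2 * (\<Sum>(u, v)\<in>R. (f u - \<sigma> * f v)\<^sup>2)"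
proof -
  obtain N where N: "N \<le> card R" "(x, y) \<in> R ^^ N"
    using assms rtrancl_finite_eq_relpow[of R] by auto
  then obtain \<phi> where \<phi>: "\<phi> 0 = x" "\<phi> N = y" "\<And>i. i < N \<Longrightarrow> (\<phi> i, \<phi> (Suc i)) \<in> R"
    unfolding relpow_fun_conv by auto
  let ?B = "\<Sum>(u, v)\<in>R. (f u - \<sigma> * f v)\<^sup>2"
  have B: "0 \<le> ?B" by (intro sum_nonneg) auto
  have s: "(\<sigma> ^ i)\<^sup>2 = 1" for i using \<sigma> by (metis power_mult power_commutes mult.commute power_one)
  \<comment> \<open>Twisting by powers of \<open>\<sigma>\<close> makes the sum telescope into the
    edge terms f u - \<open>\<sigma>\<close> f v. The sign left at the end is
    \<open>\<sigma> ^ N\<close>, which is 1 if \<open>\<sigma>\<close> is 1 and depends on the path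
    otherwise.\<close>
  have "f x - \<sigma> ^ N * f y = (\<Sum>i<N. \<sigma> ^ i * f (\<phi> i) - \<sigma> ^ Suc i * f (\<phi> (Suc i)))"
    using sum_lessThan_telescope'[of "\<lambda>i. \<sigma> ^ i * f (\<phi> i)" N] \<phi> by simp
  also have "\<dots> = (\<Sum>i<N. \<sigma> ^ i * (f (\<phi> i) - \<sigma> * f (\<phi> (Suc i))))"
    by (simp add: algebra_simps)
  finally have "(f x - \<sigma> ^ N * f y)\<^sup>2 \<le> (\<Sum>i<N. (\<sigma> ^ i * (f (\<phi> i) - \<sigma> * f (\<phi> (Suc i))))\<^sup>2) * real N"
    using sum_squared_le_sum_of_squares[of "\<lambda>i. \<sigma> ^ i * (f (\<phi> i) - \<sigma> * f (\<phi> (Suc i)))" "{..<N}"] by simp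
  also have "\<dots> \<le> (\<Sum>i<N. ?B) * real N"
  proof (intro mult_right_mono sum_mono)
    fix i assume "i \<in> {..<N}"
    then have "(\<lambda>(u, v). (f u - \<sigma> * f v)\<^sup>2) (\<phi> i, \<phi> (Suc i)) \<le> ?B"
      using \<phi>(3) assms(1) by (intro member_le_sum) auto
    then show "(\<sigma> ^ i * (f (\<phi> i) - \<sigma> * f (\<phi> (Suc i))))\<^sup>2 \<le> ?B"
      by (simp add: power_mult_distrib s)
  qed simp
  also have "\<dots> = (real N)\<^sup>2 * ?B" by (simp add: power2_eq_square)
  also have "\<dots> \<le> (real (card R))\<^sup>2 * ?B"
    using N B by (intro mult_right_mono power_mono) auto
  finally show ?thesis using s[of N] by (intro exI[of _ "\<sigma> ^ N"]) auto
qed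

lemma first_exit:
  assumes "A\<^sup>*\<^sup>* v x" "v \<in> S" "x \<notin> S"
  shows "\<exists>u y. (v, u) \<in> {(a, b). A a b \<and> a \<in> S \<and> b \<in> S}\<^sup>* \<and> u \<in> S \<and> y \<notin> S \<and> A u y"
  using assms
proof (induction rule: converse_rtranclp_induct)
  case (step v z)
  show ?case
  proof (cases "z \<in> S")
    case True
    then obtain u y where u: "(z, u) \<in> {(a, b). A a b \<and> a \<in> S \<and> b \<in> S}\<^sup>*" "u \<in> S" "y \<notin> S" "A u y"
      using step by blast
    then have "(v, u) \<in> {(a, b). A a b \<and> a \<in> S \<and> b \<in> S}\<^sup>*"
      using step True by (intro converse_rtrancl_into_rtrancl[OF _ u(1)]) auto
    then show ?thesis using u by blast
  next
    case False
    then show ?thesis using step by blast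
  qed
qed auto

lemma power_add_le:
  fixes a b :: real
  assumes "0 \<le> a" "0 \<le> b"
  shows "(a + b) ^ d \<le> 2 ^ d * (a ^ d + b ^ d)"
proof -
  have "(a + b) ^ d \<le> (2 * max a b) ^ d" using assms by (intro power_mono) auto
  also have "\<dots> = 2 ^ d * max a b ^ d" by (simp add: power_mult_distrib)
  also have "\<dots> \<le> 2 ^ d * (a ^ d + b ^ d)" using assms by (intro mult_left_mono) (auto simp: max_def)
  finally show ?thesis .
qed

text \<open>The least q works: q - 1 fails the strict inequality, and q = (q - 1) + 1 bounds the
  rounding error. It turns a weight into a range measured in whole cells.\<close>

lemma nat_root_bound:
  fixes x :: real
  assumes "0 \<le> x" "d > 0"
  shows "\<exists>q\<ge>1. x < real q ^ d \<and> real q ^ d \<le> 2 ^ d * (x + 1)"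
proof -
  define q where "q = (LEAST q. x < real q ^ d)"
  obtain k where k: "x < real k" using reals_Archimedean2 by blast
  then have "k > 0" using assms by (intro gr0I) auto
  then have "real k ^ 1 \<le> real k ^ d" using assms by (intro power_increasing) auto
  then have "x < real k ^ d" using k unfolding power_one_right by linarith
  then have q: "x < real q ^ d" unfolding q_def by (rule LeastI)
  then have q1: "q \<ge> 1" using assms by (cases "q = 0") (auto simp: power_0_left)
  have "\<not> x < real (q - 1) ^ d" using q1 unfolding q_def by (intro not_less_Least) auto
  then have "real (q - 1) ^ d \<le> x" by simp
  moreover have "real q ^ d \<le> 2 ^ d * (real (q - 1) ^ d + 1)"
    using power_add_le[of "real (q - 1)" 1 d] q1 by (simp add: of_nat_diff)
  ultimately have "real q ^ d \<le> 2 ^ d * (x + 1)"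
    by (smt (verit) mult_left_mono zero_le_power)
  then show ?thesis using q q1 by blast
qed

subsection \<open>Good cells and hubs\<close>

text \<open>There are \<open>m = M p\<^sup>2\<close> cells, \<open>p\<^sup>2\<close> blocks and \<open>p\<close> coarse cubes per side. The constants \<open>kl\<close> and
  \<open>ku\<close> enclose the threshold times the cell volume, up to the factor \<open>sqrt d ^ d\<close> in \<open>ku\<close>. A node of
  weight at least \<open>wb\<close> sees its whole block; two lighter nodes are adjacent only within \<open>R\<close> cells, any
  two nodes only within \<open>\<rho>\<close> cells. Only \<open>n\<close>, \<open>p\<close>, \<open>h\<close>, \<open>\<rho>\<close> and \<open>T\<close> grow, so a bound in terms of the
  other parameters is uniform.\<close>

locale gtg_config = walk_graph n A
  for n :: nat and A :: "nat \<Rightarrow> nat \<Rightarrow> bool" +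
  fixes cell :: "nat \<Rightarrow> 'd::finite \<Rightarrow> nat" and w :: "nat \<Rightarrow> real"
    and d K M p m W R h \<rho> :: nat and T kl ku ws wb C0 C1 C\<rho> :: real
  assumes d: "d = CARD('d)" "2 \<le> d"
    and M: "M = 2 * K + 1" and m: "m = M * (p * p)"
    and irrefl: "\<not> A i i"
    and conn: "graph_connected n A"
    and n2: "2 \<le> n"
    and p: "0 < p" and h: "3 \<le> h" and T: "1 \<le> T" and kl: "0 < kl" and ku: "0 \<le> ku"
    and C0: "1 \<le> C0" and C1: "0 \<le> C1"
    and cell_grid: "i < n \<Longrightarrow> cell i \<in> grid m"
    and w_nonneg: "i < n \<Longrightarrow> 0 \<le> w i" and w_le: "i < n \<Longrightarrow> w i \<le> T"
    and adjI: "\<lbrakk>i < n; j < n; i \<noteq> j; near m q (cell i) (cell j); ku * (real q + 1) ^ d \<le> w i + w j\<rbrakk> \<Longrightarrow> A i j"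
    and adjD: "\<lbrakk>A i j; w i + w j < kl * real q ^ d\<rbrakk> \<Longrightarrow> near m q (cell i) (cell j)"
    and cell_count: "b \<in> grid m \<Longrightarrow> real (card {i. i < n \<and> cell i = b}) \<le> C0 * real h"
    and bad_count: "b \<in> grid m \<Longrightarrow>
      card {c \<in> grid m. near m W b c \<and> card {i. i < n \<and> cell i = c \<and> ws \<le> w i} < h} \<le> K"
    and coarse_mass: "C \<in> grid p \<Longrightarrow>
      (\<Sum>i\<in>{i. i < n \<and> (\<lambda>k. cell i k div M div p) = C}. w i + 1) \<le> C1 * real p ^ d * real h"
    and ws: "ku * 2 ^ d \<le> ws"
    and wb: "wb = ku * (real M + 1) ^ d"
    and R: "2 * wb < kl * real R ^ d"
    and W: "(K * K + 1) * (R + 2 * M) + 2 * M \<le> W"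
    and \<rho>: "2 * T < kl * real \<rho> ^ d" "real \<rho> ^ d \<le> C\<rho> * T"
    and T_p: "T \<le> (real p)\<^sup>2" "T * real h ^ 6 \<le> real p ^ 4"
begin

definition good :: "('d \<Rightarrow> nat) \<Rightarrow> bool" where
  "good b \<longleftrightarrow> h \<le> card {i. i < n \<and> cell i = b \<and> ws \<le> w i}"

text \<open>Exactly h heavy nodes are picked, so the averages over any two good cells run over the
  same number of nodes and their difference is an average over h^2 pairs.\<close>

definition Sel :: "('d \<Rightarrow> nat) \<Rightarrow> nat set" where
  "Sel b = (SOME S. S \<subseteq> {i. i < n \<and> cell i = b \<and> ws \<le> w i} \<and> card S = h)"

definition block_of :: "('d \<Rightarrow> nat) \<Rightarrow> 'd \<Rightarrow> nat" where
  "block_of b = (\<lambda>k. b k div M)"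

definition block :: "('d \<Rightarrow> nat) \<Rightarrow> ('d \<Rightarrow> nat) set" where
  "block Q = {b \<in> grid m. block_of b = Q}"

definition slice :: "'d \<Rightarrow> nat \<Rightarrow> ('d \<Rightarrow> nat) \<Rightarrow> ('d \<Rightarrow> nat) set" where
  "slice j a Q = {b \<in> block Q. b j mod M = a}"

definition good_slices :: "'d \<Rightarrow> ('d \<Rightarrow> nat) \<Rightarrow> nat set" where
  "good_slices j Q = {a. a < M \<and> (\<forall>b\<in>slice j a Q. good b)}"

definition hub_cells :: "('d \<Rightarrow> nat) \<Rightarrow> ('d \<Rightarrow> nat) set" where
  "hub_cells Q = {b. \<exists>j. \<exists>a\<in>good_slices j Q. b \<in> slice j a Q}"

definition steps :: "('d \<Rightarrow> nat) set \<Rightarrow> (('d \<Rightarrow> nat) \<times> ('d \<Rightarrow> nat)) set" where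
  "steps S = {(u, v). u \<in> S \<and> v \<in> S \<and> near m 1 u v}"

lemma M_pos: "0 < M" using M by simp

lemma steps_mono: "S \<subseteq> S' \<Longrightarrow> (x, y) \<in> (steps S)\<^sup>* \<Longrightarrow> (x, y) \<in> (steps S')\<^sup>*"
  by (erule rtrancl_mono[THEN subsetD, rotated]) (auto simp: steps_def)

lemma Sel:
  assumes "good b"
  shows "Sel b \<subseteq> {i. i < n \<and> cell i = b \<and> ws \<le> w i}" "card (Sel b) = h" "finite (Sel b)"
proof -
  have "\<exists>S. S \<subseteq> {i. i < n \<and> cell i = b \<and> ws \<le> w i} \<and> card S = h"
    using obtain_subset_with_card_n[OF assms[unfolded good_def]] by blast
  then have *: "Sel b \<subseteq> {i. i < n \<and> cell i = b \<and> ws \<le> w i} \<and> card (Sel b) = h"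
    unfolding Sel_def by (rule someI_ex)
  then show "Sel b \<subseteq> {i. i < n \<and> cell i = b \<and> ws \<le> w i}" "card (Sel b) = h" by auto
  show "finite (Sel b)" using * finite_subset[of "Sel b" "{..<n}"] by auto
qed

lemma block_of_grid: "b \<in> grid m \<Longrightarrow> block_of b \<in> grid (p * p)"
  using M_pos by (auto simp: grid_def block_of_def m less_mult_imp_div_less mult.commute)

lemma block_of_near: "block_of b = block_of c \<Longrightarrow> near m M b c"
proof -
  assume e: "block_of b = block_of c"
  have "\<bar>int (b k) - int (c k)\<bar> \<le> int M" for k
  proof -
    have "b k div M = c k div M" using fun_cong[OF e, of k] by (simp add: block_of_def)
    then have "b k = M * (c k div M) + b k mod M" "c k = M * (c k div M) + c k mod M"
      by (metis mult_div_mod_eq)+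
    moreover have "b k mod M < M" "c k mod M < M" using M_pos by simp_all
    ultimately have "b k \<le> c k + M" "c k \<le> b k + M" by linarith+
    then show ?thesis by linarith
  qed
  then show ?thesis by (simp add: near_def)
qed

lemma block_point:
  assumes "Q \<in> grid (p * p)" "\<And>k. r k < M"
  shows "(\<lambda>k. M * Q k + r k) \<in> block Q"
proof -
  have "M * Q k + r k < m" for k
  proof -
    have "M * Q k + r k < M * (Q k + 1)" using assms(2)[of k] by simp
    also have "\<dots> \<le> M * (p * p)" using assms(1) by (intro mult_le_mono2) (auto simp: grid_def Suc_le_eq)
    finally show ?thesis by (simp add: m)
  qed
  then show ?thesis using assms(2) M_pos by (auto simp: block_def grid_def block_of_def)
qed

lemma bad_in_block:
  assumes "Q \<in> grid (p * p)"
  shows "card {b \<in> block Q. \<not> good b} \<le> K"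
proof -
  have b0: "(\<lambda>k. M * Q k + 0) \<in> block Q" using assms M_pos by (intro block_point) auto
  have MW: "M \<le> W" using W by simp
  have "{b \<in> block Q. \<not> good b} \<subseteq> {c \<in> grid m. near m W (\<lambda>k. M * Q k + 0) c \<and> card {i. i < n \<and> cell i = c \<and> ws \<le> w i} < h}"
    using b0 block_of_near near_mono[OF _ MW] unfolding block_def good_def by fastforce
  then have "card {b \<in> block Q. \<not> good b} \<le> card {c \<in> grid m. near m W (\<lambda>k. M * Q k + 0) c \<and> card {i. i < n \<and> cell i = c \<and> ws \<le> w i} < h}"
    by (intro card_mono) auto
  also have "\<dots> \<le> K" using b0 by (intro bad_count) (auto simp: block_def)
  finally show ?thesis .
qed

text \<open>In direction j each bad cell spoils a single one of the 2 K + 1 slices, so a strict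
  majority of them stays good.\<close>

lemma card_good_slices:
  assumes "Q \<in> grid (p * p)"
  shows "K + 1 \<le> card (good_slices j Q)"
proof -
  have "{..<M} - good_slices j Q \<subseteq> (\<lambda>b. b j mod M) ` {b \<in> block Q. \<not> good b}"
    by (auto simp: good_slices_def slice_def)
  then have "card ({..<M} - good_slices j Q) \<le> card ((\<lambda>b. b j mod M) ` {b \<in> block Q. \<not> good b})"
    by (intro card_mono finite_imageI) (auto simp: block_def)
  also have "\<dots> \<le> card {b \<in> block Q. \<not> good b}"
    by (intro card_image_le) (auto simp: block_def)
  also have "\<dots> \<le> K" by (rule bad_in_block[OF assms])
  finally have "card ({..<M} - good_slices j Q) \<le> K" .
  moreover have "good_slices j Q \<subseteq> {..<M}" by (auto simp: good_slices_def)
  then have "card ({..<M} - good_slices j Q) = M - card (good_slices j Q)"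
    by (simp add: card_Diff_subset finite_subset)
  ultimately show ?thesis using M by linarith
qed

lemma good_slices_nonempty: "Q \<in> grid (p * p) \<Longrightarrow> \<exists>a. a \<in> good_slices j Q"
  using card_good_slices[of Q j] by (metis Suc_eq_plus1 card.empty ex_in_conv not_less_eq_eq zero_le)

text \<open>Two strict majorities of the M offsets must meet. For neighbouring blocks the common
  offset is a hyperplane that continues straight from one into the other.\<close>

lemma good_slices_common:
  assumes "Q \<in> grid (p * p)" "Q' \<in> grid (p * p)"
  shows "\<exists>a. a \<in> good_slices j Q \<and> a \<in> good_slices j Q'"
proof (rule ccontr)
  assume "\<not> ?thesis"
  then have "good_slices j Q \<inter> good_slices j Q' = {}" by auto
  moreover have sub: "good_slices j Q \<union> good_slices j Q' \<subseteq> {..<M}" by (auto simp: good_slices_def)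
  moreover have "finite (good_slices j Q)" "finite (good_slices j Q')"
    using sub by (auto intro: finite_subset[of _ "{..<M}"])
  ultimately have "card (good_slices j Q) + card (good_slices j Q') \<le> card {..<M}"
    by (metis card_Un_disjoint card_mono finite_lessThan)
  then show False using card_good_slices[OF assms(1), of j] card_good_slices[OF assms(2), of j] M by simp
qed

section \<open>Connectedness of the hubs\<close>

lemma slice_connected:
  assumes Q: "Q \<in> grid (p * p)" and a: "a < M" and x: "x \<in> slice j a Q" and y: "y \<in> slice j a Q"
  shows "(x, y) \<in> (steps (slice j a Q))\<^sup>*"
proof -
  \<comment> \<open>A slice is a box, thin in direction j, so the connectedness of boxes applies to
    it.\<close>
  define lo where "lo = (\<lambda>k. if k = j then M * Q k + a else M * Q k)"
  define hi where "hi = (\<lambda>k. if k = j then M * Q k + a else M * Q k + (M - 1))"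
  have "slice j a Q = {b. \<forall>k. lo k \<le> b k \<and> b k \<le> hi k}"
  proof (intro equalityI subsetI CollectI allI)
    fix b k assume "b \<in> slice j a Q"
    then have b: "b k div M = Q k" "k = j \<Longrightarrow> b k mod M = a"
      by (auto simp: slice_def block_def block_of_def)
    have "b k = M * (b k div M) + b k mod M" "b k mod M < M" using M_pos by simp_all
    then have "b k = M * Q k + b k mod M" "b k mod M \<le> M - 1" by (simp_all add: b(1))
    then show "lo k \<le> b k \<and> b k \<le> hi k" using b(2) by (auto simp: lo_def hi_def)
  next
    fix b assume "b \<in> {b. \<forall>k. lo k \<le> b k \<and> b k \<le> hi k}"
    then have b: "lo k \<le> b k" "b k \<le> hi k" for k by auto
    define r where "r k = b k - M * Q k" for k
    have r: "r k < M" "b k = M * Q k + r k" for k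
      using b[of k] a M_pos by (auto simp: lo_def hi_def r_def split: if_splits)
    have "b = (\<lambda>k. M * Q k + r k)" using r by auto
    then have "b \<in> block Q" using block_point[OF Q, of r] r by simp
    moreover have "b j = M * Q j + a" using b[of j] by (auto simp: lo_def hi_def)
    ultimately show "b \<in> slice j a Q" using a by (simp add: slice_def)
  qed
  then show ?thesis using interval_connected[of x lo hi y m] x y unfolding steps_def by simp
qed

lemma slices_meet:
  assumes "Q \<in> grid (p * p)" "j \<noteq> j'" "a < M" "a' < M"
  shows "\<exists>z. z \<in> slice j a Q \<and> z \<in> slice j' a' Q"
proof -
  let ?r = "\<lambda>k. if k = j then a else if k = j' then a' else 0"
  have "(\<lambda>k. M * Q k + ?r k) \<in> block Q" using assms M_pos by (intro block_point) auto
  then show ?thesis using assms by (intro exI[of _ "\<lambda>k. M * Q k + ?r k"]) (auto simp: slice_def)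
qed

lemma other_direction: "\<exists>j'. j' \<noteq> (j :: 'd)"
proof (rule ccontr)
  assume "\<not> ?thesis"
  then have "UNIV = {j}" by auto
  then have "CARD('d) = card {j}" by simp
  then show False using d by simp
qed

lemma slice_hub: "a \<in> good_slices j Q \<Longrightarrow> slice j a Q \<subseteq> hub_cells Q"
  by (auto simp: hub_cells_def)

text \<open>Slices in different directions intersect. Two parallel slices are joined through a good
  slice in another direction, which exists because d is at least 2.\<close>

lemma hub_connected:
  assumes Q: "Q \<in> grid (p * p)" and x: "x \<in> hub_cells Q" and y: "y \<in> hub_cells Q"
  shows "(x, y) \<in> (steps (hub_cells Q))\<^sup>*"
proof -
  have diff: "(x, y) \<in> (steps (hub_cells Q))\<^sup>*"
    if prems: "j \<noteq> j'" "a \<in> good_slices j Q" "a' \<in> good_slices j' Q" "x \<in> slice j a Q" "y \<in> slice j' a' Q" for x y j j' a a'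
  proof -
    have lt: "a < M" "a' < M" using prems by (auto simp: good_slices_def)
    obtain z where z: "z \<in> slice j a Q" "z \<in> slice j' a' Q" using slices_meet[OF Q prems(1) lt] by blast
    have "(x, z) \<in> (steps (hub_cells Q))\<^sup>*"
      by (rule steps_mono[OF slice_hub[OF prems(2)] slice_connected[OF Q lt(1) prems(4) z(1)]])
    moreover have "(z, y) \<in> (steps (hub_cells Q))\<^sup>*"
      by (rule steps_mono[OF slice_hub[OF prems(3)] slice_connected[OF Q lt(2) z(2) prems(5)]])
    ultimately show ?thesis by (rule rtrancl_trans)
  qed
  obtain j a where 1: "a \<in> good_slices j Q" "x \<in> slice j a Q" using x by (auto simp: hub_cells_def)
  obtain j' a' where 2: "a' \<in> good_slices j' Q" "y \<in> slice j' a' Q" using y by (auto simp: hub_cells_def)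
  show ?thesis
  proof (cases "j = j'")
    case False
    then show ?thesis using diff 1 2 by blast
  next
    case True
    obtain i where i: "i \<noteq> j" using other_direction by blast
    obtain e where e: "e \<in> good_slices i Q" using good_slices_nonempty[OF Q] by blast
    obtain z where z: "z \<in> slice i e Q"
      using slices_meet[OF Q i, of e 0] e M_pos by (auto simp: good_slices_def)
    have "(x, z) \<in> (steps (hub_cells Q))\<^sup>*" using diff[OF i[symmetric] 1(1) e 1(2) z] .
    moreover have "(z, y) \<in> (steps (hub_cells Q))\<^sup>*" using diff[OF i[unfolded True] e 2(1) z 2(2)] .
    ultimately show ?thesis by (rule rtrancl_trans)
  qed
qed

text \<open>The crossing from one block to the next runs inside a hyperplane with normal direction j
  different from k, at an offset that is good in both blocks.\<close>

lemma hub_adjacent_connected: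
  assumes Q: "Q \<in> grid (p * p)" and Q': "Q' \<in> grid (p * p)" "Q' = Q(k := Q k + 1)"
    and x: "x \<in> hub_cells Q" and y: "y \<in> hub_cells Q'"
  shows "(x, y) \<in> (steps (hub_cells Q \<union> hub_cells Q'))\<^sup>*"
proof -
  obtain j where j: "j \<noteq> k" using other_direction by blast
  obtain a where a: "a \<in> good_slices j Q" "a \<in> good_slices j Q'" using good_slices_common[OF Q Q'(1)] by blast
  have aM: "a < M" using a by (auto simp: good_slices_def)
  \<comment> \<open>z is in the last layer of its block in direction k and z' in the first layer of
    the next block, so the two cells are neighbours.\<close>
  define z where "z = (\<lambda>i. M * Q i + (if i = j then a else if i = k then M - 1 else 0))"
  define z' where "z' = (\<lambda>i. M * Q' i + (if i = j then a else 0))"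
  have "z \<in> block Q" unfolding z_def using aM M_pos by (intro block_point Q) auto
  then have z: "z \<in> hub_cells Q" using a aM by (auto simp: hub_cells_def slice_def z_def)
  have "z' \<in> block Q'" unfolding z'_def using aM M_pos by (intro block_point Q') auto
  then have z': "z' \<in> hub_cells Q'" using a aM by (auto simp: hub_cells_def slice_def z'_def)
  have "near m 1 z z'" unfolding near_def z_def z'_def Q'(2) using j M_pos
    by (auto simp: of_nat_diff algebra_simps)
  then have "(z, z') \<in> (steps (hub_cells Q \<union> hub_cells Q'))\<^sup>*"
    using z z' by (intro r_into_rtrancl) (auto simp: steps_def)
  moreover have "(x, z) \<in> (steps (hub_cells Q \<union> hub_cells Q'))\<^sup>*"
    by (rule steps_mono[OF _ hub_connected[OF Q x z]]) auto
  moreover have "(z', y) \<in> (steps (hub_cells Q \<union> hub_cells Q'))\<^sup>*"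
    by (rule steps_mono[OF _ hub_connected[OF Q'(1) z' y]]) auto
  ultimately show ?thesis by (meson rtrancl_trans)
qed

lemma hub_cells_good: "b \<in> hub_cells Q \<Longrightarrow> good b"
  by (auto simp: hub_cells_def good_slices_def)

lemma hub_cells_block: "hub_cells Q \<subseteq> block Q"
  by (auto simp: hub_cells_def slice_def)

lemma hub_cells_nonempty: "Q \<in> grid (p * p) \<Longrightarrow> \<exists>b. b \<in> hub_cells Q"
proof -
  assume Q: "Q \<in> grid (p * p)"
  obtain j :: 'd where True by simp
  obtain i where i: "i \<noteq> j" using other_direction by blast
  obtain e where e: "e \<in> good_slices i Q" using good_slices_nonempty[OF Q] by blast
  obtain z where z: "z \<in> slice i e Q"
    using slices_meet[OF Q i, of e 0] e M_pos by (auto simp: good_slices_def)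
  then show ?thesis using e by (auto simp: hub_cells_def)
qed

definition rep :: "('d \<Rightarrow> nat) \<Rightarrow> 'd \<Rightarrow> nat" where
  "rep Q = (SOME b. b \<in> hub_cells Q)"

lemma rep: "Q \<in> grid (p * p) \<Longrightarrow> rep Q \<in> hub_cells Q"
  unfolding rep_def by (rule someI_ex[OF hub_cells_nonempty])

lemma finite_block: "finite (block Q)"
  by (auto simp: block_def)

lemma card_block: "card (block Q) \<le> M ^ d"
proof -
  have "block Q \<subseteq> {b. \<forall>k. b k \<in> {M * Q k..<M * Q k + M}}"
  proof safe
    fix b k assume "b \<in> block Q"
    then have "b k div M = Q k" by (auto simp: block_def block_of_def)
    moreover have "b k = M * (b k div M) + b k mod M" "b k mod M < M" using M_pos by simp_all
    ultimately show "b k \<in> {M * Q k..<M * Q k + M}" by simp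
  qed
  then have "card (block Q) \<le> card {b. \<forall>k. b k \<in> {M * Q k..<M * Q k + M}}"
    by (intro card_mono finite_prod_fun) auto
  then show ?thesis unfolding card_prod_fun by (simp add: d)
qed

end

subsection \<open>Local energy estimates\<close>

context gtg_config begin

definition edge_term :: "real \<Rightarrow> (nat \<Rightarrow> real) \<Rightarrow> nat \<Rightarrow> nat \<Rightarrow> real" where
  "edge_term \<sigma> g u v = (if A u v then (g u - \<sigma> * g v)\<^sup>2 else 0)"

text \<open>Only the first end point of an edge is localised, so the local energies of disjoint sets
  of cells add up to at most \<open>energy\<close>.\<close>

definition local_energy :: "real \<Rightarrow> (nat \<Rightarrow> real) \<Rightarrow> ('d \<Rightarrow> nat) set \<Rightarrow> real" where
  "local_energy \<sigma> g S = (\<Sum>y\<in>{y. y < n \<and> cell y \<in> S}. \<Sum>y'<n. edge_term \<sigma> g y y')"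

definition ball :: "nat \<Rightarrow> ('d \<Rightarrow> nat) \<Rightarrow> ('d \<Rightarrow> nat) set" where
  "ball q b = {c. near m q b c}"

definition ball_bound :: "nat \<Rightarrow> real" where
  "ball_bound q = real ((6 * q + 3) ^ d) * C0"

lemma edge_term_nonneg: "0 \<le> edge_term \<sigma> g u v" by (simp add: edge_term_def)

lemma energy_edge_term: "energy \<sigma> g = (\<Sum>u<n. \<Sum>v<n. edge_term \<sigma> g u v)"
  by (simp add: energy_def edge_term_def)

lemma local_energy_nonneg: "0 \<le> local_energy \<sigma> g S"
  unfolding local_energy_def by (intro sum_nonneg) (auto simp: edge_term_nonneg)

lemma local_energy_mono: "S \<subseteq> S' \<Longrightarrow> local_energy \<sigma> g S \<le> local_energy \<sigma> g S'"
  unfolding local_energy_def by (intro sum_mono2) (auto intro!: sum_nonneg simp: edge_term_nonneg)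

lemma edge_term_le_local_energy: "u < n \<Longrightarrow> v < n \<Longrightarrow> cell u \<in> S \<Longrightarrow> edge_term \<sigma> g u v \<le> local_energy \<sigma> g S"
proof -
  assume u: "u < n" "v < n" "cell u \<in> S"
  have "edge_term \<sigma> g u v \<le> (\<Sum>y'<n. edge_term \<sigma> g u y')"
    using u by (intro member_le_sum) (auto simp: edge_term_nonneg)
  also have "\<dots> \<le> local_energy \<sigma> g S"
    unfolding local_energy_def using u by (intro member_le_sum[of u _ "\<lambda>u. \<Sum>y'<n. edge_term \<sigma> g u y'"]) (auto simp: edge_term_nonneg sum_nonneg)
  finally show ?thesis .
qed

lemma cell_ball: "cell v \<in> ball q (cell v)"
  by (simp add: ball_def)

lemma ball_subset:
  assumes "near m r b c" "b \<in> grid m" "c \<in> grid m"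
  shows "ball q c \<inter> grid m \<subseteq> ball (r + q) b"
  using near_trans[OF assms(1)] assms unfolding ball_def by blast

lemma local_energy_ball_le:
  assumes "near m r b c" "b \<in> grid m" "c \<in> grid m" "r + q \<le> q'"
  shows "local_energy \<sigma> g (ball q c) \<le> local_energy \<sigma> g (ball q' b)"
proof -
  have "local_energy \<sigma> g (ball q c) = local_energy \<sigma> g (ball q c \<inter> grid m)"
    unfolding local_energy_def using cell_grid by (intro sum.cong) auto
  also have "\<dots> \<le> local_energy \<sigma> g (ball q' b)"
    using ball_subset[OF assms(1-3), of q] near_mono[OF _ assms(4)]
    by (intro local_energy_mono) (auto simp: ball_def)
  finally show ?thesis .
qed

lemma node_count:
  assumes b: "b \<in> grid m"
  shows "real (card {i. i < n \<and> near m q b (cell i)}) \<le> ball_bound q * real h"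
proof -
  have "{i. i < n \<and> near m q b (cell i)} = (\<Union>c\<in>{c \<in> grid m. near m q b c}. {i. i < n \<and> cell i = c})"
    using cell_grid by auto
  then have "card {i. i < n \<and> near m q b (cell i)} \<le> (\<Sum>c\<in>{c \<in> grid m. near m q b c}. card {i. i < n \<and> cell i = c})"
    using card_UN_le[of "{c \<in> grid m. near m q b c}" "\<lambda>c. {i. i < n \<and> cell i = c}"] by simp
  then have "real (card {i. i < n \<and> near m q b (cell i)}) \<le> (\<Sum>c\<in>{c \<in> grid m. near m q b c}. real (card {i. i < n \<and> cell i = c}))"
    unfolding of_nat_sum[symmetric] of_nat_le_iff .
  also have "\<dots> \<le> (\<Sum>c\<in>{c \<in> grid m. near m q b c}. C0 * real h)"
    by (intro sum_mono cell_count) auto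
  also have "\<dots> = real (card {c \<in> grid m. near m q b c}) * (C0 * real h)" by simp
  also have "\<dots> \<le> real ((6 * q + 3) ^ d) * (C0 * real h)"
    using card_near[OF b, of q] C0 by (intro mult_right_mono) (auto simp: d simp del: of_nat_power)
  finally show ?thesis by (simp add: ball_bound_def)
qed

text \<open>Double counting: an edge starting at y is seen by those v whose cell is within distance
  q of the cell of y, and \<open>node_count\<close> bounds their number.\<close>

lemma sum_local_energy_ball: "(\<Sum>v<n. local_energy \<sigma> g (ball q (cell v))) \<le> ball_bound q * real h * energy \<sigma> g"
proof -
  have "(\<Sum>v<n. local_energy \<sigma> g (ball q (cell v)))
      = (\<Sum>v<n. \<Sum>y<n. of_bool (near m q (cell y) (cell v)) * (\<Sum>y'<n. edge_term \<sigma> g y y'))"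
    unfolding local_energy_def ball_def
    by (intro sum.cong refl sum.mono_neutral_cong_left) (auto simp: near_sym)
  also have "\<dots> = (\<Sum>y<n. \<Sum>v<n. of_bool (near m q (cell y) (cell v)) * (\<Sum>y'<n. edge_term \<sigma> g y y'))"
    by (rule sum.swap)
  also have "\<dots> = (\<Sum>y<n. (\<Sum>v<n. of_bool (near m q (cell y) (cell v))) * (\<Sum>y'<n. edge_term \<sigma> g y y'))"
    by (simp only: sum_distrib_right)
  also have "\<dots> \<le> (\<Sum>y<n. (ball_bound q * real h) * (\<Sum>y'<n. edge_term \<sigma> g y y'))"
  proof (intro sum_mono mult_right_mono sum_nonneg edge_term_nonneg)
    fix y assume "y \<in> {..<n}"
    then have "real (card {i. i < n \<and> near m q (cell y) (cell i)}) \<le> ball_bound q * real h"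
      using cell_grid by (intro node_count) auto
    moreover have "{i. i < n \<and> near m q (cell y) (cell i)} = {..<n} \<inter> {v. near m q (cell y) (cell v)}" by auto
    ultimately show "(\<Sum>v<n. of_bool (near m q (cell y) (cell v))) \<le> ball_bound q * real h"
      by (simp add: sum_of_bool_eq)
  qed
  also have "\<dots> = ball_bound q * real h * energy \<sigma> g"
    by (simp add: energy_edge_term sum_distrib_left)
  finally show ?thesis .
qed

section \<open>Averages over the selected nodes\<close>

definition cell_mean :: "(nat \<Rightarrow> real) \<Rightarrow> ('d \<Rightarrow> nat) \<Rightarrow> real" where
  "cell_mean g b = (\<Sum>y\<in>Sel b. g y) / real h"

text \<open>The value of g on a block is read off at one representative hub cell; the other hub
  cells agree with it up to local energy, by \<open>cell_mean_rep_diff\<close>.\<close>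

definition hub_mean :: "(nat \<Rightarrow> real) \<Rightarrow> ('d \<Rightarrow> nat) \<Rightarrow> real" where
  "hub_mean g Q = cell_mean g (rep Q)"

lemma h_pos: "0 < real h" using h by simp

lemma node_cell_mean_diff:
  assumes "good b" and "\<And>y. y \<in> Sel b \<Longrightarrow> (x - g y)\<^sup>2 \<le> B"
  shows "(x - cell_mean g b)\<^sup>2 \<le> B"
proof -
  have "real h * (x - cell_mean g b) = (\<Sum>y\<in>Sel b. x - g y)"
    using h_pos Sel(2)[OF assms(1)] by (simp add: cell_mean_def sum_subtractf right_diff_distrib)
  then have "(real h * (x - cell_mean g b))\<^sup>2 \<le> (\<Sum>y\<in>Sel b. (x - g y)\<^sup>2) * real h"
    using sum_squared_le_sum_of_squares[of "\<lambda>y. x - g y" "Sel b"] Sel(2)[OF assms(1)] by simp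
  also have "\<dots> \<le> (\<Sum>y\<in>Sel b. B) * real h"
    by (intro mult_right_mono sum_mono assms(2)) auto
  also have "\<dots> = (real h)\<^sup>2 * B" using Sel(2)[OF assms(1)] by (simp add: power2_eq_square)
  finally show ?thesis using h_pos by (simp add: power_mult_distrib)
qed

lemma heavy_adjacent:
  assumes "y \<in> Sel b" "good b" "i < n" "i \<noteq> y" "near m 1 (cell i) b"
  shows "A i y"
proof (rule adjI[of i y 1])
  have y: "y < n" "cell y = b" "ws \<le> w y" using Sel(1)[OF assms(2)] assms(1) by auto
  then show "y < n" "near m 1 (cell i) (cell y)" using assms by auto
  show "ku * (real 1 + 1) ^ d \<le> w i + w y" using ws y(3) w_nonneg[OF assms(3)] by simp
qed (use assms in auto)

text \<open>All pairs of distinct selected nodes from the two cells are adjacent, so the difference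
  of the means is an average over h^2 edges (pairs of equal nodes contribute 0). The resulting
  factor h^2 is the gain that keeps logarithms out of the spectral bound.\<close>

lemma cell_mean_step:
  assumes g: "good b" "good c" and near: "near m 1 b c" 
  shows "(real h)\<^sup>2 * (cell_mean g b - cell_mean g c)\<^sup>2 \<le> (\<Sum>y\<in>Sel b. \<Sum>y'\<in>Sel c. edge_term 1 g y y')"
proof -
  note Sb = Sel[OF g(1)] and Sc = Sel[OF g(2)]
  have "(real h)\<^sup>2 * (cell_mean g b - cell_mean g c) = (\<Sum>y\<in>Sel b. \<Sum>y'\<in>Sel c. g y - g y')"
    using h_pos Sb(2) Sc(2)
    by (simp add: cell_mean_def sum_subtractf right_diff_distrib power2_eq_square sum_distrib_left[symmetric] mult_ac)
  also have "\<dots> = (\<Sum>z\<in>Sel b \<times> Sel c. g (fst z) - g (snd z))"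
    by (simp add: sum.cartesian_product case_prod_beta)
  finally have "((real h)\<^sup>2 * (cell_mean g b - cell_mean g c))\<^sup>2
      \<le> (\<Sum>z\<in>Sel b \<times> Sel c. (g (fst z) - g (snd z))\<^sup>2) * real (card (Sel b \<times> Sel c))"
    using sum_squared_le_sum_of_squares[of "\<lambda>z. g (fst z) - g (snd z)" "Sel b \<times> Sel c"] by simp
  also have "\<dots> = (real h)\<^sup>2 * (\<Sum>y\<in>Sel b. \<Sum>y'\<in>Sel c. (g y - g y')\<^sup>2)"
    using Sb Sc by (simp add: sum.cartesian_product case_prod_beta card_cartesian_product power2_eq_square)
  finally have "(real h)\<^sup>2 * ((real h)\<^sup>2 * (cell_mean g b - cell_mean g c)\<^sup>2) \<le> (real h)\<^sup>2 * (\<Sum>y\<in>Sel b. \<Sum>y'\<in>Sel c. (g y - g y')\<^sup>2)"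
    by (simp add: power2_eq_square mult_ac)
  moreover have "0 < (real h)\<^sup>2" using h_pos by simp
  ultimately have "(real h)\<^sup>2 * (cell_mean g b - cell_mean g c)\<^sup>2 \<le> (\<Sum>y\<in>Sel b. \<Sum>y'\<in>Sel c. (g y - g y')\<^sup>2)"
    by (rule mult_left_le_imp_le)
  also have "\<dots> = (\<Sum>y\<in>Sel b. \<Sum>y'\<in>Sel c. edge_term 1 g y y')"
  proof (intro sum.cong refl)
    fix y y' assume y: "y \<in> Sel b" "y' \<in> Sel c"
    have "y < n" "cell y = b" using y(1) Sb(1) by auto
    then have "A y y'" if "y \<noteq> y'"
      using heavy_adjacent[OF y(2) g(2) _ that] near by simp
    then show "(g y - g y')\<^sup>2 = edge_term 1 g y y'" by (cases "y = y'") (auto simp: edge_term_def)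
  qed
  finally show ?thesis .
qed

lemma sum_cells_le:
  fixes F :: "nat \<Rightarrow> real"
  assumes "finite S" "\<And>b. b \<in> S \<Longrightarrow> good b" "\<And>y. y < n \<Longrightarrow> 0 \<le> F y"
  shows "(\<Sum>b\<in>S. \<Sum>y\<in>Sel b. F y) \<le> (\<Sum>y\<in>{y. y < n \<and> cell y \<in> S}. F y)"
proof -
  have "(\<Sum>b\<in>S. \<Sum>y\<in>Sel b. F y) \<le> (\<Sum>b\<in>S. \<Sum>y\<in>{y\<in>{y. y < n \<and> cell y \<in> S}. cell y = b}. F y)"
  proof (intro sum_mono sum_mono2)
    fix b assume b: "b \<in> S"
    show "Sel b \<subseteq> {y \<in> {y. y < n \<and> cell y \<in> S}. cell y = b}"
      using Sel(1)[OF assms(2)[OF b]] b by blast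
  qed (use assms(3) in auto)
  also have "\<dots> = (\<Sum>y\<in>{y. y < n \<and> cell y \<in> S}. F y)"
    using assms(1) by (intro sum.group) auto
  finally show ?thesis .
qed

text \<open>The path bound costs the square of the number of steps, which is at most the square of
  \<open>card S\<close>; hence the fourth power. The lemma is applied to the hub cells of one or two
  blocks, whose number is bounded, so the gain h^2 survives.\<close>

lemma cell_mean_connected:
  assumes S: "finite S" "\<And>b. b \<in> S \<Longrightarrow> good b" and bc: "(b, c) \<in> (steps S)\<^sup>*"
  shows "(real h)\<^sup>2 * (cell_mean g b - cell_mean g c)\<^sup>2 \<le> real (card S) ^ 4 * local_energy 1 g S"
proof -
  have sub: "steps S \<subseteq> S \<times> S" by (auto simp: steps_def)
  have fin: "finite (steps S)" by (rule finite_subset[OF sub]) (use S in auto)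
  have card: "card (steps S) \<le> (card S)\<^sup>2"
    using card_mono[OF _ sub] S by (simp add: card_cartesian_product power2_eq_square)
  obtain s where s: "s = 1" "(cell_mean g b - s * cell_mean g c)\<^sup>2 \<le> (real (card (steps S)))\<^sup>2 * (\<Sum>(u, v)\<in>steps S. (cell_mean g u - 1 * cell_mean g v)\<^sup>2)"
    using rtrancl_diff_le[OF fin bc, of 1 "cell_mean g"] by auto
  have "(real h)\<^sup>2 * (cell_mean g b - cell_mean g c)\<^sup>2
      \<le> (real h)\<^sup>2 * ((real (card (steps S)))\<^sup>2 * (\<Sum>(u, v)\<in>steps S. (cell_mean g u - 1 * cell_mean g v)\<^sup>2))"
    using s by (intro mult_left_mono) auto
  also have "\<dots> = (real (card (steps S)))\<^sup>2 * (\<Sum>z\<in>steps S. (real h)\<^sup>2 * (cell_mean g (fst z) - cell_mean g (snd z))\<^sup>2)"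
    by (simp add: sum_distrib_left case_prod_beta mult_ac)
  also have "\<dots> \<le> (real (card S) ^ 2)\<^sup>2 * local_energy 1 g S"
  proof (intro mult_mono power_mono)
    show "real (card (steps S)) \<le> real (card S) ^ 2" using card by (metis of_nat_le_iff of_nat_power)
    have "(\<Sum>z\<in>steps S. (real h)\<^sup>2 * (cell_mean g (fst z) - cell_mean g (snd z))\<^sup>2)
        \<le> (\<Sum>z\<in>steps S. \<Sum>y\<in>Sel (fst z). \<Sum>y'\<in>Sel (snd z). edge_term 1 g y y')"
      by (intro sum_mono cell_mean_step) (auto simp: steps_def S)
    also have "\<dots> \<le> (\<Sum>z\<in>S \<times> S. \<Sum>y\<in>Sel (fst z). \<Sum>y'\<in>Sel (snd z). edge_term 1 g y y')"
      using sub S by (intro sum_mono2) (auto intro!: sum_nonneg simp: edge_term_nonneg)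
    also have "\<dots> = (\<Sum>b\<in>S. \<Sum>y\<in>Sel b. \<Sum>c\<in>S. \<Sum>y'\<in>Sel c. edge_term 1 g y y')"
    proof -
      have "(\<Sum>z\<in>S \<times> S. \<Sum>y\<in>Sel (fst z). \<Sum>y'\<in>Sel (snd z). edge_term 1 g y y')
          = (\<Sum>b\<in>S. \<Sum>c\<in>S. \<Sum>y\<in>Sel b. \<Sum>y'\<in>Sel c. edge_term 1 g y y')"
        unfolding sum.cartesian_product by (intro sum.cong) auto
      also have "\<dots> = (\<Sum>b\<in>S. \<Sum>y\<in>Sel b. \<Sum>c\<in>S. \<Sum>y'\<in>Sel c. edge_term 1 g y y')"
        by (intro sum.cong refl sum.swap)
      finally show ?thesis .
    qed
    also have "\<dots> \<le> (\<Sum>y\<in>{y. y < n \<and> cell y \<in> S}. \<Sum>c\<in>S. \<Sum>y'\<in>Sel c. edge_term 1 g y y')"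
      by (intro sum_cells_le S sum_nonneg edge_term_nonneg)
    also have "\<dots> \<le> (\<Sum>y\<in>{y. y < n \<and> cell y \<in> S}. \<Sum>y'\<in>{y. y < n \<and> cell y \<in> S}. edge_term 1 g y y')"
      by (intro sum_mono sum_cells_le S edge_term_nonneg)
    also have "\<dots> \<le> local_energy 1 g S"
      unfolding local_energy_def by (intro sum_mono sum_mono2) (auto simp: edge_term_nonneg)
    finally show "(\<Sum>z\<in>steps S. (real h)\<^sup>2 * (cell_mean g (fst z) - cell_mean g (snd z))\<^sup>2) \<le> local_energy 1 g S" .
  qed (auto intro!: sum_nonneg)
  finally show ?thesis by simp
qed

lemma hub_subset_ball:
  assumes "b \<in> block Q"
  shows "hub_cells Q \<subseteq> ball M b"
proof
  fix c assume "c \<in> hub_cells Q"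
  then have "block_of b = block_of c" using hub_cells_block[of Q] assms by (auto simp: block_def)
  then show "c \<in> ball M b" using block_of_near by (simp add: ball_def)
qed

lemma card_hub_cells: "card (hub_cells Q) \<le> M ^ d"
  using card_mono[OF finite_block hub_cells_block[of Q]] card_block[of Q] by simp

lemma finite_hub_cells: "finite (hub_cells Q)"
  using finite_subset[OF hub_cells_block finite_block] .

lemma cell_mean_rep_diff:
  assumes Q: "Q \<in> grid (p * p)" and b: "b \<in> hub_cells Q"
  shows "(cell_mean g b - hub_mean g Q)\<^sup>2 \<le> real (M ^ d) ^ 4 * local_energy 1 g (ball M b)"
proof -
  \<comment> \<open>Here the gain h^2 is given away: this estimate only serves to attach single
    nodes, where powers of h do no harm.\<close>
  have "1 * (cell_mean g b - hub_mean g Q)\<^sup>2 \<le> (real h)\<^sup>2 * (cell_mean g b - hub_mean g Q)\<^sup>2"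
    using h by (intro mult_right_mono) (auto simp: power2_eq_square intro: mult_ge1_I)
  also have "\<dots> \<le> real (card (hub_cells Q)) ^ 4 * local_energy 1 g (hub_cells Q)"
    unfolding hub_mean_def by (intro cell_mean_connected finite_hub_cells hub_cells_good hub_connected rep Q b)
  also have "\<dots> \<le> real (M ^ d) ^ 4 * local_energy 1 g (ball M b)"
    using card_hub_cells[of Q] subsetD[OF hub_cells_block b]
    by (intro mult_mono power_mono local_energy_mono local_energy_nonneg hub_subset_ball) (simp_all del: of_nat_power)
  finally show ?thesis by simp
qed

definition hub :: "nat set" where
  "hub = {x. x < n \<and> cell x \<in> hub_cells (block_of (cell x)) \<and> x \<in> Sel (cell x)}"

lemma cell_block_of: "i < n \<Longrightarrow> block_of (cell i) \<in> grid (p * p)"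
  by (intro block_of_grid cell_grid)

lemma Sel_hub:
  assumes "b \<in> hub_cells Q" "y \<in> Sel b"
  shows "y \<in> hub" "y < n" "cell y = b" "block_of b = Q" "b \<in> grid m"
proof -
  have "b \<in> block Q" using assms hub_cells_block by auto
  then show "block_of b = Q" "b \<in> grid m" by (auto simp: block_def)
  moreover show "y < n" "cell y = b" using Sel(1)[OF hub_cells_good[OF assms(1)]] assms by auto
  ultimately show "y \<in> hub" using assms by (auto simp: hub_def)
qed

lemma hub_diff:
  assumes "x \<in> hub"
  shows "(g x - hub_mean g (block_of (cell x)))\<^sup>2 \<le> (2 + 2 * real (M ^ d) ^ 4) * local_energy 1 g (ball M (cell x))"
proof -
  let ?b = "cell x" and ?L = "local_energy 1 g (ball M (cell x))"
  have x: "x < n" "?b \<in> hub_cells (block_of ?b)" "x \<in> Sel ?b" using assms by (auto simp: hub_def)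
  note good = hub_cells_good[OF x(2)]
  have "(g x - cell_mean g ?b)\<^sup>2 \<le> ?L"
  proof (rule node_cell_mean_diff[OF good])
    fix y assume y: "y \<in> Sel ?b"
    show "(g x - g y)\<^sup>2 \<le> ?L"
    proof (cases "x = y")
      case False
      then have "A x y" using heavy_adjacent[OF y good x(1)] by simp
      then have "(g x - g y)\<^sup>2 = edge_term 1 g x y" by (simp add: edge_term_def)
      also have "\<dots> \<le> ?L" using x y Sel(1)[OF good] by (intro edge_term_le_local_energy cell_ball) auto
      finally show ?thesis .
    qed (simp add: local_energy_nonneg)
  qed
  moreover have "(cell_mean g ?b - hub_mean g (block_of ?b))\<^sup>2 \<le> real (M ^ d) ^ 4 * ?L"
    by (rule cell_mean_rep_diff[OF cell_block_of[OF x(1)] x(2)])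
  ultimately show ?thesis
    using power2_sum_le[of "g x - cell_mean g ?b" "cell_mean g ?b - hub_mean g (block_of ?b)"] by (simp add: algebra_simps)
qed

text \<open>Three selected nodes of a cell form a triangle, and the alternating sum of the edge
  terms around an odd cycle recovers 2 g x. This is the use of \<open>3 \<le> h\<close>, and it
  keeps the walk away from being bipartite.\<close>

lemma odd_cycle:
  assumes "x \<in> hub"
  shows "(g x)\<^sup>2 \<le> 3 * local_energy (-1) g (ball M (cell x))"
proof -
  let ?b = "cell x" and ?L = "local_energy (-1) g (ball M (cell x))"
  have x: "x < n" "?b \<in> hub_cells (block_of ?b)" "x \<in> Sel ?b" using assms by (auto simp: hub_def)
  note good = hub_cells_good[OF x(2)]
  have "2 \<le> card (Sel ?b - {x})" using h Sel[OF good] x by simp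
  then obtain Y where Y: "Y \<subseteq> Sel ?b - {x}" "card Y = 2" by (meson obtain_subset_with_card_n)
  then obtain y z where yz: "y \<in> Sel ?b" "z \<in> Sel ?b" "y \<noteq> x" "z \<noteq> x" "y \<noteq> z"
    unfolding card_2_iff by auto
  have e: "(g u + g v)\<^sup>2 \<le> ?L" if "u \<in> Sel ?b" "v \<in> Sel ?b" "u \<noteq> v" for u v
  proof -
    have u: "u < n" "cell u = ?b" "v < n" using that Sel(1)[OF good] by auto
    have "A u v" using heavy_adjacent[OF that(2) good u(1)] that u by simp
    then have "(g u + g v)\<^sup>2 = edge_term (-1) g u v" by (simp add: edge_term_def)
    also have "\<dots> \<le> ?L" using u by (intro edge_term_le_local_energy) (auto simp: ball_def)
    finally show ?thesis .
  qed
  have "4 * (g x)\<^sup>2 = ((g x + g y) - (g y + g z) + (g z + g x))\<^sup>2"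
    by (simp add: power2_eq_square algebra_simps)
  also have "\<dots> \<le> 4 * (g x + g y)\<^sup>2 + 4 * (g y + g z)\<^sup>2 + 2 * (g z + g x)\<^sup>2"
    using power2_sum_le[of "(g x + g y) - (g y + g z)" "g z + g x"]
      power2_sum_le[of "g x + g y" "- (g y + g z)"] by (simp only: power2_minus diff_conv_add_uminus)
  also have "\<dots> \<le> 12 * ?L"
    using e[OF x(3) yz(1) yz(3)[symmetric]] e[OF yz(1,2,5)] e[OF yz(2) x(3) yz(4)]
      local_energy_nonneg[of "-1" g "ball M (cell x)"] by linarith
  finally show ?thesis by simp
qed

lemma not_light_adjacent:
  assumes v: "v < n" "wb \<le> w v" and y: "y < n" "v \<noteq> y" "near m M (cell v) (cell y)"
  shows "A v y"
  using w_nonneg[OF y(1)] v y wb by (intro adjI[of v y M]) auto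

text \<open>Such a node is adjacent to all selected nodes of its block and is compared with them
  directly, without a power of h and within distance M. This matters because its weight is bounded
  only by T.\<close>

lemma not_light_diff:
  assumes v: "v < n" "wb \<le> w v"
  shows "(g v - hub_mean g (block_of (cell v)))\<^sup>2 \<le> local_energy 1 g (ball M (cell v))"
  unfolding hub_mean_def
proof (rule node_cell_mean_diff)
  let ?Q = "block_of (cell v)"
  have Q: "?Q \<in> grid (p * p)" using v by (intro cell_block_of)
  note r = rep[OF Q]
  show "good (rep ?Q)" using r hub_cells_good by auto
  fix y assume y: "y \<in> Sel (rep ?Q)"
  note s = Sel_hub[OF r y]
  show "(g v - g y)\<^sup>2 \<le> local_energy 1 g (ball M (cell v))"
  proof (cases "v = y")
    case False
    have "near m M (cell v) (cell y)" using s by (intro block_of_near) auto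
    then have "A v y" using not_light_adjacent[OF v s(2) False] by simp
    then have "(g v - g y)\<^sup>2 = edge_term 1 g v y" by (simp add: edge_term_def)
    also have "\<dots> \<le> local_energy 1 g (ball M (cell v))" using v s by (intro edge_term_le_local_energy cell_ball) auto
    finally show ?thesis .
  qed (simp add: local_energy_nonneg)
qed

lemma not_light_odd:
  assumes v: "v < n" "wb \<le> w v"
  shows "(g v)\<^sup>2 \<le> 8 * local_energy (-1) g (ball (2 * M) (cell v))"
proof -
  let ?Q = "block_of (cell v)" and ?L = "local_energy (-1) g (ball (2 * M) (cell v))"
  have Q: "?Q \<in> grid (p * p)" using v by (intro cell_block_of)
  note r = rep[OF Q]
  have "Sel (rep ?Q) \<noteq> {}" using Sel(2)[OF hub_cells_good[OF r]] h by auto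
  then obtain y where y: "y \<in> Sel (rep ?Q)" by auto
  note s = Sel_hub[OF r y]
  have near: "near m M (cell v) (cell y)" using s by (intro block_of_near) auto
  have "(g y)\<^sup>2 \<le> 3 * local_energy (-1) g (ball M (cell y))" by (rule odd_cycle[OF s(1)])
  also have "\<dots> \<le> 3 * ?L" using v s near cell_grid by (intro mult_left_mono local_energy_ball_le[of M]) auto
  finally have gy: "(g y)\<^sup>2 \<le> 3 * ?L" .
  show ?thesis
  proof (cases "v = y")
    case True
    then show ?thesis using gy local_energy_nonneg[of "-1" g "ball (2 * M) (cell v)"] by simp
  next
    case False
    then have "A v y" using not_light_adjacent[OF v s(2) False] near by simp
    then have "(g v + g y)\<^sup>2 = edge_term (-1) g v y" by (simp add: edge_term_def)
    also have "\<dots> \<le> ?L" using v s by (intro edge_term_le_local_energy cell_ball) auto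
    finally have "(g v + g y)\<^sup>2 \<le> ?L" .
    then show ?thesis using gy power2_sum_le[of "g v + g y" "- g y"] by simp
  qed
qed

end

subsection \<open>Nodes outside the hubs\<close>

context gtg_config begin

definition remote :: "nat set" where
  "remote = {v. v < n \<and> v \<notin> hub \<and> (\<forall>x\<in>hub. \<not> A v x)}"

lemma hub_near: "v < n \<Longrightarrow> \<exists>y\<in>hub. near m M (cell v) (cell y)"
proof -
  assume v: "v < n"
  note r = rep[OF cell_block_of[OF v]]
  have "Sel (rep (block_of (cell v))) \<noteq> {}" using Sel(2)[OF hub_cells_good[OF r]] h by auto
  then obtain y where y: "y \<in> Sel (rep (block_of (cell v)))" by auto
  note s = Sel_hub[OF r y]
  have "near m M (cell v) (cell y)" using s by (intro block_of_near) auto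
  then show ?thesis using s by blast
qed

lemma remote_light: "v \<in> remote \<Longrightarrow> w v < wb"
proof (rule ccontr)
  assume v: "v \<in> remote" and "\<not> w v < wb"
  then have v': "v < n" "wb \<le> w v" by (auto simp: remote_def)
  obtain y where y: "y \<in> hub" "near m M (cell v) (cell y)" using hub_near[OF v'(1)] by blast
  then have "y < n" "v \<noteq> y" using v by (auto simp: remote_def hub_def)
  then have "A v y" using not_light_adjacent v' y by blast
  then show False using v y by (auto simp: remote_def)
qed

text \<open>If all cells of the block were good, every slice would be good. The node's own cell
  would then be a hub cell, so the node would belong to the hub or be adjacent to it.\<close>

lemma remote_bad: "v \<in> remote \<Longrightarrow> \<exists>c. c \<in> grid m \<and> block_of c = block_of (cell v) \<and> \<not> good c"
proof (rule ccontr)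
  assume v: "v \<in> remote" and no: "\<not> ?thesis"
  let ?b = "cell v" let ?Q = "block_of ?b"
  have vn: "v < n" using v by (simp add: remote_def)
  have all: "good c" if "c \<in> block ?Q" for c using no that by (auto simp: block_def)
  have b: "?b \<in> block ?Q" using cell_grid[OF vn] by (simp add: block_def)
  obtain j :: 'd where True by simp
  have "?b j mod M \<in> good_slices j ?Q" using all M_pos by (auto simp: good_slices_def slice_def)
  then have bh: "?b \<in> hub_cells ?Q" using b by (auto simp: hub_cells_def slice_def)
  have "Sel ?b \<noteq> {}" using Sel(2)[OF all[OF b]] h by auto
  then obtain y where y: "y \<in> Sel ?b" by auto
  have yh: "y \<in> hub" using Sel_hub(1)[OF bh y] .
  then have "v \<noteq> y" using v by (auto simp: remote_def)
  then have "A v y" using heavy_adjacent[OF y all[OF b] vn] by simp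
  then show False using v yh by (auto simp: remote_def)
qed

text \<open>The blocks visited by a path of remote nodes contain bad cells at bounded distance from each
  other, and at most \<open>K\<close> bad cells are available in the window; so the path never leaves it.\<close>

lemma remote_chain:
  fixes v
  defines "N \<equiv> {z. z < n \<and> near m W (cell v) (cell z)}"
  assumes v: "v \<in> remote" and z: "(v, z) \<in> {(a, b). A a b \<and> a \<in> remote \<and> b \<in> remote}\<^sup>*"
  shows "(v, z) \<in> {(a, b). A a b \<and> a \<in> N \<and> b \<in> N}\<^sup>*" "near m W (cell v) (cell z)"
proof -
  define \<beta> where "\<beta> z = (SOME c. c \<in> grid m \<and> block_of c = block_of (cell z) \<and> \<not> good c)" for z
  have \<beta>: "\<beta> z \<in> grid m" "block_of (\<beta> z) = block_of (cell z)" "\<not> good (\<beta> z)" if "z \<in> remote" for z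
    using someI_ex[OF remote_bad[OF that]] by (auto simp: \<beta>_def)
  have \<beta>_near: "near m M (\<beta> z) (cell z)" if "z \<in> remote" for z using \<beta>[OF that] by (intro block_of_near)
  \<comment> \<open>M from a bad cell to a node of its block, R for an edge between two light nodes,
    and M on to the next bad cell.\<close>
  define r where "r = R + 2 * M"
  define B where "B = {c \<in> grid m. near m W (cell v) c \<and> \<not> good c}"
  \<comment> \<open>The displacement is controlled through this relation and not through the length
    of the path: a chain in RB can be shortened to \<open>card RB\<close> steps of length r, and RB
    has at most K * K elements.\<close>
  define RB where "RB = {(x, y). x \<in> B \<and> y \<in> B \<and> near m r x y}"
  have cg: "cell z \<in> grid m" "z < n" if "z \<in> remote" for z using that cell_grid by (auto simp: remote_def)
  have fB: "finite B" by (simp add: B_def)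
  have cB: "card B \<le> K" using bad_count[OF cg(1)[OF v]] by (simp add: B_def good_def not_le)
  have RB_sub: "RB \<subseteq> B \<times> B" by (auto simp: RB_def)
  then have fRB: "finite RB" using fB by (meson finite_SigmaI finite_subset)
  have cRB: "card RB \<le> K * K"
  proof -
    have "card RB \<le> card B * card B" using card_mono[OF _ RB_sub] fB by (simp add: card_cartesian_product)
    also have "\<dots> \<le> K * K" using cB by (intro mult_le_mono)
    finally show ?thesis .
  qed
  have pow: "near m (i * r) x y" if "(x, y) \<in> RB ^^ i" "x \<in> grid m" for i x y
    using that(1)
  proof (induction i arbitrary: y)
    case (Suc i)
    then obtain u where u: "(x, u) \<in> RB ^^ i" "(u, y) \<in> RB" by auto
    then have "near m (i * r + r) x y"
      using near_trans[OF Suc.IH[OF u(1)], of r y] that(2) by (auto simp: RB_def B_def)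
    then show ?case by (simp add: add.commute)
  qed simp
  have star: "near m (K * K * r) x y" if "(x, y) \<in> RB\<^sup>*" "x \<in> grid m" for x y
  proof -
    have "(x, y) \<in> (\<Union>i\<in>{i. i \<le> card RB}. RB ^^ i)"
      using that(1) unfolding rtrancl_finite_eq_relpow[OF fRB] .
    then obtain i where i: "i \<le> card RB" "(x, y) \<in> RB ^^ i" by blast
    have "i * r \<le> K * K * r" using i cRB by (intro mult_le_mono1) simp
    then show ?thesis using pow[OF i(2) that(2)] near_mono by blast
  qed
  \<comment> \<open>M to the first bad cell, K * K * r along RB, r for one further step and M back
    to a node; this is where the bound for W comes from.\<close>
  have W1: "M + (K * K * r + (r + M)) \<le> W" using W by (simp add: r_def algebra_simps)
  have "z \<in> remote \<and> (v, z) \<in> {(a, b). A a b \<and> a \<in> N \<and> b \<in> N}\<^sup>* \<and> (\<beta> v, \<beta> z) \<in> RB\<^sup>* \<and> near m W (cell v) (cell z)"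
    using z
  proof (induction rule: rtrancl_induct)
    case base
    then show ?case using v by simp
  next
    case (step z z')
    then have A: "A z z'" "z \<in> remote" "z' \<in> remote" by auto
    have 1: "near m M (cell v) (\<beta> v)" using \<beta>_near[OF v] by (simp add: near_sym)
    have 2: "near m (K * K * r) (\<beta> v) (\<beta> z)" using step.IH \<beta>(1)[OF v] by (intro star) auto
    have "w z + w z' < kl * real R ^ d" using remote_light[OF A(2)] remote_light[OF A(3)] R by simp
    then have zz: "near m R (cell z) (cell z')" using adjD A(1) by simp
    have z'\<beta>: "near m M (cell z') (\<beta> z')" using \<beta>_near[OF A(3)] by (simp add: near_sym)
    have "near m (M + (R + M)) (\<beta> z) (\<beta> z')"
      using near_trans[OF \<beta>_near[OF A(2)] near_trans[OF zz z'\<beta>]] A \<beta>(1) cg by simp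
    then have 3: "near m r (\<beta> z) (\<beta> z')" by (simp add: r_def mult_2 add_ac)
    have 4: "near m (M + K * K * r) (cell v) (\<beta> z)"
      using near_trans[OF 1 2] v A \<beta>(1) cg by simp
    then have 5: "near m (M + K * K * r + r) (cell v) (\<beta> z')"
      using near_trans[OF _ 3] v A \<beta>(1) cg by simp
    then have 6: "near m (M + K * K * r + r + M) (cell v) (cell z')"
      using near_trans[OF _ \<beta>_near[OF A(3)]] v A \<beta>(1) cg by simp
    have "\<beta> z' \<in> B" unfolding B_def using near_mono[OF 5, of W] W1 \<beta>[OF A(3)] by simp
    moreover have "\<beta> z \<in> B" unfolding B_def using near_mono[OF 4, of W] W1 \<beta>[OF A(2)] by simp
    ultimately have "(\<beta> z, \<beta> z') \<in> RB" using 3 by (simp add: RB_def)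
    then have "(\<beta> v, \<beta> z') \<in> RB\<^sup>*" using step.IH by (meson rtrancl.rtrancl_into_rtrancl)
    moreover have W6: "near m W (cell v) (cell z')" using near_mono[OF 6, of W] W1 by simp
    moreover have "(v, z') \<in> {(a, b). A a b \<and> a \<in> N \<and> b \<in> N}\<^sup>*"
    proof -
      have "(z, z') \<in> {(a, b). A a b \<and> a \<in> N \<and> b \<in> N}"
        using A(1) step.IH W6 cg[OF A(2)] cg[OF A(3)] by (simp add: N_def)
      then show ?thesis using step.IH by (meson rtrancl.rtrancl_into_rtrancl)
    qed
    ultimately show ?case using A(3) by simp
  qed
  then show "(v, z) \<in> {(a, b). A a b \<and> a \<in> N \<and> b \<in> N}\<^sup>*" "near m W (cell v) (cell z)" by auto
qed

lemma adj_near: "A i j \<Longrightarrow> near m \<rho> (cell i) (cell j)"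
  using adjD[of i j \<rho>] w_le[of i] w_le[of j] vert[of i j] \<rho>(1) by force

lemma hub_nonempty: "\<exists>x. x \<in> hub"
  using hub_near[of 0] n2 by auto

lemma power2_sum3_le: "(x + y + z)\<^sup>2 \<le> 3 * (x\<^sup>2 + y\<^sup>2 + z\<^sup>2)" for x y z :: real
  using zero_le_power2[of "x - y"] zero_le_power2[of "y - z"] zero_le_power2[of "x - z"]
  by (simp add: power2_eq_square algebra_simps)

lemma ball_bound_nonneg: "0 \<le> ball_bound q" using C0 by (simp add: ball_bound_def)

text \<open>A remote node leaves its component of remote nodes through an edge u y, and y is in the
  hub or adjacent to it: one stretch inside the window W and at most two edges of length
  \<open>\<rho>\<close>. The number of node pairs in the window bounds the steps of the stretch, and
  its square gives the factor h^4.\<close>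

lemma reach_hub:
  assumes v: "v < n" and \<sigma>: "\<sigma>\<^sup>2 = 1"
  shows "\<exists>x\<in>hub. \<exists>s. s\<^sup>2 = 1 \<and> (\<sigma> = 1 \<longrightarrow> s = 1) \<and> near m (W + 2 * \<rho>) (cell v) (cell x) \<and>
    (g v - s * g x)\<^sup>2 \<le> 3 * (ball_bound W ^ 4 + 2) * real h ^ 4 * local_energy \<sigma> g (ball (W + 2 * \<rho>) (cell v))"
proof -
  let ?B = "ball (W + 2 * \<rho>) (cell v)"
  let ?L = "local_energy \<sigma> g ?B"
  have L: "0 \<le> ?L" by (rule local_energy_nonneg)
  have h1: "1 \<le> real h ^ 4" using h by (intro one_le_power) simp
  have big: "c * ?L \<le> 3 * (ball_bound W ^ 4 + 2) * real h ^ 4 * ?L" if "c \<le> 3" for c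
  proof (rule mult_right_mono[OF _ L])
    have "c \<le> 3 * (0 + 2) * 1" using that by simp
    also have "\<dots> \<le> 3 * (ball_bound W ^ 4 + 2) * real h ^ 4"
      using h1 ball_bound_nonneg[of W] by (intro mult_mono) auto
    finally show "c \<le> 3 * (ball_bound W ^ 4 + 2) * real h ^ 4" .
  qed
  show ?thesis
  proof (cases "v \<in> remote")
    case False
    then consider "v \<in> hub" | x where "x \<in> hub" "A v x" using v by (auto simp: remote_def)
    then show ?thesis
    proof cases
      case 1
      then show ?thesis using big[of 0] L by (intro bexI[of _ v] exI[of _ 1]) auto
    next
      case 2
      have "(g v - \<sigma> * g x)\<^sup>2 = edge_term \<sigma> g v x" using 2 by (simp add: edge_term_def)
      also have "\<dots> \<le> 1 * ?L" using 2 v vert by (auto intro!: edge_term_le_local_energy cell_ball)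
      also have "\<dots> \<le> 3 * (ball_bound W ^ 4 + 2) * real h ^ 4 * ?L" by (rule big) simp
      finally show ?thesis using 2 \<sigma> near_mono[OF adj_near[OF 2(2)], of "W + 2 * \<rho>"]
        by (intro bexI[of _ x] exI[of _ \<sigma>]) auto
    qed
  next
    case True
    obtain x0 where x0: "x0 \<in> hub" using hub_nonempty by blast
    then have "x0 \<notin> remote" by (simp add: remote_def)
    moreover have "A\<^sup>*\<^sup>* v x0" using conn v x0 by (auto simp: graph_connected_def hub_def)
    ultimately obtain u y where u: "(v, u) \<in> {(a, b). A a b \<and> a \<in> remote \<and> b \<in> remote}\<^sup>*" "u \<in> remote" "y \<notin> remote" "A u y"
      using first_exit[OF _ True] by blast
    define N where "N = {z. z < n \<and> near m W (cell v) (cell z)}"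
    define RN where "RN = {(a, b). A a b \<and> a \<in> N \<and> b \<in> N}"
    have vu: "(v, u) \<in> RN\<^sup>*" "near m W (cell v) (cell u)"
      using remote_chain[OF True u(1)] by (simp_all add: RN_def N_def)
    have fN: "finite N" by (simp add: N_def)
    have sub: "RN \<subseteq> N \<times> N" by (auto simp: RN_def)
    have fRN: "finite RN" by (rule finite_subset[OF sub]) (simp add: fN)
    have cN: "real (card N) \<le> ball_bound W * real h" unfolding N_def by (intro node_count cell_grid v)
    have cRN: "real (card RN) \<le> (ball_bound W * real h)\<^sup>2"
    proof -
      have "card RN \<le> card N * card N" using card_mono[OF _ sub] fN by (simp add: card_cartesian_product)
      then have "real (card RN) \<le> real (card N) * real (card N)" by (metis of_nat_le_iff of_nat_mult)
      also have "\<dots> \<le> (ball_bound W * real h)\<^sup>2" unfolding power2_eq_square using cN by (intro mult_mono) (auto simp: ball_bound_nonneg)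
      finally show ?thesis .
    qed
    obtain s where s: "s\<^sup>2 = 1" "\<sigma> = 1 \<longrightarrow> s = 1"
      "(g v - s * g u)\<^sup>2 \<le> (real (card RN))\<^sup>2 * (\<Sum>(a, b)\<in>RN. (g a - \<sigma> * g b)\<^sup>2)"
      using rtrancl_diff_le[OF fRN vu(1) \<sigma>, of g] by auto
    have "(\<Sum>(a, b)\<in>RN. (g a - \<sigma> * g b)\<^sup>2) = (\<Sum>z\<in>RN. edge_term \<sigma> g (fst z) (snd z))"
      by (intro sum.cong) (auto simp: RN_def edge_term_def)
    also have "\<dots> \<le> (\<Sum>z\<in>N \<times> {..<n}. edge_term \<sigma> g (fst z) (snd z))"
      using fN by (intro sum_mono2) (auto simp: edge_term_nonneg RN_def N_def)
    also have "\<dots> = (\<Sum>a\<in>N. \<Sum>b<n. edge_term \<sigma> g a b)" by (simp add: sum.cartesian_product case_prod_beta)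
    also have "\<dots> = local_energy \<sigma> g (ball W (cell v))" by (simp add: local_energy_def N_def ball_def)
    also have "\<dots> \<le> ?L" by (intro local_energy_mono) (auto simp: ball_def elim: near_mono)
    finally have e: "(\<Sum>(a, b)\<in>RN. (g a - \<sigma> * g b)\<^sup>2) \<le> ?L" .
    have e1: "(g v - s * g u)\<^sup>2 \<le> (ball_bound W * real h) ^ 4 * ?L"
    proof -
      have "(real (card RN))\<^sup>2 \<le> ((ball_bound W * real h)\<^sup>2)\<^sup>2" using cRN by (intro power_mono) auto
      then have "(real (card RN))\<^sup>2 * (\<Sum>(a, b)\<in>RN. (g a - \<sigma> * g b)\<^sup>2) \<le> ((ball_bound W * real h)\<^sup>2)\<^sup>2 * ?L"
        using e by (intro mult_mono) (auto intro!: sum_nonneg)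
      then show ?thesis using s(3) by simp
    qed
    have un: "u < n" "y < n" using vert[OF u(4)] by auto
    have uL: "edge_term \<sigma> g u y \<le> ?L"
      using un near_mono[OF vu(2), of "W + 2 * \<rho>"] by (intro edge_term_le_local_energy) (auto simp: ball_def)
    have vy: "near m (W + \<rho>) (cell v) (cell y)"
      using near_trans[OF vu(2) adj_near[OF u(4)]] un v cell_grid by simp
    have "\<exists>x\<in>hub. \<exists>t. t\<^sup>2 = 1 \<and> (\<sigma> = 1 \<longrightarrow> t = 1) \<and> near m (W + 2 * \<rho>) (cell v) (cell x) \<and> (g y - t * g x)\<^sup>2 \<le> ?L"
    proof (cases "y \<in> hub")
      case True
      then show ?thesis using near_mono[OF vy, of "W + 2 * \<rho>"] L by (intro bexI[of _ y] exI[of _ 1]) auto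
    next
      case False
      then obtain x where x: "x \<in> hub" "A y x" using u(3) un by (auto simp: remote_def)
      have "near m (W + \<rho> + \<rho>) (cell v) (cell x)"
        using near_trans[OF vy adj_near[OF x(2)]] un v cell_grid vert[OF x(2)] by simp
      moreover have "edge_term \<sigma> g y x \<le> ?L"
        using un near_mono[OF vy, of "W + 2 * \<rho>"] vert[OF x(2)] by (intro edge_term_le_local_energy) (auto simp: ball_def)
      ultimately show ?thesis using x \<sigma> by (intro bexI[of _ x] exI[of _ \<sigma>]) (auto simp: edge_term_def mult_2 add_ac)
    qed
    then obtain x t where x: "x \<in> hub" "t\<^sup>2 = 1" "\<sigma> = 1 \<longrightarrow> t = 1" "near m (W + 2 * \<rho>) (cell v) (cell x)"
      "(g y - t * g x)\<^sup>2 \<le> ?L" by blast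
    \<comment> \<open>Three legs: v to the exit u, the edge from u to y, and y to the hub node x.
      The signs collected on the way multiply.\<close>
    have "(g v - s * \<sigma> * t * g x)\<^sup>2 = ((g v - s * g u) + s * (g u - \<sigma> * g y) + s * \<sigma> * (g y - t * g x))\<^sup>2"
      by (simp add: algebra_simps)
    also have "\<dots> \<le> 3 * ((g v - s * g u)\<^sup>2 + (s * (g u - \<sigma> * g y))\<^sup>2 + (s * \<sigma> * (g y - t * g x))\<^sup>2)"
      by (rule power2_sum3_le)
    also have "\<dots> = 3 * ((g v - s * g u)\<^sup>2 + (g u - \<sigma> * g y)\<^sup>2 + (g y - t * g x)\<^sup>2)"
      by (simp add: power_mult_distrib s \<sigma>)
    also have "\<dots> \<le> 3 * ((ball_bound W * real h) ^ 4 * ?L + ?L + ?L)"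
      using e1 x(5) uL u(4) by (intro mult_left_mono add_mono) (auto simp: edge_term_def)
    also have "\<dots> = 3 * (ball_bound W ^ 4 * real h ^ 4 + 2) * ?L" by (simp add: algebra_simps power_mult_distrib)
    also have "\<dots> \<le> 3 * (ball_bound W ^ 4 * real h ^ 4 + 2 * real h ^ 4) * ?L"
      using h1 L by (intro mult_right_mono mult_left_mono add_left_mono) auto
    also have "\<dots> = 3 * (ball_bound W ^ 4 + 2) * real h ^ 4 * ?L" by (simp add: algebra_simps)
    finally show ?thesis using x \<sigma> s
      by (intro bexI[of _ x] exI[of _ "s * \<sigma> * t"]) (auto simp: power_mult_distrib)
  qed
qed

text \<open>For such v the two weights sum to at most 2 w u, so v lies within q cells, where q^d is
  of order w u + 1. The base 18 is 9 from 6 q + 3 <= 9 q and 2 from rounding q.\<close>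

lemma lighter_neighbours:
  assumes u: "u < n"
  shows "real (card {v. A u v \<and> w v \<le> w u}) \<le> 18 ^ d * C0 * (2 / kl + 1) * (w u + 1) * real h"
proof -
  have w: "0 \<le> w u" by (rule w_nonneg[OF u])
  obtain q where q: "q \<ge> 1" "2 * w u / kl < real q ^ d" "real q ^ d \<le> 2 ^ d * (2 * w u / kl + 1)"
    using nat_root_bound[of "2 * w u / kl" d] w kl d by auto
  have "2 * w u < kl * real q ^ d" using q(2) kl by (simp add: field_simps)
  then have "{v. A u v \<and> w v \<le> w u} \<subseteq> {i. i < n \<and> near m q (cell u) (cell i)}"
    using adjD[of u _ q] vert by fastforce
  then have "card {v. A u v \<and> w v \<le> w u} \<le> card {i. i < n \<and> near m q (cell u) (cell i)}"
    by (intro card_mono) auto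
  then have "real (card {v. A u v \<and> w v \<le> w u}) \<le> ball_bound q * real h"
    using node_count[OF cell_grid[OF u], of q] by linarith
  also have "ball_bound q \<le> 18 ^ d * C0 * (2 / kl + 1) * (w u + 1)"
  proof -
    have "real ((6 * q + 3) ^ d) \<le> (9 * real q) ^ d"
      unfolding of_nat_power using q(1) by (intro power_mono) auto
    also have "\<dots> = 9 ^ d * real q ^ d" by (simp add: power_mult_distrib)
    also have "\<dots> \<le> 9 ^ d * (2 ^ d * (2 * w u / kl + 1))" using q by (intro mult_left_mono) auto
    also have "\<dots> = 18 ^ d * (2 * w u / kl + 1)" by (simp add: power_mult_distrib[symmetric])
    also have "\<dots> \<le> 18 ^ d * ((2 / kl + 1) * (w u + 1))"
    proof (rule mult_left_mono)
      have "0 \<le> 2 / kl" using kl by simp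
      moreover have "(2 / kl + 1) * (w u + 1) = 2 * w u / kl + 1 + 2 / kl + w u" by (simp add: distrib_left distrib_right)
      ultimately show "2 * w u / kl + 1 \<le> (2 / kl + 1) * (w u + 1)" using w by linarith
    qed simp
    finally show ?thesis using C0 by (simp add: ball_bound_def mult_ac mult_left_mono)
  qed
  finally show ?thesis by (simp add: mult_right_mono)
qed

text \<open>Each edge is charged to its endpoint of larger weight; degrees themselves are not controlled
  pointwise by the weights, because of heavy neighbours.\<close>

lemma ip_le_weighted:
  assumes \<sigma>: "\<sigma>\<^sup>2 = 1"
  shows "ip g g \<le> 2 * energy \<sigma> g + 3 * (18 ^ d * C0 * (2 / kl + 1)) * real h * (\<Sum>u<n. (w u + 1) * (g u)\<^sup>2)"
proof -
  let ?D = "\<lambda>u. \<Sum>v<n. of_bool (A u v \<and> w v \<le> w u) :: real"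
  have "ip g g = (\<Sum>u<n. \<Sum>v<n. of_bool (A u v) * (g v)\<^sup>2)"
    unfolding sum_deg_right ip_def by (simp add: power2_eq_square mult.assoc)
  also have "\<dots> \<le> (\<Sum>u<n. \<Sum>v<n. of_bool (A v u \<and> w u \<le> w v) * (g v)\<^sup>2
      + 2 * edge_term \<sigma> g u v + 2 * (of_bool (A u v \<and> w v \<le> w u) * (g u)\<^sup>2))"
  proof (intro sum_mono)
    fix u v
    \<comment> \<open>If u is the heavier end point, g v is replaced by g u at the price of the
      energy of the edge.\<close>
    have "(g v)\<^sup>2 \<le> 2 * (g u - \<sigma> * g v)\<^sup>2 + 2 * (g u)\<^sup>2"
      using power2_sum_le[of "\<sigma> * g v - g u" "g u"] \<sigma> by (simp add: power_mult_distrib power2_commute)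
    then show "of_bool (A u v) * (g v)\<^sup>2 \<le> of_bool (A v u \<and> w u \<le> w v) * (g v)\<^sup>2
      + 2 * edge_term \<sigma> g u v + 2 * (of_bool (A u v \<and> w v \<le> w u) * (g u)\<^sup>2)"
      using adj_commute[of u v] by (auto simp: edge_term_def)
  qed
  also have "\<dots> = (\<Sum>u<n. \<Sum>v<n. of_bool (A v u \<and> w u \<le> w v) * (g v)\<^sup>2) + 2 * energy \<sigma> g
      + 2 * (\<Sum>u<n. ?D u * (g u)\<^sup>2)"
    by (simp add: sum.distrib energy_edge_term sum_distrib_left sum_distrib_right)
  also have "(\<Sum>u<n. \<Sum>v<n. of_bool (A v u \<and> w u \<le> w v) * (g v)\<^sup>2) = (\<Sum>v<n. ?D v * (g v)\<^sup>2)"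
    by (subst sum.swap) (simp add: sum_distrib_right)
  finally have "ip g g \<le> 2 * energy \<sigma> g + 3 * (\<Sum>u<n. ?D u * (g u)\<^sup>2)" by simp
  also have "(\<Sum>u<n. ?D u * (g u)\<^sup>2) \<le> (\<Sum>u<n. (18 ^ d * C0 * (2 / kl + 1) * (w u + 1) * real h) * (g u)\<^sup>2)"
  proof (intro sum_mono mult_right_mono)
    fix u assume "u \<in> {..<n}"
    moreover have "{v. A u v \<and> w v \<le> w u} = {..<n} \<inter> {v. A u v \<and> w v \<le> w u}" using vert by auto
    ultimately show "?D u \<le> 18 ^ d * C0 * (2 / kl + 1) * (w u + 1) * real h"
      using lighter_neighbours[of u] by (simp add: sum_of_bool_eq)
  qed auto
  finally show ?thesis by (simp add: sum_distrib_left mult_ac)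
qed

end

subsection \<open>Spectral bounds\<close>

lemma sum_Un_le:
  fixes f :: "'a \<Rightarrow> real"
  assumes "finite A" "finite B" "\<And>x. x \<in> A \<inter> B \<Longrightarrow> 0 \<le> f x"
  shows "sum f (A \<union> B) \<le> sum f A + sum f B"
  using sum.union_inter[OF assms(1,2), of f] sum_nonneg[of "A \<inter> B" f, OF assms(3)] by linarith

context gtg_config begin

definition reach_const :: real where
  "reach_const = 3 * (ball_bound W ^ 4 + 2)"

definition far_const :: real where
  "far_const = real (6 * W + 6 * M + 15) ^ d * C\<rho> * C0"

definition coarse_const :: real where
  "coarse_const = 2 ^ d * (real (6 * W + 15) ^ d * C\<rho> + real (6 * M) ^ d) * C0"

lemma rho_ge_1: "1 \<le> \<rho>"
  using \<rho>(1) T kl d by (cases "\<rho> = 0") (auto simp: power_0_left)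

lemma wb_nonneg: "0 \<le> wb" using wb ku by simp

lemma Crho_nonneg: "0 \<le> C\<rho>"
proof -
  have "0 \<le> C\<rho> * T" using \<rho>(2) zero_le_power[of "real \<rho>" d] by linarith
  then show ?thesis using T by (simp add: zero_le_mult_iff)
qed

lemma const_nonneg: "0 \<le> reach_const" "0 \<le> far_const" "0 \<le> coarse_const"
  using ball_bound_nonneg[of W] Crho_nonneg C0 by (simp_all add: reach_const_def far_const_def coarse_const_def)

lemma ball_bound_far: "ball_bound (W + 2 * \<rho> + M) \<le> far_const * T"
proof -
  have "6 * (W + 2 * \<rho> + M) + 3 = 12 * \<rho> + (6 * W + 6 * M + 3) * 1" by simp
  also have "\<dots> \<le> 12 * \<rho> + (6 * W + 6 * M + 3) * \<rho>" using rho_ge_1 by (intro add_left_mono mult_left_mono) auto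
  also have "\<dots> = (6 * W + 6 * M + 15) * \<rho>" by (simp add: algebra_simps)
  finally have "(6 * (W + 2 * \<rho> + M) + 3) ^ d \<le> ((6 * W + 6 * M + 15) * \<rho>) ^ d" by (intro power_mono) auto
  then have "real ((6 * (W + 2 * \<rho> + M) + 3) ^ d) \<le> real (((6 * W + 6 * M + 15) * \<rho>) ^ d)" by (simp only: of_nat_le_iff)
  also have "\<dots> = real (6 * W + 6 * M + 15) ^ d * real \<rho> ^ d" by (simp only: power_mult_distrib of_nat_power of_nat_mult)
  also have "\<dots> \<le> real (6 * W + 6 * M + 15) ^ d * (C\<rho> * T)" using \<rho>(2) by (intro mult_left_mono) auto
  finally have "real ((6 * (W + 2 * \<rho> + M) + 3) ^ d) * C0 \<le> real (6 * W + 6 * M + 15) ^ d * (C\<rho> * T) * C0"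
    using C0 by (intro mult_right_mono) auto
  then show ?thesis by (simp add: ball_bound_def far_const_def mult_ac)
qed

text \<open>As T <= p^2 <= p^d, even the range \<open>\<rho>\<close> of the heaviest nodes is at
  most of the order of the side of a coarse cube.\<close>

lemma ball_bound_coarse: "ball_bound (W + 2 * \<rho> + M * p) \<le> coarse_const * real p ^ d"
proof -
  have "6 * (W + 2 * \<rho> + M * p) + 3 = 12 * \<rho> + (6 * W + 3) * 1 + 6 * M * p" by simp
  also have "\<dots> \<le> 12 * \<rho> + (6 * W + 3) * \<rho> + 6 * M * p"
    using rho_ge_1 by (intro add_right_mono add_left_mono mult_left_mono) auto
  also have "\<dots> = (6 * W + 15) * \<rho> + 6 * M * p" by (simp add: algebra_simps)
  finally have "(6 * (W + 2 * \<rho> + M * p) + 3) ^ d \<le> ((6 * W + 15) * \<rho> + 6 * M * p) ^ d" by (intro power_mono) auto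
  then have "real ((6 * (W + 2 * \<rho> + M * p) + 3) ^ d) \<le> real (((6 * W + 15) * \<rho> + 6 * M * p) ^ d)" by (simp only: of_nat_le_iff)
  also have "\<dots> = (real (6 * W + 15) * real \<rho> + real (6 * M) * real p) ^ d"
    by (simp only: of_nat_power of_nat_mult of_nat_add)
  also have "\<dots> \<le> 2 ^ d * ((real (6 * W + 15) * real \<rho>) ^ d + (real (6 * M) * real p) ^ d)"
    by (intro power_add_le) auto
  also have "\<dots> = 2 ^ d * (real (6 * W + 15) ^ d * real \<rho> ^ d + real (6 * M) ^ d * real p ^ d)"
    by (simp only: power_mult_distrib)
  also have "\<dots> \<le> 2 ^ d * (real (6 * W + 15) ^ d * (C\<rho> * real p ^ d) + real (6 * M) ^ d * real p ^ d)"
  proof -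
    have "real p ^ 2 \<le> real p ^ d" using p d by (intro power_increasing) auto
    then have "C\<rho> * T \<le> C\<rho> * real p ^ d" using T_p(1) Crho_nonneg by (intro mult_left_mono) auto
    then show ?thesis using \<rho>(2) by (intro mult_left_mono add_right_mono) auto
  qed
  finally have "real ((6 * (W + 2 * \<rho> + M * p) + 3) ^ d) * C0
     \<le> 2 ^ d * (real (6 * W + 15) ^ d * (C\<rho> * real p ^ d) + real (6 * M) ^ d * real p ^ d) * C0"
    using C0 by (intro mult_right_mono) auto
  then show ?thesis by (simp add: ball_bound_def coarse_const_def algebra_simps)
qed

text \<open>The two terms are the two ways of losing a factor T: light nodes look into a ball of
  about T cells, while the others carry a weight of order T. The losses never multiply, and T h^6 <=
  p^4 absorbs either one.\<close>

lemma local_sum: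
  assumes ab: "0 \<le> a" "0 \<le> b"
    and F: "\<And>v. v < n \<Longrightarrow> F v \<le> a * real h ^ 4 * local_energy \<sigma> g (ball (W + 2 * \<rho> + M) (cell v))
        + b * T * local_energy \<sigma> g (ball (2 * M) (cell v))"
  shows "real h * (\<Sum>v<n. F v) \<le> (a * far_const + b * ball_bound (2 * M)) * real p ^ 4 * energy \<sigma> g"
proof -
  let ?E = "energy \<sigma> g"
  have E: "0 \<le> ?E" by (rule energy_nonneg)
  have h1: "1 \<le> real h" using h by simp
  have "(\<Sum>v<n. F v) \<le> (\<Sum>v<n. a * real h ^ 4 * local_energy \<sigma> g (ball (W + 2 * \<rho> + M) (cell v))
        + b * T * local_energy \<sigma> g (ball (2 * M) (cell v)))"
    using F by (intro sum_mono) auto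
  also have "\<dots> = a * real h ^ 4 * (\<Sum>v<n. local_energy \<sigma> g (ball (W + 2 * \<rho> + M) (cell v)))
        + b * T * (\<Sum>v<n. local_energy \<sigma> g (ball (2 * M) (cell v)))"
    by (simp add: sum.distrib sum_distrib_left)
  also have "\<dots> \<le> a * real h ^ 4 * (far_const * T * real h * ?E) + b * T * (ball_bound (2 * M) * real h * ?E)"
  proof (intro add_mono mult_left_mono)
    have "(\<Sum>v<n. local_energy \<sigma> g (ball (W + 2 * \<rho> + M) (cell v))) \<le> ball_bound (W + 2 * \<rho> + M) * real h * ?E"
      by (rule sum_local_energy_ball)
    also have "\<dots> \<le> far_const * T * real h * ?E"
      using E by (intro mult_right_mono ball_bound_far) auto
    finally show "(\<Sum>v<n. local_energy \<sigma> g (ball (W + 2 * \<rho> + M) (cell v))) \<le> far_const * T * real h * ?E" .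
    show "(\<Sum>v<n. local_energy \<sigma> g (ball (2 * M) (cell v))) \<le> ball_bound (2 * M) * real h * ?E"
      by (rule sum_local_energy_ball)
  qed (use ab T in auto)
  finally have "real h * (\<Sum>v<n. F v)
      \<le> real h * (a * real h ^ 4 * (far_const * T * real h * ?E) + b * T * (ball_bound (2 * M) * real h * ?E))"
    by (intro mult_left_mono) auto
  also have "\<dots> = (a * far_const) * (T * real h ^ 6) * ?E + (b * ball_bound (2 * M)) * (T * real h ^ 2) * ?E"
    by (simp add: algebra_simps power_numeral_reduce)
  also have "\<dots> \<le> (a * far_const) * (real p ^ 4) * ?E + (b * ball_bound (2 * M)) * (real p ^ 4) * ?E"
  proof -
    have "T * real h ^ 2 \<le> T * real h ^ 6" using T h1 by (intro mult_left_mono power_increasing) auto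
    then have "T * real h ^ 2 \<le> real p ^ 4" using T_p(2) by linarith
    then show ?thesis using T_p(2) ab const_nonneg ball_bound_nonneg[of "2 * M"] E
      by (intro add_mono mult_right_mono mult_left_mono) auto
  qed
  finally show ?thesis by (simp add: algebra_simps)
qed

definition anti_const :: real where
  "anti_const = (wb + 1) * 2 * (reach_const + 3) * far_const + 16 * ball_bound (2 * M)"

text \<open>For the sign -1 a local argument suffices: a triangle is within reach of every node, so
  g v itself is controlled and no mean has to be subtracted.\<close>

lemma weighted_anti:
  "real h * (\<Sum>v<n. (w v + 1) * (g v)\<^sup>2) \<le> anti_const * real p ^ 4 * energy (-1) g"
  unfolding anti_const_def
proof (rule local_sum)
  show "0 \<le> (wb + 1) * 2 * (reach_const + 3)" using wb_nonneg const_nonneg by simp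
  show "(0 :: real) \<le> 16" by simp
  fix v assume v: "v < n"
  let ?L = "local_energy (-1) g (ball (W + 2 * \<rho> + M) (cell v))" and ?L' = "local_energy (-1) g (ball (2 * M) (cell v))"
  have L: "0 \<le> ?L" "0 \<le> ?L'" by (rule local_energy_nonneg)+
  have h4: "1 \<le> real h ^ 4" using h by (intro one_le_power) simp
  show "(w v + 1) * (g v)\<^sup>2 \<le> (wb + 1) * 2 * (reach_const + 3) * real h ^ 4 * ?L + 16 * T * ?L'"
  proof (cases "wb \<le> w v")
    case True
    have "(w v + 1) * (g v)\<^sup>2 \<le> (2 * T) * (8 * ?L')"
      using not_light_odd[OF v True, of g] w_le[OF v] T w_nonneg[OF v] by (intro mult_mono) auto
    moreover have "0 \<le> (wb + 1) * 2 * (reach_const + 3) * real h ^ 4 * ?L"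
      using wb_nonneg const_nonneg L by simp
    ultimately show ?thesis by simp
  next
    case False
    obtain x s where x: "x \<in> hub" "s\<^sup>2 = 1" "near m (W + 2 * \<rho>) (cell v) (cell x)"
      "(g v - s * g x)\<^sup>2 \<le> reach_const * real h ^ 4 * local_energy (-1) g (ball (W + 2 * \<rho>) (cell v))"
      using reach_hub[OF v, of "-1" g] unfolding reach_const_def by auto
    have xn: "x < n" using x by (simp add: hub_def)
    have "(g x)\<^sup>2 \<le> 3 * local_energy (-1) g (ball M (cell x))" by (rule odd_cycle[OF x(1)])
    also have "\<dots> \<le> 3 * ?L" using x(3) v xn cell_grid by (intro mult_left_mono local_energy_ball_le[of "W + 2 * \<rho>"]) auto
    also have "\<dots> \<le> 3 * real h ^ 4 * ?L" using h4 L by (intro mult_right_mono) auto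
    finally have gx: "(g x)\<^sup>2 \<le> 3 * real h ^ 4 * ?L" .
    have "local_energy (-1) g (ball (W + 2 * \<rho>) (cell v)) \<le> ?L"
      by (intro local_energy_mono) (auto simp: ball_def elim: near_mono)
    then have "reach_const * real h ^ 4 * local_energy (-1) g (ball (W + 2 * \<rho>) (cell v)) \<le> reach_const * real h ^ 4 * ?L"
      using const_nonneg by (intro mult_left_mono) auto
    then have "(g v - s * g x)\<^sup>2 \<le> reach_const * real h ^ 4 * ?L" using x(4) by linarith
    moreover have "(g v)\<^sup>2 \<le> 2 * (g v - s * g x)\<^sup>2 + 2 * (g x)\<^sup>2"
      using power2_sum_le[of "g v - s * g x" "s * g x"] x(2) by (simp add: power_mult_distrib)
    ultimately have "(g v)\<^sup>2 \<le> 2 * (reach_const * real h ^ 4 * ?L) + 2 * (3 * real h ^ 4 * ?L)"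
      using gx by linarith
    also have "\<dots> = 2 * (reach_const + 3) * real h ^ 4 * ?L" by (simp add: algebra_simps)
    finally have "(w v + 1) * (g v)\<^sup>2 \<le> (wb + 1) * (2 * (reach_const + 3) * real h ^ 4 * ?L)"
      using False w_nonneg[OF v] by (intro mult_mono) auto
    also have "\<dots> = (wb + 1) * 2 * (reach_const + 3) * real h ^ 4 * ?L" by (simp only: mult.assoc)
    finally have "(w v + 1) * (g v)\<^sup>2 \<le> (wb + 1) * 2 * (reach_const + 3) * real h ^ 4 * ?L" .
    moreover have "0 \<le> 16 * T * ?L'" using T L by simp
    ultimately show ?thesis by linarith
  qed
qed

text \<open>A path between two neighbouring hubs stays inside their two blocks, and each block takes
  part in at most two such pairs per direction.\<close>

lemma total_grad:
  "(real h)\<^sup>2 * (\<Sum>k\<in>UNIV. grad (p * p) (hub_mean g) k) \<le> 2 * real d * real (2 * M ^ d) ^ 4 * energy 1 g"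
proof -
  let ?G = "grid (p * p)" and ?c = "real (2 * M ^ d) ^ 4" and ?E = "energy 1 g"
  have blocks: "(\<Sum>Q\<in>?G. local_energy 1 g (block Q)) = ?E"
  proof -
    have "(\<Sum>Q\<in>?G. local_energy 1 g (block Q)) = (\<Sum>Q\<in>?G. \<Sum>y\<in>{y \<in> {..<n}. block_of (cell y) = Q}. \<Sum>y'<n. edge_term 1 g y y')"
      unfolding local_energy_def block_def using cell_grid by (intro sum.cong) auto
    also have "\<dots> = (\<Sum>y<n. \<Sum>y'<n. edge_term 1 g y y')"
      by (intro sum.group) (auto simp: cell_block_of)
    finally show ?thesis by (simp add: energy_edge_term)
  qed
  have k: "(real h)\<^sup>2 * grad (p * p) (hub_mean g) k \<le> ?c * (2 * ?E)" for k
  proof -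
    let ?S = "{Q \<in> ?G. Q k + 1 < p * p}"
    have "(real h)\<^sup>2 * grad (p * p) (hub_mean g) k = (\<Sum>Q\<in>?S. (real h)\<^sup>2 * (hub_mean g (Q(k := Q k + 1)) - hub_mean g Q)\<^sup>2)"
      unfolding grad_def sum_distrib_left by (intro sum.mono_neutral_cong_right) auto
    also have "\<dots> \<le> (\<Sum>Q\<in>?S. ?c * (local_energy 1 g (block Q) + local_energy 1 g (block (Q(k := Q k + 1)))))"
    proof (intro sum_mono)
      fix Q assume "Q \<in> ?S"
      then have Q: "Q \<in> ?G" "Q(k := Q k + 1) \<in> ?G" by (auto simp: grid_def)
      let ?Q = "Q(k := Q k + 1)" let ?U = "hub_cells Q \<union> hub_cells ?Q"
      have "(real h)\<^sup>2 * (hub_mean g Q - hub_mean g ?Q)\<^sup>2 \<le> real (card ?U) ^ 4 * local_energy 1 g ?U"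
        unfolding hub_mean_def using hub_adjacent_connected[OF Q refl rep[OF Q(1)] rep[OF Q(2)]]
        by (intro cell_mean_connected) (auto simp: finite_hub_cells dest: hub_cells_good)
      also have "\<dots> \<le> ?c * (local_energy 1 g (block Q) + local_energy 1 g (block ?Q))"
      proof (intro mult_mono power_mono)
        have "card ?U \<le> 2 * M ^ d"
          using card_Un_le[of "hub_cells Q" "hub_cells ?Q"] card_hub_cells[of Q] card_hub_cells[of ?Q] by linarith
        then show "real (card ?U) \<le> real (2 * M ^ d)" by (simp only: of_nat_le_iff)
        have "local_energy 1 g ?U \<le> local_energy 1 g (block Q \<union> block ?Q)"
          using hub_cells_block by (intro local_energy_mono) blast
        also have "\<dots> \<le> local_energy 1 g (block Q) + local_energy 1 g (block ?Q)"
        proof -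
          have "{y. y < n \<and> cell y \<in> block Q \<union> block ?Q} = {y. y < n \<and> cell y \<in> block Q} \<union> {y. y < n \<and> cell y \<in> block ?Q}" by auto
          then show ?thesis unfolding local_energy_def
            using sum_Un_le[of "{y. y < n \<and> cell y \<in> block Q}" "{y. y < n \<and> cell y \<in> block ?Q}" "\<lambda>y. \<Sum>y'<n. edge_term 1 g y y'"]
            by (simp only:) (simp add: sum_nonneg edge_term_nonneg)
        qed
        finally show "local_energy 1 g ?U \<le> local_energy 1 g (block Q) + local_energy 1 g (block ?Q)" .
      qed (auto simp: local_energy_nonneg)
      finally show "(real h)\<^sup>2 * (hub_mean g ?Q - hub_mean g Q)\<^sup>2 \<le> ?c * (local_energy 1 g (block Q) + local_energy 1 g (block ?Q))"
        unfolding power2_commute[of "hub_mean g ?Q"] .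
    qed
    also have "\<dots> = ?c * ((\<Sum>Q\<in>?S. local_energy 1 g (block Q)) + (\<Sum>Q\<in>?S. local_energy 1 g (block (Q(k := Q k + 1)))))"
      by (simp only: sum.distrib sum_distrib_left[symmetric])
    also have "\<dots> \<le> ?c * (?E + ?E)"
    proof (intro mult_left_mono add_mono)
      show "(\<Sum>Q\<in>?S. local_energy 1 g (block Q)) \<le> ?E"
        unfolding blocks[symmetric] by (intro sum_mono2) (auto simp: local_energy_nonneg)
      have inj: "inj_on (\<lambda>Q. Q(k := Q k + 1)) ?S"
        by (rule inj_on_inverseI[where g = "\<lambda>Q. Q(k := Q k - 1)"]) simp
      have "(\<Sum>Q\<in>?S. local_energy 1 g (block (Q(k := Q k + 1)))) = (\<Sum>Q\<in>(\<lambda>Q. Q(k := Q k + 1)) ` ?S. local_energy 1 g (block Q))"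
        using sum.reindex[OF inj, of "\<lambda>Q. local_energy 1 g (block Q)"] by (simp only: o_def)
      also have "\<dots> \<le> ?E"
        unfolding blocks[symmetric]
      proof (rule sum_mono2)
        show "(\<lambda>Q. Q(k := Q k + 1)) ` ?S \<subseteq> ?G" by (auto simp: grid_def)
      qed (auto simp: local_energy_nonneg)
      finally show "(\<Sum>Q\<in>?S. local_energy 1 g (block (Q(k := Q k + 1)))) \<le> ?E" .
    qed simp
    finally show ?thesis by simp
  qed
  have "(real h)\<^sup>2 * (\<Sum>k\<in>UNIV. grad (p * p) (hub_mean g) k) \<le> (\<Sum>k\<in>(UNIV :: 'd set). ?c * (2 * ?E))"
    unfolding sum_distrib_left by (intro sum_mono k)
  then show ?thesis by (simp add: d mult_ac)
qed

text \<open>Each node is assigned to a block with whose hub it can be compared: its own if the node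
  is not light, otherwise the block of a hub node found by \<open>reach_hub\<close>. The last two
  conjuncts record how far the assignment moves a node, for the mass bounds in
  \<open>weighted_gap\<close>.\<close>

lemma target_exists:
  assumes v: "v < n"
  shows "\<exists>Q\<in>grid (p * p). (w v + 1) * (g v - hub_mean g Q)\<^sup>2
      \<le> (wb + 1) * 2 * (reach_const + 2 + 2 * real (M ^ d) ^ 4) * real h ^ 4 * local_energy 1 g (ball (W + 2 * \<rho> + M) (cell v))
        + 2 * T * local_energy 1 g (ball (2 * M) (cell v))
    \<and> (wb \<le> w v \<longrightarrow> Q = block_of (cell v))
    \<and> (w v < wb \<longrightarrow> (\<exists>x<n. near m (W + 2 * \<rho>) (cell v) (cell x) \<and> Q = block_of (cell x)))"
proof -
  let ?L = "local_energy 1 g (ball (W + 2 * \<rho> + M) (cell v))" and ?L' = "local_energy 1 g (ball (2 * M) (cell v))"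
  let ?a = "2 + 2 * real (M ^ d) ^ 4"
  have L: "0 \<le> ?L" "0 \<le> ?L'" by (rule local_energy_nonneg)+
  have h4: "1 \<le> real h ^ 4" using h by (intro one_le_power) simp
  show ?thesis
  proof (cases "wb \<le> w v")
    case True
    have "(g v - hub_mean g (block_of (cell v)))\<^sup>2 \<le> local_energy 1 g (ball M (cell v))" by (rule not_light_diff[OF v True])
    also have "\<dots> \<le> ?L'" by (intro local_energy_mono) (auto simp: ball_def elim: near_mono)
    finally have "(w v + 1) * (g v - hub_mean g (block_of (cell v)))\<^sup>2 \<le> (2 * T) * ?L'"
      using w_le[OF v] T w_nonneg[OF v] by (intro mult_mono) auto
    moreover have "0 \<le> (wb + 1) * 2 * (reach_const + 2 + 2 * real (M ^ d) ^ 4) * real h ^ 4 * ?L"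
      using wb_nonneg const_nonneg L by simp
    ultimately show ?thesis using True cell_block_of[OF v] by (intro bexI[of _ "block_of (cell v)"]) auto
  next
    case False
    obtain x where x: "x \<in> hub" "near m (W + 2 * \<rho>) (cell v) (cell x)"
      "(g v - g x)\<^sup>2 \<le> reach_const * real h ^ 4 * local_energy 1 g (ball (W + 2 * \<rho>) (cell v))"
      using reach_hub[OF v, of 1 g] unfolding reach_const_def by auto
    let ?Q = "block_of (cell x)"
    have xn: "x < n" using x by (simp add: hub_def)
    have "(g x - hub_mean g ?Q)\<^sup>2 \<le> ?a * local_energy 1 g (ball M (cell x))" by (rule hub_diff[OF x(1)])
    also have "\<dots> \<le> ?a * ?L" using x(2) v xn cell_grid by (intro mult_left_mono local_energy_ball_le[of "W + 2 * \<rho>"]) auto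
    also have "\<dots> \<le> ?a * real h ^ 4 * ?L"
    proof (rule mult_right_mono[OF _ L(1)])
      have "?a * 1 \<le> ?a * real h ^ 4" by (intro mult_left_mono h4) simp
      then show "?a \<le> ?a * real h ^ 4" by simp
    qed
    finally have gx: "(g x - hub_mean g ?Q)\<^sup>2 \<le> ?a * real h ^ 4 * ?L" .
    have "local_energy 1 g (ball (W + 2 * \<rho>) (cell v)) \<le> ?L"
      by (intro local_energy_mono) (auto simp: ball_def elim: near_mono)
    then have "reach_const * real h ^ 4 * local_energy 1 g (ball (W + 2 * \<rho>) (cell v)) \<le> reach_const * real h ^ 4 * ?L"
      using const_nonneg by (intro mult_left_mono) auto
    then have "(g v - hub_mean g ?Q)\<^sup>2 \<le> 2 * (reach_const * real h ^ 4 * ?L) + 2 * (?a * real h ^ 4 * ?L)"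
      using x(3) gx power2_sum_le[of "g v - g x" "g x - hub_mean g ?Q"] by simp
    also have "\<dots> = 2 * (reach_const + ?a) * real h ^ 4 * ?L" by (simp add: algebra_simps)
    finally have "(w v + 1) * (g v - hub_mean g ?Q)\<^sup>2 \<le> (wb + 1) * (2 * (reach_const + ?a) * real h ^ 4 * ?L)"
      using False w_nonneg[OF v] by (intro mult_mono) auto
    also have "\<dots> = (wb + 1) * 2 * (reach_const + 2 + 2 * real (M ^ d) ^ 4) * real h ^ 4 * ?L"
      by (simp add: algebra_simps)
    finally have "(w v + 1) * (g v - hub_mean g ?Q)\<^sup>2 \<le> (wb + 1) * 2 * (reach_const + 2 + 2 * real (M ^ d) ^ 4) * real h ^ 4 * ?L
        + 2 * T * ?L'" using T L by (simp add: add_increasing2)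
    then show ?thesis using False xn x(2) cell_block_of[OF xn] by (intro bexI[of _ ?Q]) auto
  qed
qed

definition gap_weight_const :: real where
  "gap_weight_const = 2 * ((wb + 1) * 2 * (reach_const + 2 + 2 * real (M ^ d) ^ 4) * far_const + 2 * ball_bound (2 * M))
    + 2 * (2 * 2 ^ d * (((wb + 1) * far_const + 2 * ball_bound M) + ((wb + 1) * coarse_const + C1))
        * (2 * real d * real (2 * M ^ d) ^ 4))"

text \<open>The number a is the unweighted mean of \<open>hub_mean\<close> over the grid of blocks.
  The deviation splits into the local error of assigning v to Q v and the two-scale inequality for
  \<open>hub_mean\<close> with masses w v + 1.\<close>

lemma weighted_gap:
  "\<exists>a. real h * (\<Sum>v<n. (w v + 1) * (g v - a)\<^sup>2) \<le> gap_weight_const * real p ^ 4 * energy 1 g"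
proof -
  let ?a1 = "(wb + 1) * 2 * (reach_const + 2 + 2 * real (M ^ d) ^ 4)"
  obtain Q where Q: "\<And>v. v < n \<Longrightarrow> Q v \<in> grid (p * p)"
    "\<And>v. v < n \<Longrightarrow> (w v + 1) * (g v - hub_mean g (Q v))\<^sup>2 \<le> ?a1 * real h ^ 4 * local_energy 1 g (ball (W + 2 * \<rho> + M) (cell v))
        + 2 * T * local_energy 1 g (ball (2 * M) (cell v))"
    "\<And>v. v < n \<Longrightarrow> wb \<le> w v \<Longrightarrow> Q v = block_of (cell v)"
    "\<And>v. v < n \<Longrightarrow> w v < wb \<Longrightarrow> \<exists>x<n. near m (W + 2 * \<rho>) (cell v) (cell x) \<and> Q v = block_of (cell x)"
    using target_exists[of _ g] by metis
  have alg1: "c * (x * P + y * P) * (Z * e) = c * (x + y) * Z * P * e"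
    and alg2: "(2 * x + 2 * y) * P * e = 2 * (x * P * e) + 2 * (y * P * e)" for c x y P Z e :: real
    by (simp_all add: algebra_simps)
  let ?E = "energy 1 g"
  have E: "0 \<le> ?E" by (rule energy_nonneg)
  let ?G = "\<Sum>k\<in>UNIV. grad (p * p) (hub_mean g) k"
  have G: "0 \<le> ?G" by (intro sum_nonneg grad_nonneg)
  define a where "a = grid_mean (p * p) (hub_mean g)"
  define X1 where "X1 = (wb + 1) * far_const + 2 * ball_bound M"
  define X2 where "X2 = (wb + 1) * coarse_const + C1"
  have X: "0 \<le> X1" "0 \<le> X2" using wb_nonneg const_nonneg ball_bound_nonneg[of M] C1 by (simp_all add: X1_def X2_def)
  have near1: "real h * (\<Sum>v<n. (w v + 1) * (g v - hub_mean g (Q v))\<^sup>2)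
      \<le> (?a1 * far_const + 2 * ball_bound (2 * M)) * real p ^ 4 * ?E"
    by (rule local_sum[OF _ _ Q(2)]) (use wb_nonneg const_nonneg in auto)
  \<comment> \<open>The mass assigned to a region comes from light nodes in a slightly larger
    region, each weighing at most wb + 1, and from the other nodes, which have not been
    moved.\<close>
  have light_mass: "(\<Sum>v\<in>{v \<in> {..<n}. P (Q v)}. w v + 1)
      \<le> (wb + 1) * (ball_bound (W + 2 * \<rho> + q) * real h) + (\<Sum>v\<in>{v \<in> {..<n}. wb \<le> w v \<and> P (block_of (cell v))}. w v + 1)"
    if c0: "c0 \<in> grid m" and P: "\<And>c. c \<in> grid m \<Longrightarrow> P (block_of c) \<Longrightarrow> near m q c0 c" for P c0 q
  proof -
    have "{v \<in> {..<n}. P (Q v)} \<subseteq> {i. i < n \<and> w i < wb \<and> near m (W + 2 * \<rho> + q) c0 (cell i)}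
        \<union> {v \<in> {..<n}. wb \<le> w v \<and> P (block_of (cell v))}" (is "_ \<subseteq> ?A \<union> ?B")
    proof
      fix v assume "v \<in> {v \<in> {..<n}. P (Q v)}"
      then have v: "v < n" "P (Q v)" by auto
      show "v \<in> ?A \<union> ?B"
      proof (cases "wb \<le> w v")
        case True
        then show ?thesis using v Q(3)[OF v(1)] by auto
      next
        case False
        then obtain x where x: "x < n" "near m (W + 2 * \<rho>) (cell v) (cell x)" "Q v = block_of (cell x)"
          using Q(4)[OF v(1)] by auto
        have "near m q c0 (cell x)" using P cell_grid x v by auto
        then have "near m (q + (W + 2 * \<rho>)) c0 (cell v)"
          using x(2) by (intro near_trans[of m q c0 "cell x"]) (auto simp: near_sym cell_grid c0 x v)
        then show ?thesis using v False by (simp add: add.commute)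
      qed
    qed
    then have "(\<Sum>v\<in>{v \<in> {..<n}. P (Q v)}. w v + 1) \<le> (\<Sum>v\<in>?A \<union> ?B. w v + 1)"
      using w_nonneg by (intro sum_mono2) fastforce+
    also have "\<dots> \<le> (\<Sum>v\<in>?A. w v + 1) + (\<Sum>v\<in>?B. w v + 1)"
      using w_nonneg by (intro sum_Un_le) fastforce+
    also have "(\<Sum>v\<in>?A. w v + 1) \<le> (\<Sum>v\<in>?A. wb + 1)" by (intro sum_mono) auto
    also have "\<dots> = (wb + 1) * real (card ?A)" by simp
    also have "\<dots> \<le> (wb + 1) * (ball_bound (W + 2 * \<rho> + q) * real h)"
    proof (rule mult_left_mono)
      have "card ?A \<le> card {i. i < n \<and> near m (W + 2 * \<rho> + q) c0 (cell i)}" by (intro card_mono) auto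
      then show "real (card ?A) \<le> ball_bound (W + 2 * \<rho> + q) * real h"
        using node_count[OF c0, of "W + 2 * \<rho> + q"] by linarith
    qed (use wb_nonneg in simp)
    finally show ?thesis by simp
  qed
  \<comment> \<open>On the scale of one block the crude weight bound T is enough, because
    \<open>two_scale_poincare\<close> multiplies it only by p^2.\<close>
  have m1: "(\<Sum>v\<in>{v \<in> {..<n}. Q v = Y}. w v + 1) \<le> X1 * T * real h" if Y: "Y \<in> grid (p * p)" for Y
  proof -
    have c0: "(\<lambda>k. M * Y k + 0) \<in> block Y" using M_pos by (intro block_point Y) auto
    let ?c0 = "\<lambda>k. M * Y k + 0"
    have c0g: "?c0 \<in> grid m" using c0 by (simp add: block_def)
    have nr: "near m M ?c0 c" if "block_of c = Y" for c
      using c0 that by (intro block_of_near) (simp add: block_def)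
    have "(\<Sum>v\<in>{v \<in> {..<n}. Q v = Y}. w v + 1) \<le> (wb + 1) * (ball_bound (W + 2 * \<rho> + M) * real h)
        + (\<Sum>v\<in>{v \<in> {..<n}. wb \<le> w v \<and> block_of (cell v) = Y}. w v + 1)"
      by (rule light_mass[OF c0g]) (rule nr)
    also have "(\<Sum>v\<in>{v \<in> {..<n}. wb \<le> w v \<and> block_of (cell v) = Y}. w v + 1)
        \<le> (\<Sum>v\<in>{v \<in> {..<n}. wb \<le> w v \<and> block_of (cell v) = Y}. 2 * T)"
      using w_le T by (intro sum_mono) fastforce
    also have "\<dots> = real (card {v \<in> {..<n}. wb \<le> w v \<and> block_of (cell v) = Y}) * (2 * T)" by simp
    also have "\<dots> \<le> (ball_bound M * real h) * (2 * T)"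
    proof (rule mult_right_mono)
      have "card {v \<in> {..<n}. wb \<le> w v \<and> block_of (cell v) = Y} \<le> card {i. i < n \<and> near m M ?c0 (cell i)}"
        using nr by (intro card_mono) auto
      then show "real (card {v \<in> {..<n}. wb \<le> w v \<and> block_of (cell v) = Y}) \<le> ball_bound M * real h"
        using node_count[OF c0g, of M] by linarith
    qed (use T in simp)
    also have "(wb + 1) * (ball_bound (W + 2 * \<rho> + M) * real h) \<le> (wb + 1) * (far_const * T * real h)"
      using wb_nonneg by (intro mult_left_mono mult_right_mono ball_bound_far) auto
    finally show ?thesis by (simp add: X1_def algebra_simps)
  qed
  \<comment> \<open>On the coarse scale no factor T may be lost; here \<open>coarse_mass\<close> is
    used.\<close>
  have m2: "(\<Sum>v\<in>{v \<in> {..<n}. (\<lambda>k. Q v k div p) = C}. w v + 1) \<le> X2 * real p ^ d * real h" if C: "C \<in> grid p" for C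
  proof -
    let ?c0 = "\<lambda>k. M * (p * C k)"
    have c0g: "?c0 \<in> grid m" using C p M_pos by (auto simp: grid_def m)
    have nr: "near m (M * p) ?c0 c" if "(\<lambda>k. block_of c k div p) = C" for c
    proof -
      have "\<bar>int (?c0 k) - int (c k)\<bar> \<le> int (M * p)" for k
      proof -
        have "c k div (M * p) = C k" using fun_cong[OF that, of k] by (simp add: block_of_def div_mult2_eq)
        then have "c k = (M * p) * C k + c k mod (M * p)" by (metis mult_div_mod_eq)
        moreover have "c k mod (M * p) < M * p" using M_pos p by simp
        ultimately have "?c0 k \<le> c k" "c k \<le> ?c0 k + M * p" by (simp_all add: mult.assoc)
        then show ?thesis by linarith
      qed
      then show ?thesis by (simp add: near_def)
    qed
    have "(\<Sum>v\<in>{v \<in> {..<n}. (\<lambda>k. Q v k div p) = C}. w v + 1) \<le> (wb + 1) * (ball_bound (W + 2 * \<rho> + M * p) * real h)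
        + (\<Sum>v\<in>{v \<in> {..<n}. wb \<le> w v \<and> (\<lambda>k. block_of (cell v) k div p) = C}. w v + 1)"
      by (rule light_mass[OF c0g]) (rule nr)
    also have "(\<Sum>v\<in>{v \<in> {..<n}. wb \<le> w v \<and> (\<lambda>k. block_of (cell v) k div p) = C}. w v + 1)
        \<le> (\<Sum>i\<in>{i. i < n \<and> (\<lambda>k. cell i k div M div p) = C}. w i + 1)"
      using w_nonneg by (intro sum_mono2) (auto simp: block_of_def add_nonneg_nonneg)
    also have "\<dots> \<le> C1 * real p ^ d * real h" by (rule coarse_mass[OF C])
    also have "(wb + 1) * (ball_bound (W + 2 * \<rho> + M * p) * real h) \<le> (wb + 1) * (coarse_const * real p ^ d * real h)"
      using wb_nonneg by (intro mult_left_mono mult_right_mono ball_bound_coarse) auto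
    finally show ?thesis by (simp add: X2_def algebra_simps)
  qed
  have "(\<Sum>v<n. (w v + 1) * (hub_mean g (Q v) - a)\<^sup>2)
      \<le> 2 * 2 ^ CARD('d) * (X1 * T * real h * (real p)\<^sup>2 + X2 * real p ^ d * real h * real p ^ 4 / real p ^ CARD('d)) * ?G"
    unfolding a_def using w_nonneg
    by (intro two_scale_poincare p m1 m2 Q(1)) (auto simp: add_nonneg_nonneg)
  also have "\<dots> = 2 * 2 ^ d * (X1 * (T * (real p)\<^sup>2) + X2 * real p ^ 4) * (real h * ?G)"
    using p by (simp add: d algebra_simps)
  finally have "real h * (\<Sum>v<n. (w v + 1) * (hub_mean g (Q v) - a)\<^sup>2)
      \<le> real h * (2 * 2 ^ d * (X1 * (T * (real p)\<^sup>2) + X2 * real p ^ 4) * (real h * ?G))"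
    by (intro mult_left_mono) auto
  also have "\<dots> = 2 * 2 ^ d * (X1 * (T * (real p)\<^sup>2) + X2 * real p ^ 4) * ((real h)\<^sup>2 * ?G)"
    by (simp add: power2_eq_square mult_ac)
  \<comment> \<open>T p^2 <= p^4 pays for the fine scale. The two factors h, from the statement and
    from the masses, are exactly what \<open>total_grad\<close> consumes.\<close>
  also have "\<dots> \<le> 2 * 2 ^ d * (X1 * real p ^ 4 + X2 * real p ^ 4) * (2 * real d * real (2 * M ^ d) ^ 4 * ?E)"
  proof (rule mult_mono)
    have "T * (real p)\<^sup>2 \<le> (real p)\<^sup>2 * (real p)\<^sup>2" using T_p(1) by (intro mult_right_mono) auto
    then have "T * (real p)\<^sup>2 \<le> real p ^ 4" by (simp add: power4_eq_xxxx power2_eq_square mult.assoc)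
    then show "2 * 2 ^ d * (X1 * (T * (real p)\<^sup>2) + X2 * real p ^ 4) \<le> 2 * 2 ^ d * (X1 * real p ^ 4 + X2 * real p ^ 4)"
      using X by (intro mult_left_mono add_right_mono) auto
    show "(real h)\<^sup>2 * ?G \<le> 2 * real d * real (2 * M ^ d) ^ 4 * ?E" by (rule total_grad)
  qed (use G X in auto)
  also have "\<dots> = 2 * 2 ^ d * (X1 + X2) * (2 * real d * real (2 * M ^ d) ^ 4) * real p ^ 4 * ?E"
    by (rule alg1)
  finally have far1: "real h * (\<Sum>v<n. (w v + 1) * (hub_mean g (Q v) - a)\<^sup>2)
      \<le> 2 * 2 ^ d * (X1 + X2) * (2 * real d * real (2 * M ^ d) ^ 4) * real p ^ 4 * ?E" .
  have "real h * (\<Sum>v<n. (w v + 1) * (g v - a)\<^sup>2)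
      \<le> real h * (\<Sum>v<n. (w v + 1) * (2 * (g v - hub_mean g (Q v))\<^sup>2 + 2 * (hub_mean g (Q v) - a)\<^sup>2))"
  proof (intro mult_left_mono sum_mono)
    fix v
    show "(g v - a)\<^sup>2 \<le> 2 * (g v - hub_mean g (Q v))\<^sup>2 + 2 * (hub_mean g (Q v) - a)\<^sup>2"
      using power2_sum_le[of "g v - hub_mean g (Q v)" "hub_mean g (Q v) - a"] by simp
  qed (use w_nonneg in \<open>auto simp: add_nonneg_nonneg\<close>)
  also have "\<dots> = 2 * (real h * (\<Sum>v<n. (w v + 1) * (g v - hub_mean g (Q v))\<^sup>2))
      + 2 * (real h * (\<Sum>v<n. (w v + 1) * (hub_mean g (Q v) - a)\<^sup>2))"
    by (simp add: distrib_left sum.distrib sum_distrib_left mult_ac)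
  also have "\<dots> \<le> gap_weight_const * real p ^ 4 * ?E"
    using near1 far1 unfolding gap_weight_const_def X1_def[symmetric] X2_def[symmetric] alg2
    by linarith
  finally show ?thesis by blast
qed

text \<open>Of the locale parameters only d, M, W, kl, wb, C0, C1 and \<open>C\<rho>\<close> occur,
  none of which varies with n, so one number serves all n.\<close>

definition gap_const :: real where
  "gap_const = 2 + 3 * (18 ^ d * C0 * (2 / kl + 1)) * (gap_weight_const + anti_const)"

lemma spectral_bounds:
  shows "1 \<le> gap_const * real p ^ 4"
    and "ip g (\<lambda>_. 1) = 0 \<Longrightarrow> ip g g \<le> gap_const * real p ^ 4 * energy 1 g"
    and "ip g g \<le> gap_const * real p ^ 4 * energy (-1) g"
proof -
  let ?D = "18 ^ d * C0 * (2 / kl + 1)"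
  have D: "0 \<le> ?D" using C0 kl by simp
  have c: "0 \<le> gap_weight_const" "0 \<le> anti_const"
    using wb_nonneg const_nonneg C1 ball_bound_nonneg by (simp_all add: gap_weight_const_def anti_const_def)
  have p4: "1 \<le> real p ^ 4" using p by (intro one_le_power) simp
  have g2: "2 \<le> gap_const" using D c by (simp add: gap_const_def)
  have "1 * 1 \<le> gap_const * real p ^ 4" using g2 p4 by (intro mult_mono) auto
  then show "1 \<le> gap_const * real p ^ 4" by simp
  have alg: "2 * P * e + 3 * D * (x * P * e) = (2 + 3 * D * x) * P * e" for D x P e :: real
    by (simp add: algebra_simps)
  have fin: "2 * e + 3 * ?D * (c' * real p ^ 4 * e) \<le> gap_const * real p ^ 4 * e"
    if "0 \<le> e" "c' \<le> gap_weight_const + anti_const" for e c'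
  proof -
    have "2 * e + 3 * ?D * (c' * real p ^ 4 * e) \<le> 2 * real p ^ 4 * e + 3 * ?D * ((gap_weight_const + anti_const) * real p ^ 4 * e)"
      using that D p4 by (intro add_mono mult_left_mono mult_right_mono) auto
    also have "\<dots> = gap_const * real p ^ 4 * e" unfolding gap_const_def by (rule alg)
    finally show ?thesis .
  qed
  show "ip g g \<le> gap_const * real p ^ 4 * energy (-1) g"
  proof -
    have "ip g g \<le> 2 * energy (-1) g + 3 * ?D * (real h * (\<Sum>u<n. (w u + 1) * (g u)\<^sup>2))"
      using ip_le_weighted[of "-1" g] by (simp add: mult.assoc)
    also have "\<dots> \<le> 2 * energy (-1) g + 3 * ?D * (anti_const * real p ^ 4 * energy (-1) g)"
      using D weighted_anti by (intro add_left_mono mult_left_mono) auto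
    also have "\<dots> \<le> gap_const * real p ^ 4 * energy (-1) g"
      by (rule fin) (use c energy_nonneg in auto)
    finally show ?thesis .
  qed
  assume mean: "ip g (\<lambda>_. 1) = 0"
  obtain a where a: "real h * (\<Sum>v<n. (w v + 1) * (g v - a)\<^sup>2) \<le> gap_weight_const * real p ^ 4 * energy 1 g"
    using weighted_gap[of g] by blast
  \<comment> \<open>For g of mean zero, subtracting a constant leaves the energy unchanged and can
    only increase \<open>ip\<close>, so any a from \<open>weighted_gap\<close> will do.\<close>
  let ?g = "\<lambda>v. 1 * g v + (- a) * 1"
  have "ip ?g ?g = ip g g + a\<^sup>2 * ip (\<lambda>_. 1) (\<lambda>_. 1)"
    unfolding ip_bilinear[of 1 g "- a" "\<lambda>_. 1"] using mean by simp
  moreover have "0 \<le> a\<^sup>2 * ip (\<lambda>_. 1) (\<lambda>_. 1)" using ip_nonneg[of "\<lambda>_. 1"] by simp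
  ultimately have "ip g g \<le> ip ?g ?g" by linarith
  also have "\<dots> \<le> 2 * energy 1 ?g + 3 * ?D * (real h * (\<Sum>u<n. (w u + 1) * (?g u)\<^sup>2))"
    using ip_le_weighted[of 1 ?g] by (simp add: mult.assoc)
  also have "energy 1 ?g = energy 1 g" by (simp add: energy_def cong: if_cong)
  also have "2 * energy 1 g + 3 * ?D * (real h * (\<Sum>u<n. (w u + 1) * (?g u)\<^sup>2))
      \<le> 2 * energy 1 g + 3 * ?D * (gap_weight_const * real p ^ 4 * energy 1 g)"
    using D a by (intro add_left_mono mult_left_mono) auto
  also have "\<dots> \<le> gap_const * real p ^ 4 * energy 1 g"
    by (rule fin) (use c energy_nonneg in auto)
  finally show "ip g g \<le> gap_const * real p ^ 4 * energy 1 g" .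
qed

end

subsection \<open>Independent samples\<close>

abbreviation iid :: "nat \<Rightarrow> 'a measure \<Rightarrow> (nat \<Rightarrow> 'a) measure" where
  "iid n M \<equiv> PiM {..<n} (\<lambda>_. M)"

context prob_space begin

lemma iid_prob_space: "prob_space (iid n M)"
  by (intro prob_space_PiM prob_space_axioms)

lemma iid_finite_measure: "finite_measure (iid n M)"
  using iid_prob_space by (rule prob_space.finite_measure)

lemma iid_cylinder:
  assumes J: "J \<subseteq> {..<n}" and B: "B \<in> events"
  shows "measure (iid n M) {\<omega> \<in> space (iid n M). \<forall>j\<in>J. \<omega> j \<in> B} = prob B ^ card J"
proof -
  interpret P: product_prob_space "\<lambda>_. M" "{..<n}" by unfold_locales
  have fJ: "finite J" using J finite_subset by blast
  have "emeasure (iid n M) {\<omega> \<in> space (iid n M). \<forall>j\<in>J. \<omega> j \<in> B} = (\<Prod>j\<in>J. emeasure M B)"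
    by (rule P.emeasure_PiM_Collect[OF J fJ B])
  also have "\<dots> = ennreal (prob B ^ card J)"
    by (simp add: emeasure_eq_measure ennreal_power)
  finally show ?thesis by (simp add: finite_measure.emeasure_eq_measure[OF iid_finite_measure])
qed

lemma iid_exists:
  assumes "B \<in> events"
  shows "{\<omega> \<in> space (iid n M). \<exists>i<n. \<omega> i \<in> B} \<in> sets (iid n M)"
    and "measure (iid n M) {\<omega> \<in> space (iid n M). \<exists>i<n. \<omega> i \<in> B} \<le> real n * prob B"
proof -
  have m: "{\<omega> \<in> space (iid n M). \<omega> i \<in> B} \<in> sets (iid n M)" if "i < n" for i
  proof -
    have "i \<in> {..<n}" using that by simp
    then show ?thesis using assms by measurable
  qed
  have eq: "{\<omega> \<in> space (iid n M). \<exists>i<n. \<omega> i \<in> B} = (\<Union>i<n. {\<omega> \<in> space (iid n M). \<omega> i \<in> B})" by auto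
  show "{\<omega> \<in> space (iid n M). \<exists>i<n. \<omega> i \<in> B} \<in> sets (iid n M)"
    unfolding eq using m by auto
  have "measure (iid n M) (\<Union>i<n. {\<omega> \<in> space (iid n M). \<omega> i \<in> B})
      \<le> (\<Sum>i<n. measure (iid n M) {\<omega> \<in> space (iid n M). \<omega> i \<in> B})"
    using m by (intro finite_measure.finite_measure_subadditive_finite[OF iid_finite_measure]) auto
  also have "\<dots> = (\<Sum>i<n. prob B)"
    using iid_cylinder[of "{i}" n B for i] assms by (intro sum.cong refl) auto
  finally show "measure (iid n M) {\<omega> \<in> space (iid n M). \<exists>i<n. \<omega> i \<in> B} \<le> real n * prob B"
    unfolding eq by simp
qed

text \<open>Chernoff bound with the exponential parameter fixed to 1; both tails follow by inserting
  \<open>\<phi>\<close> or its negative. The thresholds used later have free constants, so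
  optimising the parameter would gain nothing.\<close>

lemma iid_exp_bound:
  fixes \<phi> :: "'a \<Rightarrow> real"
  assumes \<phi>: "\<phi> \<in> borel_measurable M" "\<And>x. x \<in> space M \<Longrightarrow> \<bar>\<phi> x\<bar> \<le> 1"
    and e: "(\<integral>x. exp (\<phi> x) \<partial>M) \<le> exp E"
  shows "{\<omega> \<in> space (iid n M). k \<le> (\<Sum>i<n. \<phi> (\<omega> i))} \<in> sets (iid n M)"
    and "measure (iid n M) {\<omega> \<in> space (iid n M). k \<le> (\<Sum>i<n. \<phi> (\<omega> i))} \<le> exp (real n * E - k)"
proof -
  interpret P: product_prob_space "\<lambda>_. M" "{..<n}" by unfold_locales
  let ?A = "{\<omega> \<in> space (iid n M). k \<le> (\<Sum>i<n. \<phi> (\<omega> i))}"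
  show A: "?A \<in> sets (iid n M)" using \<phi>(1) by measurable
  have int: "integrable M (\<lambda>x. exp (\<phi> x))"
  proof (intro integrable_const_bound[where B = "exp 1"] AE_I2)
    show "norm (exp (\<phi> x)) \<le> exp 1" if "x \<in> space M" for x using \<phi>(2)[OF that] by simp
  qed (use \<phi>(1) in measurable)
  have intP: "integrable (iid n M) (\<lambda>\<omega>. \<Prod>i<n. exp (\<phi> (\<omega> i)))"
    by (rule P.product_integrable_prod[OF _ int]) simp
  have "measure (iid n M) ?A = (\<integral>\<omega>. indicator ?A \<omega> \<partial>iid n M)" using A by simp
  also have "\<dots> \<le> (\<integral>\<omega>. exp (- k) * (\<Prod>i<n. exp (\<phi> (\<omega> i))) \<partial>iid n M)"
  proof (rule integral_mono)
    fix \<omega> assume "\<omega> \<in> space (iid n M)"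
    have "exp (- k) * (\<Prod>i<n. exp (\<phi> (\<omega> i))) = exp ((\<Sum>i<n. \<phi> (\<omega> i)) - k)"
      by (simp add: exp_sum[symmetric] mult_exp_exp)
    moreover have "1 \<le> exp ((\<Sum>i<n. \<phi> (\<omega> i)) - k)" if "\<omega> \<in> ?A" using that by simp
    ultimately show "indicator ?A \<omega> \<le> exp (- k) * (\<Prod>i<n. exp (\<phi> (\<omega> i)))"
      by (auto simp: indicator_def)
  qed (use A intP in \<open>auto simp: finite_measure.emeasure_finite[OF iid_finite_measure] less_top[symmetric]\<close>)
  also have "\<dots> = exp (- k) * (\<Prod>i<n. \<integral>x. exp (\<phi> x) \<partial>M)"
    using P.product_integral_prod[of "{..<n}" "\<lambda>_ x. exp (\<phi> x)", OF _ int] by simp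
  also have "\<dots> \<le> exp (- k) * (\<Prod>i<n. exp E)"
    using e by (intro mult_left_mono prod_mono) (auto intro!: integral_nonneg)
  also have "\<dots> = exp (real n * E - k)" by (simp add: exp_of_nat_mult[symmetric] mult_exp_exp)
  finally show "measure (iid n M) ?A \<le> exp (real n * E - k)" .
qed

lemma iid_sum_upper:
  fixes \<phi> :: "'a \<Rightarrow> real"
  assumes \<phi>: "\<phi> \<in> borel_measurable M" "\<And>x. x \<in> space M \<Longrightarrow> 0 \<le> \<phi> x \<and> \<phi> x \<le> 1"
  shows "{\<omega> \<in> space (iid n M). k \<le> (\<Sum>i<n. \<phi> (\<omega> i))} \<in> sets (iid n M)"
    and "measure (iid n M) {\<omega> \<in> space (iid n M). k \<le> (\<Sum>i<n. \<phi> (\<omega> i))} \<le> exp (2 * real n * expectation \<phi> - k)"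
proof -
  have int: "integrable M \<phi>" using \<phi> by (intro integrable_const_bound[where B = 1] AE_I2) auto
  have "(\<integral>x. exp (\<phi> x) \<partial>M) \<le> (\<integral>x. 1 + 2 * \<phi> x \<partial>M)"
  proof (rule integral_mono)
    show "integrable M (\<lambda>x. exp (\<phi> x))"
    proof (intro integrable_const_bound[where B = "exp 1"] AE_I2)
      show "norm (exp (\<phi> x)) \<le> exp 1" if "x \<in> space M" for x using \<phi>(2)[OF that] by simp
    qed (use \<phi>(1) in measurable)
    \<comment> \<open>On [0, 1] one has exp t <= 1 + t + t^2 <= 1 + 2 t.\<close>
    show "exp (\<phi> x) \<le> 1 + 2 * \<phi> x" if "x \<in> space M" for x
      using exp_bound[of "\<phi> x"] \<phi>(2)[OF that] power_le_one_iff[of "\<phi> x" 2]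
        mult_left_le[of "\<phi> x" "\<phi> x"] by (simp add: power2_eq_square)
  qed (use int in auto)
  also have "\<dots> = 1 + 2 * expectation \<phi>" using int by (simp add: prob_space)
  also have "\<dots> \<le> exp (2 * expectation \<phi>)" by (rule exp_ge_add_one_self)
  finally have e: "(\<integral>x. exp (\<phi> x) \<partial>M) \<le> exp (2 * expectation \<phi>)" .
  have b: "\<And>x. x \<in> space M \<Longrightarrow> \<bar>\<phi> x\<bar> \<le> 1" using \<phi>(2) by force
  show "{\<omega> \<in> space (iid n M). k \<le> (\<Sum>i<n. \<phi> (\<omega> i))} \<in> sets (iid n M)"
    by (rule iid_exp_bound(1)[OF \<phi>(1) b e])
  show "measure (iid n M) {\<omega> \<in> space (iid n M). k \<le> (\<Sum>i<n. \<phi> (\<omega> i))} \<le> exp (2 * real n * expectation \<phi> - k)"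
    using iid_exp_bound(2)[OF \<phi>(1) b e, of n k] by (simp add: mult_ac)
qed

lemma iid_sum_lower:
  fixes \<phi> :: "'a \<Rightarrow> real"
  assumes \<phi>: "\<phi> \<in> borel_measurable M" "\<And>x. x \<in> space M \<Longrightarrow> 0 \<le> \<phi> x \<and> \<phi> x \<le> 1"
  shows "{\<omega> \<in> space (iid n M). (\<Sum>i<n. \<phi> (\<omega> i)) \<le> k} \<in> sets (iid n M)"
    and "measure (iid n M) {\<omega> \<in> space (iid n M). (\<Sum>i<n. \<phi> (\<omega> i)) \<le> k} \<le> exp (k - real n * expectation \<phi> / 2)"
proof -
  have int: "integrable M \<phi>" using \<phi> by (intro integrable_const_bound[where B = 1] AE_I2) auto
  have "(\<integral>x. exp (- \<phi> x) \<partial>M) \<le> (\<integral>x. 1 - \<phi> x / 2 \<partial>M)"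
  proof (rule integral_mono)
    show "integrable M (\<lambda>x. exp (- \<phi> x))"
    proof (intro integrable_const_bound[where B = 1] AE_I2)
      show "norm (exp (- \<phi> x)) \<le> 1" if "x \<in> space M" for x using \<phi>(2)[OF that] by simp
    qed (use \<phi>(1) in measurable)
    show "exp (- \<phi> x) \<le> 1 - \<phi> x / 2" if "x \<in> space M" for x
    proof -
      let ?t = "\<phi> x"
      have t: "0 \<le> ?t" "?t \<le> 1" using \<phi>(2)[OF that] by auto
      \<comment> \<open>(1 - t / 2) (1 + t) = 1 + t (1 - t) / 2, which is at least 1 on
        [0, 1].\<close>
      have "0 \<le> ?t * (1 - ?t)" using t by simp
      then have "1 \<le> (1 - ?t / 2) * (1 + ?t)" by (simp add: algebra_simps)
      also have "\<dots> \<le> (1 - ?t / 2) * exp ?t" using t by (intro mult_left_mono exp_ge_add_one_self) auto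
      finally show ?thesis by (simp add: exp_minus field_simps)
    qed
  qed (use int in auto)
  also have "\<dots> = 1 + - (expectation \<phi> / 2)" using int by (simp add: prob_space)
  also have "\<dots> \<le> exp (- (expectation \<phi> / 2))" by (rule exp_ge_add_one_self)
  finally have e: "(\<integral>x. exp (- \<phi> x) \<partial>M) \<le> exp (- (expectation \<phi> / 2))" .
  have b: "\<And>x. x \<in> space M \<Longrightarrow> \<bar>- \<phi> x\<bar> \<le> 1" using \<phi>(2) by force
  have eq: "{\<omega> \<in> space (iid n M). (\<Sum>i<n. \<phi> (\<omega> i)) \<le> k} = {\<omega> \<in> space (iid n M). - k \<le> (\<Sum>i<n. - \<phi> (\<omega> i))}"
    by (auto simp: sum_negf)
  have m: "(\<lambda>x. - \<phi> x) \<in> borel_measurable M" using \<phi>(1) by measurable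
  show "{\<omega> \<in> space (iid n M). (\<Sum>i<n. \<phi> (\<omega> i)) \<le> k} \<in> sets (iid n M)"
    unfolding eq by (rule iid_exp_bound(1)[OF m b e])
  show "measure (iid n M) {\<omega> \<in> space (iid n M). (\<Sum>i<n. \<phi> (\<omega> i)) \<le> k} \<le> exp (k - real n * expectation \<phi> / 2)"
    unfolding eq using iid_exp_bound(2)[OF m b e, of n "- k"] by (simp add: mult_ac)
qed

end

lemma pair_integral_prod:
  fixes \<alpha> :: "'a \<Rightarrow> real" and \<beta> :: "'b \<Rightarrow> real"
  assumes "prob_space M1" "prob_space M2"
    and "\<alpha> \<in> borel_measurable M1" "\<beta> \<in> borel_measurable M2"
    and "\<And>x. \<bar>\<alpha> x\<bar> \<le> 1" "\<And>y. \<bar>\<beta> y\<bar> \<le> 1"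
  shows "(\<integral>z. \<alpha> (fst z) * \<beta> (snd z) \<partial>(M1 \<Otimes>\<^sub>M M2)) = (\<integral>x. \<alpha> x \<partial>M1) * (\<integral>y. \<beta> y \<partial>M2)"
proof -
  interpret M1: prob_space M1 by fact
  interpret M2: prob_space M2 by fact
  interpret pair_prob_space M1 M2 by unfold_locales
  have "\<bar>\<alpha> x * \<beta> y\<bar> \<le> 1" for x y
    unfolding abs_mult using mult_mono[of "\<bar>\<alpha> x\<bar>" 1 "\<bar>\<beta> y\<bar>" 1] assms by simp
  then have "integrable (M1 \<Otimes>\<^sub>M M2) (\<lambda>z. \<alpha> (fst z) * \<beta> (snd z))"
    using assms by (intro P.integrable_const_bound[where B = 1] AE_I2) auto
  then have "(\<integral>z. \<alpha> (fst z) * \<beta> (snd z) \<partial>(M1 \<Otimes>\<^sub>M M2)) = (\<integral>x. \<integral>y. \<alpha> x * \<beta> y \<partial>M2 \<partial>M1)"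
    by (subst integral_fst'[symmetric]) auto
  then show ?thesis by simp
qed

subsection \<open>The uniform law on the cube\<close>

text \<open>Half-open, so that the floor in \<open>cell_of\<close> never reaches m. The closed cube
  of the law differs from it by a null set, which \<open>ev_outside\<close> takes care of.\<close>

definition unit_cube :: "(real^'d) set" where
  "unit_cube = {x. \<forall>k. 0 \<le> x $ k \<and> x $ k < 1}"

definition cell_of :: "nat \<Rightarrow> real^'d \<Rightarrow> 'd \<Rightarrow> nat" where
  "cell_of m x = (\<lambda>k. nat \<lfloor>real m * x $ k\<rfloor>)"

definition cells :: "nat \<Rightarrow> ('d \<Rightarrow> nat) set \<Rightarrow> (real^'d) set" where
  "cells m S = {x \<in> unit_cube. cell_of m x \<in> S}"

abbreviation cube_law :: "(real^'d::finite) measure" where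
  "cube_law \<equiv> uniform_measure lborel (cbox 0 One)"

lemma One_nth: "(One :: real^'d::finite) $ k = 1"
proof -
  have "(One :: real^'d) \<bullet> axis k 1 = 1" 
    using inner_sum_left_Basis[of "axis k 1 :: real^'d" "\<lambda>_. 1"] by (simp add: axis_in_Basis_iff)
  then show ?thesis by (simp add: inner_axis)
qed

lemma emeasure_cube: "emeasure lborel (cbox 0 One :: (real^'d::finite) set) = 1"
  by (subst emeasure_lborel_cbox) auto

lemma prob_space_cube_law: "prob_space (cube_law :: (real^'d::finite) measure)"
  by (intro prob_space_uniform_measure) (simp_all add: emeasure_cube del: emeasure_lborel_cbox)

lemma cell_of_iff:
  assumes "x \<in> unit_cube" "0 < m" 
  shows "cell_of m x = b \<longleftrightarrow> (\<forall>k. real (b k) / real m \<le> x $ k \<and> x $ k < (real (b k) + 1) / real m)"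
proof -
  have "nat \<lfloor>real m * x $ k\<rfloor> = b k \<longleftrightarrow> real (b k) / real m \<le> x $ k \<and> x $ k < (real (b k) + 1) / real m" for k
  proof -
    have "0 \<le> real m * x $ k" using assms by (simp add: unit_cube_def)
    then have "nat \<lfloor>real m * x $ k\<rfloor> = b k \<longleftrightarrow> \<lfloor>real m * x $ k\<rfloor> = int (b k)" by linarith
    also have "\<dots> \<longleftrightarrow> real (b k) \<le> real m * x $ k \<and> real m * x $ k < real (b k) + 1"
      by (simp add: floor_eq_iff)
    finally show ?thesis using assms by (simp add: field_simps)
  qed
  then show ?thesis by (simp add: cell_of_def fun_eq_iff)
qed

lemma cell_of_grid:
  assumes "x \<in> unit_cube" "0 < m"
  shows "cell_of m x \<in> grid m"
  unfolding grid_def cell_of_def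
proof safe
  fix k
  have "0 \<le> x $ k" "x $ k < 1" using assms by (auto simp: unit_cube_def)
  then have "real m * x $ k < real m * 1" using assms by (intro mult_strict_left_mono) auto
  then have "\<lfloor>real m * x $ k\<rfloor> < int m" by (simp add: floor_less_iff)
  then show "nat \<lfloor>real m * x $ k\<rfloor> < m" using assms(2) by linarith
qed

lemma cells_single:
  assumes "b \<in> grid m"
  shows "cells m {b} = {x. \<forall>k. real (b k) / real m \<le> x $ k \<and> x $ k < (real (b k) + 1) / real m}"
proof -
  have m: "0 < m" using assms by (cases "m = 0") (auto simp: grid_def)
  have "x \<in> unit_cube" if "\<And>k. real (b k) / real m \<le> x $ k \<and> x $ k < (real (b k) + 1) / real m" for x :: "real^'a"
    unfolding unit_cube_def
  proof (intro CollectI allI conjI)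
    fix k
    show "0 \<le> x $ k" using that[of k] by (meson divide_nonneg_nonneg of_nat_0_le_iff order_trans)
    have "b k < m" using assms by (simp add: grid_def)
    then have "(real (b k) + 1) / real m \<le> 1" using m by (simp add: field_simps)
    then show "x $ k < 1" using that[of k] by linarith
  qed
  then show ?thesis using cell_of_iff[OF _ m, of _ b] unfolding cells_def by auto
qed

lemma cells_single_measure:
  fixes b :: "'d::finite \<Rightarrow> nat"
  assumes b: "b \<in> grid m"
  shows "cells m {b} \<in> sets lborel" "measure cube_law (cells m {b}) = 1 / real m ^ CARD('d)"
proof -
  have m: "0 < m" using assms by (cases "m = 0") (auto simp: grid_def)
  have "cells m {b} = (\<Inter>k\<in>UNIV. {x. real (b k) / real m \<le> x $ k} \<inter> {x. x $ k < (real (b k) + 1) / real m})"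
    unfolding cells_single[OF b] by auto
  also have "\<dots> \<in> sets borel" by (intro sets.finite_INT) (auto simp: cart_eq_inner_axis)
  finally show meas: "cells m {b} \<in> sets lborel" by simp
  define l u :: "real^'d" where "l = (\<chi> k. real (b k) / real m)" and "u = (\<chi> k. (real (b k) + 1) / real m)"
  have in_c: "(u - l) \<bullet> i = 1 / real m" if "i \<in> Basis" for i
    using that m by (auto simp: Basis_vec_def l_def u_def inner_axis diff_divide_distrib[symmetric])
  have le: "l \<bullet> i \<le> u \<bullet> i" if "i \<in> Basis" for i
  proof -
    have "0 \<le> (u - l) \<bullet> i" unfolding in_c[OF that] by simp
    then show ?thesis by (simp add: inner_diff_left)
  qed
  have prod: "(\<Prod>i\<in>Basis. (u - l) \<bullet> i) = 1 / real m ^ CARD('d)"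
    using in_c by (simp add: power_divide)
  have lo: "box l u \<subseteq> cells m {b}" and hi: "cells m {b} \<subseteq> cbox l u"
    unfolding cells_single[OF b] by (auto simp: mem_box_cart l_def u_def less_imp_le)
  have "emeasure lborel (cells m {b}) = ennreal (1 / real m ^ CARD('d))"
  proof (rule antisym)
    show "emeasure lborel (cells m {b}) \<le> ennreal (1 / real m ^ CARD('d))"
      using emeasure_mono[OF hi, of lborel] le prod by simp
    show "ennreal (1 / real m ^ CARD('d)) \<le> emeasure lborel (cells m {b})"
      using emeasure_mono[OF lo meas] le prod by simp
  qed
  moreover have "x \<in> cbox 0 One" if "x \<in> unit_cube" for x :: "real^'d"
    using that unfolding mem_box_cart One_nth by (auto simp: unit_cube_def less_imp_le)
  then have "cbox 0 One \<inter> cells m {b} = cells m {b}" by (auto simp: cells_def)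
  ultimately show "measure cube_law (cells m {b}) = 1 / real m ^ CARD('d)"
    using meas by (simp add: measure_def emeasure_uniform_measure emeasure_cube divide_ennreal
        ennreal_1[symmetric] del: emeasure_lborel_cbox ennreal_1)
qed

lemma cells_measure:
  fixes S :: "('d::finite \<Rightarrow> nat) set"
  assumes S: "S \<subseteq> grid m"
  shows "cells m S \<in> sets lborel" "measure cube_law (cells m S) = real (card S) / real m ^ CARD('d)"
proof -
  interpret prob_space "cube_law :: (real^'d) measure" by (rule prob_space_cube_law)
  have fin: "finite S" using S finite_subset[OF _ finite_grid] by blast
  have eq: "cells m S = (\<Union>b\<in>S. cells m {b})" by (auto simp: cells_def)
  show "cells m S \<in> sets lborel" unfolding eq using S fin cells_single_measure(1) by (intro sets.finite_UN) auto
  have "prob (cells m S) = (\<Sum>b\<in>S. prob (cells m {b}))"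
    unfolding eq
    by (rule finite_measure_finite_Union[OF fin]) (use S cells_single_measure(1) in \<open>auto simp: disjoint_family_on_def cells_def\<close>)
  also have "\<dots> = (\<Sum>b\<in>S. 1 / real m ^ CARD('d))"
    using S by (intro sum.cong refl cells_single_measure(2)) auto
  finally show "prob (cells m S) = real (card S) / real m ^ CARD('d)" by simp
qed

lemma unit_cube_measure:
  "(unit_cube :: (real^'d::finite) set) \<in> sets lborel" "measure cube_law (unit_cube :: (real^'d::finite) set) = 1"
proof -
  have "cells 1 (grid 1 :: ('d \<Rightarrow> nat) set) = unit_cube"
    using cell_of_grid[of _ 1] by (auto simp: cells_def)
  then show "(unit_cube :: (real^'d) set) \<in> sets lborel" "measure cube_law (unit_cube :: (real^'d) set) = 1"
    using cells_measure[of "grid 1 :: ('d \<Rightarrow> nat) set" 1] by (simp_all add: card_grid)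
qed

subsection \<open>Adjacency and cells\<close>

text \<open>Floors change a difference by less than 1: hence q + 1 here, whereas in the converse
  \<open>torus_coord_less\<close> integrality recovers q from a strict inequality.\<close>

lemma torus_coord_le:
  fixes a b :: real
  assumes "0 \<le> a" "a < 1" "0 \<le> b" "b < 1" "0 < m"
    and "\<bar>int (nat \<lfloor>real m * a\<rfloor>) - int (nat \<lfloor>real m * b\<rfloor>)\<bar> \<le> int q \<or>
      int m - int q \<le> \<bar>int (nat \<lfloor>real m * a\<rfloor>) - int (nat \<lfloor>real m * b\<rfloor>)\<bar>"
  shows "min \<bar>a - b\<bar> (1 - \<bar>a - b\<bar>) \<le> (real q + 1) / real m"
proof -
  have nn: "0 \<le> real m * a" "0 \<le> real m * b" using assms by auto
  have "\<bar>real m * a - real m * b\<bar> \<le> real q + 1 \<or> real m - real q - 1 \<le> \<bar>real m * a - real m * b\<bar>"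
    using assms(6) nn by linarith
  moreover have "\<bar>real m * a - real m * b\<bar> = real m * \<bar>a - b\<bar>"
    by (simp add: abs_mult right_diff_distrib[symmetric])
  ultimately have "real m * \<bar>a - b\<bar> \<le> real q + 1 \<or> real m * (1 - \<bar>a - b\<bar>) \<le> real q + 1"
    unfolding right_diff_distrib mult_1_right by linarith
  then have "\<bar>a - b\<bar> \<le> (real q + 1) / real m \<or> 1 - \<bar>a - b\<bar> \<le> (real q + 1) / real m"
    using assms(5) by (simp add: pos_le_divide_eq mult.commute)
  then show ?thesis by linarith
qed

lemma torus_coord_less:
  fixes a b :: real
  assumes "0 \<le> a" "a < 1" "0 \<le> b" "b < 1" "0 < m"
    and "min \<bar>a - b\<bar> (1 - \<bar>a - b\<bar>) < real q / real m"
  shows "\<bar>int (nat \<lfloor>real m * a\<rfloor>) - int (nat \<lfloor>real m * b\<rfloor>)\<bar> \<le> int q \<or>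
      int m - int q \<le> \<bar>int (nat \<lfloor>real m * a\<rfloor>) - int (nat \<lfloor>real m * b\<rfloor>)\<bar>"
proof -
  have nn: "0 \<le> real m * a" "0 \<le> real m * b" using assms by auto
  have "real m * \<bar>a - b\<bar> < real q \<or> real m * (1 - \<bar>a - b\<bar>) < real q"
    using assms(5,6) by (auto simp: min_def field_simps split: if_splits)
  moreover have "\<bar>real m * a - real m * b\<bar> = real m * \<bar>a - b\<bar>"
    by (simp add: abs_mult right_diff_distrib[symmetric])
  ultimately have "\<bar>real m * a - real m * b\<bar> < real q \<or> real m - real q < \<bar>real m * a - real m * b\<bar>"
    unfolding right_diff_distrib mult_1_right by linarith
  then show ?thesis using nn by linarith
qed

lemma torus_dist_nonneg: "0 \<le> torus_dist x y"
  unfolding torus_dist_def by (intro real_sqrt_ge_zero sum_nonneg) auto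

lemma torus_coord_nonneg:
  "x \<in> unit_cube \<Longrightarrow> y \<in> unit_cube \<Longrightarrow> 0 \<le> min \<bar>x $ k - y $ k\<bar> (1 - \<bar>x $ k - y $ k\<bar>)"
proof -
  assume "x \<in> unit_cube" "y \<in> unit_cube"
  then have "0 \<le> x $ k" "x $ k < 1" "0 \<le> y $ k" "y $ k < 1" by (auto simp: unit_cube_def)
  then show ?thesis by linarith
qed

lemma near_torus_dist:
  fixes x y :: "real^'d::finite"
  assumes "x \<in> unit_cube" "y \<in> unit_cube" "0 < m" "near m q (cell_of m x) (cell_of m y)"
  shows "torus_dist x y \<le> sqrt (real CARD('d)) * ((real q + 1) / real m)"
proof -
  have "(\<Sum>k\<in>UNIV. (min \<bar>x $ k - y $ k\<bar> (1 - \<bar>x $ k - y $ k\<bar>))\<^sup>2)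
      \<le> (\<Sum>k\<in>(UNIV :: 'd set). ((real q + 1) / real m)\<^sup>2)"
  proof (intro sum_mono power_mono)
    fix k
    show "min \<bar>x $ k - y $ k\<bar> (1 - \<bar>x $ k - y $ k\<bar>) \<le> (real q + 1) / real m"
      using assms by (intro torus_coord_le) (auto simp: unit_cube_def near_def cell_of_def)
  qed (use assms torus_coord_nonneg in auto)
  then have "torus_dist x y \<le> sqrt (real CARD('d) * ((real q + 1) / real m)\<^sup>2)"
    unfolding torus_dist_def by simp
  then show ?thesis by (simp add: real_sqrt_mult)
qed

lemma torus_dist_near:
  fixes x y :: "real^'d::finite"
  assumes "x \<in> unit_cube" "y \<in> unit_cube" "0 < m" "torus_dist x y < real q / real m"
  shows "near m q (cell_of m x) (cell_of m y)"
  unfolding near_def cell_of_def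
proof (intro allI torus_coord_less)
  fix k
  let ?t = "\<lambda>k. min \<bar>x $ k - y $ k\<bar> (1 - \<bar>x $ k - y $ k\<bar>)"
  have "(?t k)\<^sup>2 \<le> (\<Sum>k\<in>UNIV. (?t k)\<^sup>2)" by (rule member_le_sum) auto
  then have "?t k \<le> torus_dist x y"
    unfolding torus_dist_def by (rule real_le_rsqrt)
  then show "?t k < real q / real m" using assms(4) by linarith
qed (use assms in \<open>auto simp: unit_cube_def\<close>)

lemma gtg_adjI:
  fixes X :: "nat \<Rightarrow> real^'d::finite"
  assumes ij: "i < n" "j < n" "i \<noteq> j" and X: "X i \<in> unit_cube" "X j \<in> unit_cube" "X i \<noteq> X j"
    and m: "0 < m" and near: "near m q (cell_of m (X i)) (cell_of m (X j))"
    and \<theta>: "0 < \<theta>" and le: "\<theta> * sqrt (real CARD('d)) ^ CARD('d) / real m ^ CARD('d) \<le> ku"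
    and w: "ku * (real q + 1) ^ CARD('d) \<le> w i + w j"
  shows "gtg_adj n \<theta> X w i j"
proof -
  let ?r = "torus_dist (X i) (X j)" let ?d = "CARD('d)"
  have "?r \<noteq> 0"
  proof
    assume "?r = 0"
    then have "(\<Sum>k\<in>UNIV. (min \<bar>X i $ k - X j $ k\<bar> (1 - \<bar>X i $ k - X j $ k\<bar>))\<^sup>2) = 0"
      by (simp add: torus_dist_def)
    \<comment> \<open>Coordinates in the half-open cube differ by less than 1, so the wrap-around
      branch of the minimum stays positive and distance 0 forces equality.\<close>
    then have "min \<bar>X i $ k - X j $ k\<bar> (1 - \<bar>X i $ k - X j $ k\<bar>) = 0" for k
      by (simp add: sum_nonneg_eq_0_iff)
    moreover have "\<bar>X i $ k - X j $ k\<bar> < 1" for k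
    proof -
      have "0 \<le> X i $ k" "X i $ k < 1" "0 \<le> X j $ k" "X j $ k < 1" using X by (auto simp: unit_cube_def)
      then show ?thesis by linarith
    qed
    ultimately have "X i $ k = X j $ k" for k
      by (metis (no_types, lifting) abs_zero cancel_comm_monoid_add_class.diff_cancel diff_gt_0_iff_gt
          eq_iff_diff_eq_0 less_irrefl min_def abs_eq_0_iff)
    then show False using X(3) by (simp add: vec_eq_iff)
  qed
  then have r: "0 < ?r" using torus_dist_nonneg[of "X i" "X j"] by simp
  have "\<theta> * ?r ^ ?d \<le> \<theta> * (sqrt (real ?d) * ((real q + 1) / real m)) ^ ?d"
    using near_torus_dist[OF X(1,2) m near] \<theta> torus_dist_nonneg[of "X i" "X j"]
    by (intro mult_left_mono power_mono) auto
  also have "\<dots> = (\<theta> * sqrt (real ?d) ^ ?d / real m ^ ?d) * (real q + 1) ^ ?d"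
    by (simp add: power_mult_distrib power_divide)
  also have "\<dots> \<le> ku * (real q + 1) ^ ?d" using le by (intro mult_right_mono) auto
  also have "\<dots> \<le> w i + w j" by (rule w)
  finally have "\<theta> \<le> (w i + w j) / ?r ^ ?d" using r by (simp add: field_simps)
  then show ?thesis using ij by (simp add: gtg_adj_def)
qed

lemma gtg_adjD:
  fixes X :: "nat \<Rightarrow> real^'d::finite"
  assumes A: "gtg_adj n \<theta> X w i j" and X: "X i \<in> unit_cube" "X j \<in> unit_cube"
    and m: "0 < m" and \<theta>: "0 < \<theta>" and kl: "kl \<le> \<theta> / real m ^ CARD('d)"
    and w: "w i + w j < kl * real q ^ CARD('d)"
  shows "near m q (cell_of m (X i)) (cell_of m (X j))"
proof (rule torus_dist_near[OF X m])
  let ?r = "torus_dist (X i) (X j)" let ?d = "CARD('d)"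
  have a: "\<theta> \<le> (w i + w j) / ?r ^ ?d" using A by (simp add: gtg_adj_def)
  have "?r ^ ?d \<noteq> 0"
  proof
    assume z: "?r ^ ?d = 0"
    show False using a \<theta> unfolding z by simp
  qed
  then have r: "0 < ?r ^ ?d" using torus_dist_nonneg[of "X i" "X j"] by simp
  have "\<theta> * ?r ^ ?d \<le> w i + w j" using a r by (simp add: field_simps)
  also have "\<dots> < kl * real q ^ ?d" by (rule w)
  also have "\<dots> \<le> \<theta> / real m ^ ?d * real q ^ ?d" using kl by (intro mult_right_mono) auto
  also have "\<dots> = \<theta> * (real q / real m) ^ ?d" by (simp add: power_divide)
  finally have "?r ^ ?d < (real q / real m) ^ ?d" using \<theta> by simp
  then show "?r < real q / real m" by (rule power_less_imp_less_base) simp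
qed

subsection \<open>Probabilities of exceptional events\<close>

locale weight_density =
  fixes f :: "real \<Rightarrow> real"
  assumes f_meas: "f \<in> borel_measurable borel"
    and f_nonneg: "\<And>x. 0 \<le> f x"
    and f_supp: "\<And>x. x < 0 \<Longrightarrow> f x = 0"
    and f_prob: "(\<integral>\<^sup>+x. ennreal (f x) \<partial>lborel) = 1"
begin

abbreviation weights :: "real measure" where
  "weights \<equiv> density lborel f"

abbreviation node :: "((real^'d::finite) \<times> real) measure" where
  "node \<equiv> cube_law \<Otimes>\<^sub>M weights"

lemma prob_space_weights: "prob_space weights"
  using f_meas f_prob by (intro prob_spaceI) (simp add: emeasure_density)

lemma prob_space_node: "prob_space (node :: ((real^'d::finite) \<times> real) measure)"
proof -
  interpret M1: prob_space "cube_law :: (real^'d) measure" by (rule prob_space_cube_law)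
  interpret M2: prob_space weights by (rule prob_space_weights)
  interpret pair_prob_space "cube_law :: (real^'d) measure" weights by unfold_locales
  show ?thesis by (rule P.prob_space_axioms)
qed

lemma gtg_space_iid: "(gtg_space f n :: (nat \<Rightarrow> (real^'d::finite) \<times> real) measure) = iid n node"
  by (simp add: gtg_space_def)

lemma sets_node: "sets (node :: ((real^'d::finite) \<times> real) measure) = sets (borel \<Otimes>\<^sub>M borel)"
  by (intro sets_pair_measure_cong) simp_all

lemma space_node [simp]: "space (node :: ((real^'d::finite) \<times> real) measure) = UNIV"
  by (simp add: space_pair_measure)

lemma fst_preimage_node: "B \<in> sets borel \<Longrightarrow> {z. fst z \<in> B} \<in> sets (node :: ((real^'d::finite) \<times> real) measure)"
  unfolding sets_node using measurable_sets[OF measurable_fst, of B borel borel]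
  by (simp add: vimage_def space_pair_measure)

lemma snd_preimage_node: "B \<in> sets borel \<Longrightarrow> {z. snd z \<in> B} \<in> sets (node :: ((real^'d::finite) \<times> real) measure)"
  unfolding sets_node using measurable_sets[OF measurable_snd, of B borel borel]
  by (simp add: vimage_def space_pair_measure)

lemma cells_weight_expectation:
  fixes S :: "('d::finite \<Rightarrow> nat) set"
  assumes S: "S \<subseteq> grid m" and \<beta>: "\<beta> \<in> borel_measurable borel" "\<And>y. 0 \<le> \<beta> y \<and> \<beta> y \<le> 1"
  shows "(\<lambda>z. indicat_real (cells m S) (fst z) * \<beta> (snd z)) \<in> borel_measurable node"
    and "(\<integral>z. indicat_real (cells m S) (fst z) * \<beta> (snd z) \<partial>node)
      = real (card S) / real m ^ CARD('d) * (\<integral>y. \<beta> y \<partial>weights)"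
proof -
  have c: "cells m S \<in> sets borel" using cells_measure(1)[OF S] by simp
  have i: "indicat_real (cells m S) \<in> borel_measurable cube_law" "\<beta> \<in> borel_measurable weights"
    using c \<beta>(1) by simp_all
  show "(\<lambda>z. indicat_real (cells m S) (fst z) * \<beta> (snd z)) \<in> borel_measurable node"
    using i by (intro borel_measurable_times measurable_compose[OF measurable_fst] measurable_compose[OF measurable_snd])
  have "(\<integral>z. indicat_real (cells m S) (fst z) * \<beta> (snd z) \<partial>node)
      = (\<integral>x. indicat_real (cells m S) x \<partial>cube_law) * (\<integral>y. \<beta> y \<partial>weights)"
    using \<beta>(2) by (intro pair_integral_prod prob_space_cube_law prob_space_weights i) (auto simp: indicator_def)
  also have "(\<integral>x. indicat_real (cells m S) x \<partial>cube_law) = real (card S) / real m ^ CARD('d)"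
    using c cells_measure(2)[OF S] by simp
  finally show "(\<integral>z. indicat_real (cells m S) (fst z) * \<beta> (snd z) \<partial>node)
      = real (card S) / real m ^ CARD('d) * (\<integral>y. \<beta> y \<partial>weights)" .
qed

text \<open>One statistic for three purposes: \<open>\<beta>\<close> is the constant 1 for
  occupation numbers, the indicator of {ws..} for heavy nodes, and \<open>trunc T\<close> for the
  total weight of a coarse cube.\<close>

definition cell_sum :: "nat \<Rightarrow> nat \<Rightarrow> ('d::finite \<Rightarrow> nat) set \<Rightarrow> (real \<Rightarrow> real) \<Rightarrow> (nat \<Rightarrow> (real^'d) \<times> real) \<Rightarrow> real" where
  "cell_sum n m S \<beta> \<omega> = (\<Sum>i<n. indicat_real (cells m S) (fst (\<omega> i)) * \<beta> (snd (\<omega> i)))"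

lemma cell_sum_upper:
  fixes S :: "('d::finite \<Rightarrow> nat) set"
  assumes S: "S \<subseteq> grid m" and \<beta>: "\<beta> \<in> borel_measurable borel" "\<And>y. 0 \<le> \<beta> y \<and> \<beta> y \<le> 1"
  shows "{\<omega> \<in> space (iid n node). k \<le> cell_sum n m S \<beta> \<omega>} \<in> sets (iid n node)"
    and "measure (iid n node) {\<omega> \<in> space (iid n node). k \<le> cell_sum n m S \<beta> \<omega>}
      \<le> exp (2 * real n * (real (card S) / real m ^ CARD('d) * (\<integral>y. \<beta> y \<partial>weights)) - k)"
proof -
  interpret prob_space "node :: ((real^'d) \<times> real) measure" by (rule prob_space_node)
  note e = cells_weight_expectation[OF S \<beta>]
  have b: "0 \<le> indicat_real (cells m S) (fst z) * \<beta> (snd z) \<and> indicat_real (cells m S) (fst z) * \<beta> (snd z) \<le> 1" for z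
    using \<beta>(2) by (auto simp: indicator_def)
  show "{\<omega> \<in> space (iid n node). k \<le> cell_sum n m S \<beta> \<omega>} \<in> sets (iid n node)"
    unfolding cell_sum_def by (rule iid_sum_upper(1)[OF e(1) b])
  show "measure (iid n node) {\<omega> \<in> space (iid n node). k \<le> cell_sum n m S \<beta> \<omega>}
      \<le> exp (2 * real n * (real (card S) / real m ^ CARD('d) * (\<integral>y. \<beta> y \<partial>weights)) - k)"
    unfolding cell_sum_def e(2)[symmetric] by (rule iid_sum_upper(2)[OF e(1) b])
qed

lemma cell_sum_lower:
  fixes S :: "('d::finite \<Rightarrow> nat) set"
  assumes S: "S \<subseteq> grid m" and \<beta>: "\<beta> \<in> borel_measurable borel" "\<And>y. 0 \<le> \<beta> y \<and> \<beta> y \<le> 1"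
  shows "{\<omega> \<in> space (iid n node). cell_sum n m S \<beta> \<omega> \<le> k} \<in> sets (iid n node)"
    and "measure (iid n node) {\<omega> \<in> space (iid n node). cell_sum n m S \<beta> \<omega> \<le> k}
      \<le> exp (k - real n * (real (card S) / real m ^ CARD('d) * (\<integral>y. \<beta> y \<partial>weights)) / 2)"
proof -
  interpret prob_space "node :: ((real^'d) \<times> real) measure" by (rule prob_space_node)
  note e = cells_weight_expectation[OF S \<beta>]
  have b: "0 \<le> indicat_real (cells m S) (fst z) * \<beta> (snd z) \<and> indicat_real (cells m S) (fst z) * \<beta> (snd z) \<le> 1" for z
    using \<beta>(2) by (auto simp: indicator_def)
  show "{\<omega> \<in> space (iid n node). cell_sum n m S \<beta> \<omega> \<le> k} \<in> sets (iid n node)"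
    unfolding cell_sum_def by (rule iid_sum_lower(1)[OF e(1) b])
  show "measure (iid n node) {\<omega> \<in> space (iid n node). cell_sum n m S \<beta> \<omega> \<le> k}
      \<le> exp (k - real n * (real (card S) / real m ^ CARD('d) * (\<integral>y. \<beta> y \<partial>weights)) / 2)"
    unfolding cell_sum_def e(2)[symmetric] by (rule iid_sum_lower(2)[OF e(1) b])
qed

definition outside :: "((real^'d::finite) \<times> real) set" where
  "outside = {z. fst z \<notin> unit_cube \<or> snd z < 0}"

lemma weights_negative: "measure weights {..<0} = 0"
proof -
  have "emeasure weights {..<0} = (\<integral>\<^sup>+x. ennreal (f x) * indicator {..<0} x \<partial>lborel)"
    using f_meas by (simp add: emeasure_density)
  also have "(\<lambda>x. ennreal (f x) * indicator {..<0} x) = (\<lambda>_. 0)"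
    by (auto simp: fun_eq_iff indicator_def f_supp)
  finally show ?thesis by (simp add: measure_def)
qed

lemma measure_node_fst: "B \<in> sets borel \<Longrightarrow> measure (node :: ((real^'d::finite) \<times> real) measure) {z. fst z \<in> B} = measure cube_law B"
proof -
  assume B: "B \<in> sets (borel :: (real^'d) measure)"
  interpret M1: prob_space "cube_law :: (real^'d) measure" by (rule prob_space_cube_law)
  interpret M2: prob_space weights by (rule prob_space_weights)
  interpret pair_prob_space "cube_law :: (real^'d) measure" weights by unfold_locales
  have "{z. fst z \<in> B} = B \<times> (UNIV :: real set)" by auto
  moreover have "emeasure node (B \<times> (UNIV :: real set)) = emeasure cube_law B * emeasure weights UNIV"
    using B by (intro M2.emeasure_pair_measure_Times) auto
  moreover have "emeasure weights UNIV = 1" using M2.emeasure_space_1 by simp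
  ultimately show ?thesis by (simp only: measure_def mult_1_right)
qed

lemma measure_node_snd: "B \<in> sets borel \<Longrightarrow> measure (node :: ((real^'d::finite) \<times> real) measure) {z. snd z \<in> B} = measure weights B"
proof -
  assume B: "B \<in> sets (borel :: real measure)"
  interpret M1: prob_space "cube_law :: (real^'d) measure" by (rule prob_space_cube_law)
  interpret M2: prob_space weights by (rule prob_space_weights)
  interpret pair_prob_space "cube_law :: (real^'d) measure" weights by unfold_locales
  have "{z. snd z \<in> B} = (UNIV :: (real^'d) set) \<times> B" by auto
  moreover have "emeasure node ((UNIV :: (real^'d) set) \<times> B) = emeasure cube_law (UNIV :: (real^'d) set) * emeasure weights B"
    using B by (intro M2.emeasure_pair_measure_Times) auto
  moreover have "emeasure cube_law (UNIV :: (real^'d) set) = 1" using M1.emeasure_space_1 by simp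
  ultimately show ?thesis by (simp only: measure_def mult_1_left)
qed

lemma outside_measure:
  "outside \<in> sets (node :: ((real^'d::finite) \<times> real) measure)"
  "measure (node :: ((real^'d) \<times> real) measure) outside = 0"
proof -
  interpret prob_space "node :: ((real^'d) \<times> real) measure" by (rule prob_space_node)
  have u: "- unit_cube \<in> sets (borel :: (real^'d) measure)" 
    unfolding Compl_eq_Diff_UNIV using unit_cube_measure(1) by (intro sets.Diff) auto
  have eq: "outside = {z. fst z \<in> - unit_cube} \<union> {z. snd z \<in> {..<0}}"
    by (auto simp: outside_def)
  show "outside \<in> sets (node :: ((real^'d) \<times> real) measure)"
    unfolding eq using u by (intro sets.Un fst_preimage_node snd_preimage_node) auto
  have "unit_cube \<in> sets (cube_law :: (real^'d) measure)" using unit_cube_measure(1) by simp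
  then have "measure cube_law (space cube_law - unit_cube :: (real^'d) set) = 0"
    by (subst prob_space.prob_compl[OF prob_space_cube_law]) (simp_all only: unit_cube_measure(2) diff_self)
  then have c0: "measure (cube_law :: (real^'d) measure) (- unit_cube) = 0"
    by (simp only: Compl_eq_Diff_UNIV space_uniform_measure space_lborel space_borel)
  have "prob {z. fst z \<in> - unit_cube} = 0"
    using measure_node_fst[OF u] c0 by (rule trans)
  moreover have "prob {z. snd z \<in> {..<0}} = 0"
    by (rule trans[OF measure_node_snd weights_negative]) simp
  ultimately have "prob outside \<le> 0"
    unfolding eq using measure_Un_le[OF fst_preimage_node[OF u] snd_preimage_node[of "{..<0}"]] by simp
  then show "prob outside = 0" by (simp add: measure_le_0_iff)
qed

lemma coincidence_measure:
  fixes b :: "'d::finite \<Rightarrow> nat"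
  assumes "i < n" "j < n" "i \<noteq> j" "b \<in> grid L"
  shows "{\<omega> \<in> space (iid n node). \<forall>l\<in>{i, j}. \<omega> l \<in> {z. fst z \<in> cells L {b}}} \<in> sets (iid n node)"
    and "measure (iid n node) {\<omega> \<in> space (iid n node). \<forall>l\<in>{i, j}. \<omega> l \<in> {z. fst z \<in> cells L {b}}}
      = (1 / real L ^ CARD('d)) ^ 2"
proof -
  interpret prob_space "node :: ((real^'d) \<times> real) measure" by (rule prob_space_node)
  have c: "cells L {b} \<in> sets borel" using cells_single_measure(1)[OF assms(4)] by simp
  have ev: "{z. fst z \<in> cells L {b}} \<in> events" by (rule fst_preimage_node[OF c])
  have "{\<omega> \<in> space (iid n node). \<omega> l \<in> {z. fst z \<in> cells L {b}}} \<in> sets (iid n node)" if "l \<in> {i, j}" for l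
  proof -
    have "l \<in> {..<n}" using that assms by auto
    then show ?thesis using ev by measurable
  qed
  then have "{\<omega> \<in> space (iid n node). \<omega> i \<in> {z. fst z \<in> cells L {b}}}
      \<inter> {\<omega> \<in> space (iid n node). \<omega> j \<in> {z. fst z \<in> cells L {b}}} \<in> sets (iid n node)" by blast
  also have "{\<omega> \<in> space (iid n node). \<omega> i \<in> {z. fst z \<in> cells L {b}}}
      \<inter> {\<omega> \<in> space (iid n node). \<omega> j \<in> {z. fst z \<in> cells L {b}}}
      = {\<omega> \<in> space (iid n node). \<forall>l\<in>{i, j}. \<omega> l \<in> {z. fst z \<in> cells L {b}}}" by auto
  finally show "{\<omega> \<in> space (iid n node). \<forall>l\<in>{i, j}. \<omega> l \<in> {z. fst z \<in> cells L {b}}} \<in> sets (iid n node)" .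
  have "measure (iid n node) {\<omega> \<in> space (iid n node). \<forall>l\<in>{i, j}. \<omega> l \<in> {z. fst z \<in> cells L {b}}}
      = prob {z. fst z \<in> cells L {b}} ^ card {i, j}"
    using assms by (intro iid_cylinder ev) auto
  then show "measure (iid n node) {\<omega> \<in> space (iid n node). \<forall>l\<in>{i, j}. \<omega> l \<in> {z. fst z \<in> cells L {b}}}
      = (1 / real L ^ CARD('d)) ^ 2"
    using assms measure_node_fst[OF c] cells_single_measure(2)[OF assms(4)] by (simp add: power2_eq_square)
qed


text \<open>The value (y + 1) / (T + 1), clipped so as to lie in [0, 1] as the Chernoff bounds
  require. If all weights lie between 0 and T, the clipping has no effect.\<close>

definition trunc :: "real \<Rightarrow> real \<Rightarrow> real" where
  "trunc T y = (max 0 (min y T) + 1) / (T + 1)"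

definition coarse_cells :: "nat \<Rightarrow> nat \<Rightarrow> ('d::finite \<Rightarrow> nat) \<Rightarrow> ('d \<Rightarrow> nat) set" where
  "coarse_cells M p C = {b. \<forall>k. b k \<in> {M * p * C k..<M * p * C k + M * p}}"

text \<open>A window with more than K bad cells contains such a set of bad cells, so the union bound
  runs over these sets.\<close>

definition window_sets :: "nat \<Rightarrow> nat \<Rightarrow> nat \<Rightarrow> ('d::finite \<Rightarrow> nat) set set" where
  "window_sets m W K = {S. S \<subseteq> grid m \<and> card S = K + 1 \<and> (\<exists>b\<in>grid m. S \<subseteq> {c \<in> grid m. near m W b c})}"

lemma card_window_sets:
  "finite (window_sets m W K :: ('d::finite \<Rightarrow> nat) set set)"
  "real (card (window_sets m W K :: ('d \<Rightarrow> nat) set set)) \<le> real m ^ CARD('d) * 2 ^ ((6 * W + 3) ^ CARD('d))"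
proof -
  let ?B = "\<lambda>b::'d \<Rightarrow> nat. {c \<in> grid m. near m W b c}"
  have sub: "window_sets m W K \<subseteq> (\<Union>b\<in>grid m. Pow (?B b))" by (auto simp: window_sets_def)
  have fin: "finite (\<Union>b\<in>grid m. Pow (?B b))" by (intro finite_UN_I) auto
  then show "finite (window_sets m W K :: ('d \<Rightarrow> nat) set set)" using sub by (rule finite_subset[rotated])
  have "card (window_sets m W K :: ('d \<Rightarrow> nat) set set) \<le> card (\<Union>b\<in>grid m. Pow (?B b))"
    by (rule card_mono[OF fin sub])
  also have "\<dots> \<le> (\<Sum>b\<in>grid m. card (Pow (?B b)))" by (rule card_UN_le) simp
  also have "\<dots> \<le> (\<Sum>b\<in>(grid m :: ('d \<Rightarrow> nat) set). 2 ^ ((6 * W + 3) ^ CARD('d)))"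
    by (intro sum_mono) (auto simp: card_Pow intro!: power_increasing card_near)
  also have "\<dots> = m ^ CARD('d) * 2 ^ ((6 * W + 3) ^ CARD('d))" by (simp add: card_grid)
  finally have "real (card (window_sets m W K :: ('d \<Rightarrow> nat) set set)) \<le> real (m ^ CARD('d) * 2 ^ ((6 * W + 3) ^ CARD('d)))"
    by (simp only: of_nat_le_iff)
  then show "real (card (window_sets m W K :: ('d \<Rightarrow> nat) set set)) \<le> real m ^ CARD('d) * 2 ^ ((6 * W + 3) ^ CARD('d))"
    by simp
qed

lemma coarse_cells:
  fixes C :: "'d::finite \<Rightarrow> nat"
  assumes C: "C \<in> grid p" and M: "0 < M" and p: "0 < p" and m: "m = M * (p * p)"
  shows "coarse_cells M p C \<subseteq> grid m"
    and "real (card (coarse_cells M p C)) / real m ^ CARD('d) = 1 / real p ^ CARD('d)"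
    and "b \<in> coarse_cells M p C \<longleftrightarrow> (\<lambda>k. b k div M div p) = C"
proof -
  show "coarse_cells M p C \<subseteq> grid m"
  proof
    fix b assume b: "b \<in> coarse_cells M p C"
    have "b k < m" for k
    proof -
      have "b k < M * p * C k + M * p" using b by (auto simp: coarse_cells_def)
      also have "\<dots> = M * p * (C k + 1)" by simp
      also have "\<dots> \<le> M * p * p" using C by (intro mult_le_mono2) (auto simp: grid_def Suc_le_eq)
      finally show ?thesis by (simp add: m)
    qed
    then show "b \<in> grid m" by (simp add: grid_def)
  qed
  have "card (coarse_cells M p C) = (M * p) ^ CARD('d)"
    unfolding coarse_cells_def card_prod_fun by simp
  then show "real (card (coarse_cells M p C)) / real m ^ CARD('d) = 1 / real p ^ CARD('d)"
    using M p by (simp add: m power_mult_distrib)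
  have "b k \<in> {M * p * C k..<M * p * C k + M * p} \<longleftrightarrow> b k div M div p = C k" for k
  proof -
    have "b k div M div p = b k div (M * p)" by (simp add: div_mult2_eq)
    moreover have "b k div (M * p) = C k \<longleftrightarrow> M * p * C k \<le> b k \<and> b k < M * p * C k + M * p"
      using M p by (simp add: div_nat_eqI dividend_less_times_div mult.commute) 
        (metis div_nat_eqI div_times_less_eq_dividend dividend_less_div_times mult.commute mult_Suc nat_0_less_mult_iff add.commute)
    ultimately show ?thesis by simp
  qed
  then show "b \<in> coarse_cells M p C \<longleftrightarrow> (\<lambda>k. b k div M div p) = C"
    unfolding coarse_cells_def by (auto simp: fun_eq_iff)
qed

lemma trunc:
  assumes "1 \<le> T"
  shows "trunc T \<in> borel_measurable borel" "0 \<le> trunc T y \<and> trunc T y \<le> 1"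
    and "integrable lborel (\<lambda>x. x * f x) \<Longrightarrow>
      (\<integral>y. trunc T y \<partial>weights) \<le> ((\<integral>x. x * f x \<partial>lborel) + 1) / (T + 1)"
proof -
  show m: "trunc T \<in> borel_measurable borel" unfolding trunc_def by measurable
  show b: "0 \<le> trunc T y \<and> trunc T y \<le> 1" for y using assms by (auto simp: trunc_def)
  assume int: "integrable lborel (\<lambda>x. x * f x)"
  interpret W: prob_space weights by (rule prob_space_weights)
  have intw: "integrable weights (\<lambda>y. y)"
    using int f_meas f_nonneg by (simp add: integrable_density mult.commute)
  have mean: "(\<integral>y. y \<partial>weights) = (\<integral>x. x * f x \<partial>lborel)"
    using f_meas f_nonneg by (simp add: integral_density mult.commute)
  have nn: "AE y in weights. 0 \<le> y"
    using f_meas f_supp by (subst AE_density) (auto intro!: AE_I2 simp: not_less[symmetric])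
  have "(\<integral>y. trunc T y \<partial>weights) \<le> (\<integral>y. (y + 1) / (T + 1) \<partial>weights)"
  proof (rule integral_mono_AE)
    show "integrable weights (trunc T)"
      using m b by (intro W.integrable_const_bound[where B = 1] AE_I2) (auto simp: abs_le_iff intro: order_trans[of _ 0])
    show "integrable weights (\<lambda>y. (y + 1) / (T + 1))" using intw by simp
    show "AE y in weights. trunc T y \<le> (y + 1) / (T + 1)"
      using nn by eventually_elim (use assms in \<open>auto simp: trunc_def intro!: divide_right_mono\<close>)
  qed
  also have "\<dots> = ((\<integral>x. x * f x \<partial>lborel) + 1) / (T + 1)"
    using intw mean W.prob_space by simp
  finally show "(\<integral>y. trunc T y \<partial>weights) \<le> ((\<integral>x. x * f x \<partial>lborel) + 1) / (T + 1)" .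
qed


section \<open>The six exceptional events and their probabilities\<close>

definition ev_outside :: "nat \<Rightarrow> (nat \<Rightarrow> (real^'d::finite) \<times> real) set" where
  "ev_outside n = {\<omega> \<in> space (iid n node). \<exists>i<n. \<omega> i \<in> outside}"

definition ev_crowded :: "nat \<Rightarrow> nat \<Rightarrow> real \<Rightarrow> (nat \<Rightarrow> (real^'d::finite) \<times> real) set" where
  "ev_crowded n m k = (\<Union>b\<in>grid m. {\<omega> \<in> space (iid n node). k \<le> cell_sum n m {b} (\<lambda>_. 1) \<omega>})"

definition ev_window :: "nat \<Rightarrow> nat \<Rightarrow> nat \<Rightarrow> nat \<Rightarrow> real \<Rightarrow> real \<Rightarrow> (nat \<Rightarrow> (real^'d::finite) \<times> real) set" where
  "ev_window n m W K ws k = (\<Union>S\<in>window_sets m W K. {\<omega> \<in> space (iid n node). cell_sum n m S (indicat_real {ws..}) \<omega> \<le> k})"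

definition ev_heavy :: "nat \<Rightarrow> real \<Rightarrow> (nat \<Rightarrow> (real^'d::finite) \<times> real) set" where
  "ev_heavy n T = {\<omega> \<in> space (iid n node). \<exists>i<n. \<omega> i \<in> {z. snd z \<in> {T..}}}"

definition ev_mass :: "nat \<Rightarrow> nat \<Rightarrow> nat \<Rightarrow> nat \<Rightarrow> real \<Rightarrow> real \<Rightarrow> (nat \<Rightarrow> (real^'d::finite) \<times> real) set" where
  "ev_mass n m M p T k = (\<Union>C\<in>grid p. {\<omega> \<in> space (iid n node). k \<le> cell_sum n m (coarse_cells M p C) (trunc T) \<omega>})"

text \<open>For \<open>\<theta> > 0\<close> two coincident nodes are never adjacent, because \<open>x / 0 = 0\<close>.\<close>

definition ev_coincide :: "nat \<Rightarrow> nat \<Rightarrow> (nat \<Rightarrow> (real^'d::finite) \<times> real) set" where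
  "ev_coincide n L = (\<Union>(i, j)\<in>{(i, j). i < n \<and> j < n \<and> i \<noteq> j}. \<Union>b\<in>grid L.
     {\<omega> \<in> space (iid n node). \<forall>l\<in>{i, j}. \<omega> l \<in> {z. fst z \<in> cells L {b}}})"

lemma iid_node_UN_le:
  assumes "finite I" and "\<And>i. i \<in> I \<Longrightarrow> F i \<in> sets (iid n (node :: ((real^'d::finite) \<times> real) measure))"
    and "\<And>i. i \<in> I \<Longrightarrow> measure (iid n (node :: ((real^'d::finite) \<times> real) measure)) (F i) \<le> B"
  shows "(\<Union>i\<in>I. F i) \<in> sets (iid n node)" "measure (iid n node) (\<Union>i\<in>I. F i) \<le> real (card I) * B"
proof -
  interpret prob_space "node :: ((real^'d) \<times> real) measure" by (rule prob_space_node)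
  show "(\<Union>i\<in>I. F i) \<in> sets (iid n node)" using assms(1,2) by auto
  have "measure (iid n node) (\<Union>i\<in>I. F i) \<le> (\<Sum>i\<in>I. measure (iid n node) (F i))"
    using assms(1,2) by (intro finite_measure.finite_measure_subadditive_finite[OF iid_finite_measure]) auto
  also have "\<dots> \<le> (\<Sum>i\<in>I. B)" by (intro sum_mono assms(3))
  finally show "measure (iid n node) (\<Union>i\<in>I. F i) \<le> real (card I) * B" by simp
qed

lemma ev_outside:
  "ev_outside n \<in> sets (iid n (node :: ((real^'d::finite) \<times> real) measure))"
  "measure (iid n (node :: ((real^'d) \<times> real) measure)) (ev_outside n) \<le> 0"
proof -
  interpret prob_space "node :: ((real^'d) \<times> real) measure" by (rule prob_space_node)
  note e = iid_exists[OF outside_measure(1)[where 'd = 'd], of n]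
  show "ev_outside n \<in> sets (iid n (node :: ((real^'d) \<times> real) measure))"
    unfolding ev_outside_def by (rule e(1))
  show "measure (iid n (node :: ((real^'d) \<times> real) measure)) (ev_outside n) \<le> 0"
    unfolding ev_outside_def using e(2) outside_measure(2)[where 'd = 'd] by (simp only: mult_zero_right)
qed

lemma ev_crowded:
  "ev_crowded n m k \<in> sets (iid n (node :: ((real^'d::finite) \<times> real) measure))"
  "measure (iid n (node :: ((real^'d) \<times> real) measure)) (ev_crowded n m k)
    \<le> real m ^ CARD('d) * exp (2 * (real n / real m ^ CARD('d)) - k)"
proof -
  interpret W: prob_space weights by (rule prob_space_weights)
  have one: "(\<integral>y. 1 \<partial>weights) = (1 :: real)" using W.prob_space by simp
  have u: "{\<omega> \<in> space (iid n (node :: ((real^'d) \<times> real) measure)). k \<le> cell_sum n m {b} (\<lambda>_. 1) \<omega>} \<in> sets (iid n node)"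
    "measure (iid n (node :: ((real^'d) \<times> real) measure)) {\<omega> \<in> space (iid n node). k \<le> cell_sum n m {b} (\<lambda>_. 1) \<omega>}
      \<le> exp (2 * (real n / real m ^ CARD('d)) - k)" if "b \<in> grid m" for b
    using cell_sum_upper[of "{b}" m "\<lambda>_. 1", where k = k and n = n] that one by simp_all
  show "ev_crowded n m k \<in> sets (iid n (node :: ((real^'d) \<times> real) measure))"
    unfolding ev_crowded_def by (rule iid_node_UN_le(1)[OF finite_grid u])
  show "measure (iid n (node :: ((real^'d) \<times> real) measure)) (ev_crowded n m k)
    \<le> real m ^ CARD('d) * exp (2 * (real n / real m ^ CARD('d)) - k)"
    unfolding ev_crowded_def
    by (rule order_trans[OF iid_node_UN_le(2)[OF finite_grid u]]) (simp_all add: card_grid)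
qed

text \<open>Counting the heavy nodes of K + 1 cells together multiplies the exponent of the lower
  tail by K + 1. A large K therefore beats the m^d windows, and the choice of the subset of a window
  costs only a constant factor.\<close>

lemma ev_window:
  "ev_window n m W K ws k \<in> sets (iid n (node :: ((real^'d::finite) \<times> real) measure))"
  "measure (iid n (node :: ((real^'d) \<times> real) measure)) (ev_window n m W K ws k)
    \<le> (real m ^ CARD('d) * 2 ^ ((6 * W + 3) ^ CARD('d)))
      * exp (k - real n * (real (K + 1) / real m ^ CARD('d) * measure weights {ws..}) / 2)"
proof -
  have pw: "(\<integral>y. indicat_real {ws..} y \<partial>weights) = measure weights {ws..}" by simp
  have b: "indicat_real {ws..} \<in> borel_measurable borel" "\<And>y. 0 \<le> indicat_real {ws..} y \<and> indicat_real {ws..} y \<le> 1"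
    by (simp_all add: indicator_def)
  have u: "{\<omega> \<in> space (iid n (node :: ((real^'d) \<times> real) measure)). cell_sum n m S (indicat_real {ws..}) \<omega> \<le> k} \<in> sets (iid n node)"
    "measure (iid n (node :: ((real^'d) \<times> real) measure)) {\<omega> \<in> space (iid n node). cell_sum n m S (indicat_real {ws..}) \<omega> \<le> k}
      \<le> exp (k - real n * (real (K + 1) / real m ^ CARD('d) * measure weights {ws..}) / 2)" if "S \<in> window_sets m W K" for S
  proof -
    have S: "S \<subseteq> grid m" "card S = K + 1" using that by (auto simp: window_sets_def)
    show "{\<omega> \<in> space (iid n (node :: ((real^'d) \<times> real) measure)). cell_sum n m S (indicat_real {ws..}) \<omega> \<le> k} \<in> sets (iid n node)"
      by (rule cell_sum_lower(1)[OF S(1) b])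
    show "measure (iid n (node :: ((real^'d) \<times> real) measure)) {\<omega> \<in> space (iid n node). cell_sum n m S (indicat_real {ws..}) \<omega> \<le> k}
      \<le> exp (k - real n * (real (K + 1) / real m ^ CARD('d) * measure weights {ws..}) / 2)"
      using cell_sum_lower(2)[OF S(1) b, of n k] unfolding S(2) pw .
  qed
  show "ev_window n m W K ws k \<in> sets (iid n (node :: ((real^'d) \<times> real) measure))"
    unfolding ev_window_def by (rule iid_node_UN_le(1)[OF card_window_sets(1) u])
  have "measure (iid n (node :: ((real^'d) \<times> real) measure)) (ev_window n m W K ws k)
    \<le> real (card (window_sets m W K :: ('d \<Rightarrow> nat) set set))
      * exp (k - real n * (real (K + 1) / real m ^ CARD('d) * measure weights {ws..}) / 2)"
    unfolding ev_window_def by (rule iid_node_UN_le(2)[OF card_window_sets(1) u])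
  also have "\<dots> \<le> (real m ^ CARD('d) * 2 ^ ((6 * W + 3) ^ CARD('d)))
      * exp (k - real n * (real (K + 1) / real m ^ CARD('d) * measure weights {ws..}) / 2)"
    by (intro mult_right_mono card_window_sets(2)) simp
  finally show "measure (iid n (node :: ((real^'d) \<times> real) measure)) (ev_window n m W K ws k)
    \<le> (real m ^ CARD('d) * 2 ^ ((6 * W + 3) ^ CARD('d)))
      * exp (k - real n * (real (K + 1) / real m ^ CARD('d) * measure weights {ws..}) / 2)" .
qed

lemma ev_heavy:
  "ev_heavy n T \<in> sets (iid n (node :: ((real^'d::finite) \<times> real) measure))"
  "measure (iid n (node :: ((real^'d) \<times> real) measure)) (ev_heavy n T) \<le> real n * measure weights {T..}"
proof -
  interpret prob_space "node :: ((real^'d) \<times> real) measure" by (rule prob_space_node)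
  have b: "{T..} \<in> sets borel" by simp
  note e = iid_exists[OF snd_preimage_node[OF b, where 'd = 'd], of n]
  show "ev_heavy n T \<in> sets (iid n (node :: ((real^'d) \<times> real) measure))"
    unfolding ev_heavy_def by (rule e(1))
  show "measure (iid n (node :: ((real^'d) \<times> real) measure)) (ev_heavy n T) \<le> real n * measure weights {T..}"
    unfolding ev_heavy_def using e(2) unfolding measure_node_snd[OF b] .
qed

lemma ev_mass:
  assumes T: "1 \<le> T" and int: "integrable lborel (\<lambda>x. x * f x)"
    and M: "0 < M" and p: "0 < p" and m: "m = M * (p * p)"
  shows "ev_mass n m M p T k \<in> sets (iid n (node :: ((real^'d::finite) \<times> real) measure))"
  "measure (iid n (node :: ((real^'d) \<times> real) measure)) (ev_mass n m M p T k)
    \<le> real p ^ CARD('d) * exp (2 * real n * (1 / real p ^ CARD('d) * (((\<integral>x. x * f x \<partial>lborel) + 1) / (T + 1))) - k)"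
proof -
  let ?B = "((\<integral>x. x * f x \<partial>lborel) + 1) / (T + 1)"
  have u: "{\<omega> \<in> space (iid n (node :: ((real^'d) \<times> real) measure)). k \<le> cell_sum n m (coarse_cells M p C) (trunc T) \<omega>} \<in> sets (iid n node)"
    "measure (iid n (node :: ((real^'d) \<times> real) measure)) {\<omega> \<in> space (iid n node). k \<le> cell_sum n m (coarse_cells M p C) (trunc T) \<omega>}
      \<le> exp (2 * real n * (1 / real p ^ CARD('d) * ?B) - k)" if C: "C \<in> grid p" for C
  proof -
    note c = coarse_cells[OF C M p m]
    show "{\<omega> \<in> space (iid n (node :: ((real^'d) \<times> real) measure)). k \<le> cell_sum n m (coarse_cells M p C) (trunc T) \<omega>} \<in> sets (iid n node)"
      by (rule cell_sum_upper(1)[OF c(1) trunc(1,2)[OF T]])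
    have "measure (iid n (node :: ((real^'d) \<times> real) measure)) {\<omega> \<in> space (iid n node). k \<le> cell_sum n m (coarse_cells M p C) (trunc T) \<omega>}
      \<le> exp (2 * real n * (1 / real p ^ CARD('d) * (\<integral>y. trunc T y \<partial>weights)) - k)"
      using cell_sum_upper(2)[OF c(1) trunc(1,2)[OF T], of n k] unfolding c(2) .
    also have "\<dots> \<le> exp (2 * real n * (1 / real p ^ CARD('d) * ?B) - k)"
      using trunc(3)[OF T int] unfolding exp_le_cancel_iff by (intro diff_right_mono mult_left_mono) auto
    finally show "measure (iid n (node :: ((real^'d) \<times> real) measure)) {\<omega> \<in> space (iid n node). k \<le> cell_sum n m (coarse_cells M p C) (trunc T) \<omega>}
      \<le> exp (2 * real n * (1 / real p ^ CARD('d) * ?B) - k)" .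
  qed
  show "ev_mass n m M p T k \<in> sets (iid n (node :: ((real^'d) \<times> real) measure))"
    unfolding ev_mass_def by (rule iid_node_UN_le(1)[OF finite_grid u])
  show "measure (iid n (node :: ((real^'d) \<times> real) measure)) (ev_mass n m M p T k)
    \<le> real p ^ CARD('d) * exp (2 * real n * (1 / real p ^ CARD('d) * ?B) - k)"
    unfolding ev_mass_def
    by (rule order_trans[OF iid_node_UN_le(2)[OF finite_grid u]]) (simp_all add: card_grid)
qed

lemma ev_coincide:
  assumes L: "0 < L"
  shows "ev_coincide n L \<in> sets (iid n (node :: ((real^'d::finite) \<times> real) measure))"
  "measure (iid n (node :: ((real^'d) \<times> real) measure)) (ev_coincide n L) \<le> (real n)\<^sup>2 / real L ^ CARD('d)"
proof -
  let ?P = "{(i, j). i < n \<and> j < n \<and> i \<noteq> j}"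
  have sub: "?P \<subseteq> {..<n} \<times> {..<n}" by auto
  then have fin: "finite ?P" by (rule finite_subset) simp
  have card: "real (card ?P) \<le> (real n)\<^sup>2"
  proof -
    have "card ?P \<le> card ({..<n} \<times> {..<n})" by (intro card_mono sub) simp
    then have "card ?P \<le> n * n" by (simp add: card_cartesian_product)
    then have "real (card ?P) \<le> real (n * n)" by (simp only: of_nat_le_iff)
    then show ?thesis by (simp add: power2_eq_square)
  qed
  let ?F = "\<lambda>z. \<Union>b\<in>grid L. {\<omega> \<in> space (iid n (node :: ((real^'d) \<times> real) measure)). \<forall>l\<in>{fst z, snd z}. \<omega> l \<in> {z. fst z \<in> cells L {b}}}"
  have F: "?F z \<in> sets (iid n node)" "measure (iid n node) (?F z) \<le> 1 / real L ^ CARD('d)" if z: "z \<in> ?P" for z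
  proof -
    have ij: "fst z < n" "snd z < n" "fst z \<noteq> snd z" using z by auto
    note c = coincidence_measure[OF ij, where 'd = 'd and L = L]
    show "?F z \<in> sets (iid n node)" using c by (intro iid_node_UN_le(1)[OF finite_grid]) auto
    have "measure (iid n node) (?F z) \<le> real (card (grid L :: ('d \<Rightarrow> nat) set)) * (1 / real L ^ CARD('d)) ^ 2"
      using c by (intro iid_node_UN_le(2)[OF finite_grid]) auto
    also have "\<dots> = 1 / real L ^ CARD('d)" using L by (simp add: card_grid power2_eq_square)
    finally show "measure (iid n node) (?F z) \<le> 1 / real L ^ CARD('d)" .
  qed
  have eq: "ev_coincide n L = (\<Union>z\<in>?P. ?F z)" 
    unfolding ev_coincide_def by (intro SUP_cong refl) (simp add: case_prod_beta)
  show "ev_coincide n L \<in> sets (iid n (node :: ((real^'d) \<times> real) measure))"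
    unfolding eq by (rule iid_node_UN_le(1)[OF fin F])
  have "measure (iid n (node :: ((real^'d) \<times> real) measure)) (ev_coincide n L) \<le> real (card ?P) * (1 / real L ^ CARD('d))"
    unfolding eq by (rule iid_node_UN_le(2)[OF fin F])
  also have "\<dots> \<le> (real n)\<^sup>2 * (1 / real L ^ CARD('d))" using card by (intro mult_right_mono) auto
  finally show "measure (iid n (node :: ((real^'d) \<times> real) measure)) (ev_coincide n L) \<le> (real n)\<^sup>2 / real L ^ CARD('d)" by simp
qed

text \<open>The interface between probability and geometry: everything from here on about a single
  connected realisation is deterministic.\<close>

lemma good_realisation_config:
  fixes \<omega> :: "nat \<Rightarrow> (real^'d::finite) \<times> real"
  assumes \<omega>: "\<omega> \<in> space (iid n node)" "\<omega> \<notin> ev_outside n" "\<omega> \<notin> ev_crowded n m (C0 * real h)"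
      "\<omega> \<notin> ev_window n m W K ws (real (K + 1) * real h)" "\<omega> \<notin> ev_heavy n T"
      "\<omega> \<notin> ev_mass n m M p T (C1 * real p ^ d * real h / (T + 1))" "\<omega> \<notin> ev_coincide n L"
    and conn: "graph_connected n (gtg_graph n \<theta> \<omega>)"
    and d: "d = CARD('d)" "2 \<le> d" and M: "M = 2 * K + 1" and m: "m = M * (p * p)"
    and pos: "2 \<le> n" "0 < p" "3 \<le> h" "1 \<le> T" "0 < kl" "0 \<le> ku" "1 \<le> C0" "0 \<le> C1" "0 < \<theta>" "0 < L"
    and kl: "kl \<le> \<theta> / real m ^ d" and ku: "\<theta> * sqrt (real d) ^ d / real m ^ d \<le> ku"
    and ws: "ku * 2 ^ d \<le> ws" and wb: "wb = ku * (real M + 1) ^ d"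
    and R: "2 * wb < kl * real R ^ d" and W: "(K * K + 1) * (R + 2 * M) + 2 * M \<le> W"
    and \<rho>: "2 * T < kl * real \<rho> ^ d" "real \<rho> ^ d \<le> C\<rho> * T"
    and T_p: "T \<le> (real p)\<^sup>2" "T * real h ^ 6 \<le> real p ^ 4"
  shows "gtg_config n (gtg_graph n \<theta> \<omega>) (\<lambda>i. cell_of m (fst (\<omega> i))) (\<lambda>i. snd (\<omega> i))
    d K M p m W R h \<rho> T kl ku ws wb C0 C1 C\<rho>"
proof -
  have Mp: "0 < M" using M by simp
  have mp: "0 < m" using Mp pos by (simp add: m)
  have X: "fst (\<omega> i) \<in> unit_cube" "0 \<le> snd (\<omega> i)" if "i < n" for i
    using \<omega>(1,2) that by (auto simp: ev_outside_def outside_def)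
  have T: "snd (\<omega> i) < T" if "i < n" for i using \<omega>(1,5) that by (auto simp: ev_heavy_def)
  have ne: "fst (\<omega> i) \<noteq> fst (\<omega> j)" if ij: "i < n" "j < n" "i \<noteq> j" for i j
  proof
    assume e: "fst (\<omega> i) = fst (\<omega> j)"
    let ?b = "cell_of L (fst (\<omega> i))"
    have b: "?b \<in> grid L" using X[OF ij(1)] pos by (intro cell_of_grid) auto
    have "\<omega> l \<in> {z. fst z \<in> cells L {?b}}" if "l \<in> {i, j}" for l
      using that e X ij by (auto simp: cells_def)
    then have "\<omega> \<in> ev_coincide n L" unfolding ev_coincide_def using \<omega>(1) ij b by blast
    then show False using \<omega>(7) by simp
  qed
  have cs: "cell_sum n m S \<beta> \<omega> = (\<Sum>i\<in>{i. i < n \<and> cell_of m (fst (\<omega> i)) \<in> S}. \<beta> (snd (\<omega> i)))" for S \<beta>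
    unfolding cell_sum_def using X by (intro sum.mono_neutral_cong_right) (auto simp: cells_def indicator_def)
  have sym: "torus_dist x y = torus_dist y x" for x y :: "real^'d"
    unfolding torus_dist_def by (simp add: abs_minus_commute)
  show ?thesis
  proof (unfold_locales, goal_cases)
    case (1 i j)
    then show ?case by (auto simp: gtg_graph_def gtg_adj_def sym add.commute)
  next
    case (2 i j)
    then show ?case by (auto simp: gtg_graph_def gtg_adj_def)
  next
    case 3 show ?case by (rule d)
  next
    case 4 show ?case by (rule d)
  next
    case 5 show ?case by (rule M)
  next
    case 6 show ?case by (rule m)
  next
    case (7 i)
    show ?case by (auto simp: gtg_graph_def gtg_adj_def)
  next
    case 8 show ?case by (rule conn)
  next
    case (17 i)
    then show ?case using X mp by (intro cell_of_grid) auto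
  next
    case (18 i)
    then show ?case using X by simp
  next
    case (19 i)
    then show ?case using T[of i] by simp
  next
    case (20 i j q)
    then show ?case unfolding gtg_graph_def
      using X ne mp pos ku[unfolded d(1)] by (intro gtg_adjI) (auto simp: d(1))
  next
    case (21 i j q)
    then have A: "gtg_adj n \<theta> (\<lambda>i. fst (\<omega> i)) (\<lambda>i. snd (\<omega> i)) i j" by (simp add: gtg_graph_def)
    then have "i < n" "j < n" by (auto simp: gtg_adj_def)
    then show ?case using X mp pos kl[unfolded d(1)] 21(2) by (intro gtg_adjD[OF A]) (auto simp: d(1))
  next
    case (22 b)
    have "\<not> C0 * real h \<le> cell_sum n m {b} (\<lambda>_. 1) \<omega>" using \<omega>(1,3) 22 by (auto simp: ev_crowded_def)
    then show ?case by (simp add: cs)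
  next
    case (23 b)
    let ?Z = "{c \<in> grid m. near m W b c \<and> card {i. i < n \<and> cell_of m (fst (\<omega> i)) = c \<and> ws \<le> snd (\<omega> i)} < h}"
    show ?case
    proof (rule ccontr)
      assume "\<not> card ?Z \<le> K"
      then have "K + 1 \<le> card ?Z" by simp
      \<comment> \<open>Each of these K + 1 cells has fewer than h heavy nodes, so together they
        stay below (K + 1) h, which the event for S excludes.\<close>
      then obtain S where S: "S \<subseteq> ?Z" "card S = K + 1" "finite S" by (rule obtain_subset_with_card_n)
      then have Sw: "S \<in> window_sets m W K" using 23 unfolding window_sets_def by auto
      have "cell_sum n m S (indicat_real {ws..}) \<omega>
          = (\<Sum>i\<in>{i. i < n \<and> cell_of m (fst (\<omega> i)) \<in> S}. indicat_real {ws..} (snd (\<omega> i)))" by (rule cs)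
      also have "\<dots> = (\<Sum>c\<in>S. \<Sum>i\<in>{i \<in> {i. i < n \<and> cell_of m (fst (\<omega> i)) \<in> S}. cell_of m (fst (\<omega> i)) = c}. indicat_real {ws..} (snd (\<omega> i)))"
        using S(3) by (intro sum.group[symmetric]) auto
      also have "\<dots> \<le> (\<Sum>c\<in>S. real h)"
      proof (intro sum_mono)
        fix c assume c: "c \<in> S"
        have "(\<Sum>i\<in>{i \<in> {i. i < n \<and> cell_of m (fst (\<omega> i)) \<in> S}. cell_of m (fst (\<omega> i)) = c}. indicat_real {ws..} (snd (\<omega> i)))
            = (\<Sum>i\<in>{i. i < n \<and> cell_of m (fst (\<omega> i)) = c \<and> ws \<le> snd (\<omega> i)}. 1)"
          using c by (intro sum.mono_neutral_cong_right) (auto simp: indicator_def)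
        also have "\<dots> \<le> real h" using c S(1) by auto
        finally show "(\<Sum>i\<in>{i \<in> {i. i < n \<and> cell_of m (fst (\<omega> i)) \<in> S}. cell_of m (fst (\<omega> i)) = c}. indicat_real {ws..} (snd (\<omega> i))) \<le> real h" .
      qed
      also have "\<dots> = real (K + 1) * real h" using S(2) by simp
      finally have "\<omega> \<in> ev_window n m W K ws (real (K + 1) * real h)"
        unfolding ev_window_def using Sw \<omega>(1) by blast
      then show False using \<omega>(4) by simp
    qed
  next
    case (24 C)
    have "\<not> C1 * real p ^ d * real h / (T + 1) \<le> cell_sum n m (coarse_cells M p C) (trunc T) \<omega>"
      using \<omega>(1,6) 24 by (auto simp: ev_mass_def)
    also have "cell_sum n m (coarse_cells M p C) (trunc T) \<omega>
        = (\<Sum>i\<in>{i. i < n \<and> (\<lambda>k. cell_of m (fst (\<omega> i)) k div M div p) = C}. (snd (\<omega> i) + 1) / (T + 1))"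
      unfolding cs coarse_cells(3)[OF 24 Mp pos(2) m]
      using X T by (intro sum.cong refl) (auto simp: trunc_def min_absorb1 less_imp_le)
    also have "\<dots> = (\<Sum>i\<in>{i. i < n \<and> (\<lambda>k. cell_of m (fst (\<omega> i)) k div M div p) = C}. snd (\<omega> i) + 1) / (T + 1)"
      by (simp add: sum_divide_distrib)
    finally show ?case using pos(4) by (simp add: divide_le_cancel not_le less_imp_le divide_less_cancel)
  qed (use assms in auto)
qed

end

subsection \<open>The slow mixing event\<close>

context weight_density begin

text \<open>There are finitely many graphs on n nodes, so P may be arbitrary: the event is a finite
  union of events that prescribe every edge. Measurability gives the limit in the theorem its
  content, since \<open>measure\<close> is 0 on non-measurable sets.\<close>

lemma graph_event_measurable:
  "{\<omega> \<in> space (gtg_space f n :: (nat \<Rightarrow> (real^'d::finite) \<times> real) measure). P (gtg_graph n \<theta> \<omega>)}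
    \<in> sets (gtg_space f n)"
proof -
  let ?M = "gtg_space f n :: (nat \<Rightarrow> (real^'d) \<times> real) measure"
  have edge: "{\<omega> \<in> space ?M. gtg_graph n \<theta> \<omega> i j} \<in> sets ?M" if ij: "i < n" "j < n" for i j
  proof -
    have comp: "(\<lambda>\<omega>. \<omega> l) \<in> measurable ?M (borel \<Otimes>\<^sub>M borel)" if "l < n" for l
      using measurable_component_singleton[of l "{..<n}" "\<lambda>_. node"] that
      unfolding gtg_space_iid measurable_cong_sets[OF refl sets_node] by simp
    have X: "(\<lambda>\<omega>. fst (\<omega> l)) \<in> borel_measurable ?M" and W: "(\<lambda>\<omega>. snd (\<omega> l)) \<in> borel_measurable ?M"
      if "l < n" for l
      using measurable_compose[OF comp[OF that] measurable_fst] measurable_compose[OF comp[OF that] measurable_snd] by auto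
    have C: "(\<lambda>\<omega>. fst (\<omega> l) $ k) \<in> borel_measurable ?M" if "l < n" for l k
      unfolding cart_eq_inner_axis using X[OF that] by measurable
    note [measurable] = W[OF ij(1)] W[OF ij(2)] C[OF ij(1)] C[OF ij(2)]
    have "{\<omega> \<in> space ?M. i \<noteq> j \<and> \<theta> \<le> (snd (\<omega> i) + snd (\<omega> j)) / torus_dist (fst (\<omega> i)) (fst (\<omega> j)) ^ CARD('d)} \<in> sets ?M"
      unfolding torus_dist_def by measurable
    also have "{\<omega> \<in> space ?M. i \<noteq> j \<and> \<theta> \<le> (snd (\<omega> i) + snd (\<omega> j)) / torus_dist (fst (\<omega> i)) (fst (\<omega> j)) ^ CARD('d)}
        = {\<omega> \<in> space ?M. gtg_graph n \<theta> \<omega> i j}"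
      by (simp only: gtg_graph_def gtg_adj_def ij simp_thms)
    finally show ?thesis .
  qed
  define G where "G R = {\<omega> \<in> space ?M. \<forall>z\<in>{..<n} \<times> {..<n}. gtg_graph n \<theta> \<omega> (fst z) (snd z) \<longleftrightarrow> z \<in> R}" for R
  have G: "G R \<in> sets ?M" for R
  proof -
    have "{\<omega> \<in> space ?M. gtg_graph n \<theta> \<omega> (fst z) (snd z) \<longleftrightarrow> z \<in> R} \<in> sets ?M" if "z \<in> {..<n} \<times> {..<n}" for z
    proof (cases "z \<in> R")
      case True
      then show ?thesis using edge[of "fst z" "snd z"] that by auto
    next
      case False
      have "space ?M - {\<omega> \<in> space ?M. gtg_graph n \<theta> \<omega> (fst z) (snd z)} \<in> sets ?M"
        using edge[of "fst z" "snd z"] that by auto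
      also have "space ?M - {\<omega> \<in> space ?M. gtg_graph n \<theta> \<omega> (fst z) (snd z)}
          = {\<omega> \<in> space ?M. gtg_graph n \<theta> \<omega> (fst z) (snd z) \<longleftrightarrow> z \<in> R}" using False by auto
      finally show ?thesis .
    qed
    then show ?thesis unfolding G_def by (intro sets.sets_Collect_finite_All) auto
  qed
  have "{\<omega> \<in> space ?M. P (gtg_graph n \<theta> \<omega>)}
      = (\<Union>R\<in>{R \<in> Pow ({..<n} \<times> {..<n}). P (\<lambda>i j. (i, j) \<in> R)}. G R)"
  proof safe
    fix \<omega> assume \<omega>: "\<omega> \<in> space ?M" "P (gtg_graph n \<theta> \<omega>)"
    let ?R = "{z \<in> {..<n} \<times> {..<n}. gtg_graph n \<theta> \<omega> (fst z) (snd z)}"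
    have "(\<lambda>i j. (i, j) \<in> ?R) = gtg_graph n \<theta> \<omega>"
      by (auto simp: fun_eq_iff gtg_graph_def gtg_adj_def)
    then have "?R \<in> {R \<in> Pow ({..<n} \<times> {..<n}). P (\<lambda>i j. (i, j) \<in> R)}" using \<omega> by auto
    moreover have "\<omega> \<in> G ?R" using \<omega> by (auto simp: G_def)
    ultimately show "\<omega> \<in> (\<Union>R\<in>{R \<in> Pow ({..<n} \<times> {..<n}). P (\<lambda>i j. (i, j) \<in> R)}. G R)" by blast
  next
    fix \<omega> R assume R: "\<omega> \<in> G R" "R \<subseteq> {..<n} \<times> {..<n}" "P (\<lambda>i j. (i, j) \<in> R)"
    show "\<omega> \<in> space ?M" using R by (simp add: G_def)
    have "gtg_graph n \<theta> \<omega> i j \<longleftrightarrow> (i, j) \<in> R" for i j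
    proof (cases "i < n \<and> j < n")
      case True
      then have "(i, j) \<in> {..<n} \<times> {..<n}" by simp
      then show ?thesis using R(1) unfolding G_def by fastforce
    next
      case False
      then show ?thesis using R(2) by (auto simp: gtg_graph_def gtg_adj_def)
    qed
    then have "gtg_graph n \<theta> \<omega> = (\<lambda>i j. (i, j) \<in> R)" by (simp add: fun_eq_iff)
    then show "P (gtg_graph n \<theta> \<omega>)" using R(3) by simp
  qed
  also have "\<dots> \<in> sets ?M" using G by (intro sets.finite_UN) auto
  finally show ?thesis .
qed

end

lemma connected_deg_pos:
  assumes "graph_connected n A" "2 \<le> n" "i < n" and vert: "\<And>i j. A i j \<Longrightarrow> i < n \<and> j < n"
  shows "0 < deg n A i"
proof -
  obtain j where j: "j < n" "j \<noteq> i" using assms(2,3) by (cases "i = 0") (auto intro: that[of 1] that[of 0])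
  then have "A\<^sup>*\<^sup>* i j" using assms by (simp add: graph_connected_def)
  then obtain k where k: "A i k" using j by (metis converse_rtranclpE)
  have "card {k} \<le> card {j. j < n \<and> A i j}" using k vert by (intro card_mono) auto
  then show ?thesis by (simp add: deg_def)
qed

text \<open>On the complete graph \<open>cross g g\<close> is the square of the sum of g minus the
  sum of the squares, so both inequalities hold with \<open>\<Lambda>\<close> = 1. The sign -1 uses
  \<open>3 \<le> n\<close>: two nodes form a bipartite graph.\<close>

lemma complete_mix_time:
  assumes A: "\<And>i j. A i j \<longleftrightarrow> i < n \<and> j < n \<and> i \<noteq> j" and n: "3 \<le> n"
  shows "\<exists>m. mix_time n A (1 / real n) = enat m \<and> real m \<le> 5 * 1 * ln (real n)"
proof -
  interpret walk_graph n A by unfold_locales (use A in auto)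
  have "{j. j < n \<and> A i j} = {..<n} - {i}" if "i < n" for i using A that by auto
  then have dg: "deg n A i = n - 1" if "i < n" for i using that by (simp add: deg_def)
  have ip: "ip f g = (real n - 1) * (\<Sum>i<n. f i * g i)" for f g
    unfolding ip_def sum_distrib_left using n by (intro sum.cong) (auto simp: dg of_nat_diff)
  have cross: "cross g g = (\<Sum>i<n. g i)\<^sup>2 - (\<Sum>i<n. g i * g i)" for g
  proof -
    have "cross g g = (\<Sum>u<n. \<Sum>v<n. g u * g v - (if u = v then g u * g v else 0))"
      unfolding cross_def using A by (intro sum.cong refl) auto
    also have "\<dots> = (\<Sum>u<n. \<Sum>v<n. g u * g v) - (\<Sum>u<n. g u * g u)"
      by (simp add: sum_subtractf)
    finally show ?thesis by (simp add: power2_eq_square sum_product)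
  qed
  have sq: "0 \<le> (\<Sum>i<n. g i * g i)" for g :: "nat \<Rightarrow> real" by (intro sum_nonneg) auto
  have "exp 1 \<le> (3 :: real)" by (rule exp_le)
  also have "\<dots> \<le> real n" using n by simp
  finally have e: "exp 1 \<le> real n" .
  show ?thesis
  proof (rule mix_time_le)
    show "0 < deg n A i" if "i < n" for i using dg[OF that] n by simp
    fix g
    have r: "1 * (\<Sum>i<n. g i * g i) \<le> (real n - 1) * (\<Sum>i<n. g i * g i)"
      "2 * (\<Sum>i<n. g i * g i) \<le> (real n - 1) * (\<Sum>i<n. g i * g i)"
      by (rule mult_right_mono[OF _ sq], use n in simp)+
    have alg: "x \<le> 1 * (2 * x + 2 * (q - s))" if "2 * s \<le> x" "0 \<le> q" for x q s :: real
      using that by simp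
    show "ip g g \<le> 1 * energy (-1) g"
      unfolding energy_eq[of "-1" g, simplified] cross ip by (rule alg[OF r(2)]) simp
    assume "ip g (\<lambda>_. 1) = 0"
    then have "(\<Sum>i<n. g i) = 0" using n by (simp add: ip)
    then show "ip g g \<le> 1 * energy 1 g"
      unfolding energy_eq[of 1 g, simplified] cross ip using r sq[of g] by simp
  qed (use e in auto)
qed

context weight_density begin

text \<open>A law with a density has no mass at 0, and the half-lines {1 / (k + 1)..} exhaust the
  positive numbers. The threshold ws may be tiny; the cell size is adapted to it afterwards.\<close>

lemma weights_positive: "\<exists>ws>0. 0 < measure weights {ws..}"
proof -
  interpret W: prob_space weights by (rule prob_space_weights)
  have "AE y in weights. 0 < y"
    using AE_lborel_singleton[of 0] f_meas f_supp
    by (subst AE_density) (auto elim!: eventually_mono simp: neq_iff)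
  then have 1: "W.prob {0<..} = 1"
    using W.prob_Collect_eq_1[of "\<lambda>y. 0 < y"] by (simp add: greaterThan_def)
  have "(\<lambda>k. W.prob {1 / real (Suc k)..}) \<longlonglongrightarrow> W.prob (\<Union>k. {1 / real (Suc k)..})"
    by (intro W.finite_Lim_measure_incseq) (auto simp: incseq_def field_simps intro: order_trans[rotated])
  moreover have "(\<Union>k. {1 / real (Suc k)..}) = {0 :: real<..}"
  proof safe
    fix x :: real assume "0 < x"
    then obtain k where "1 / real (Suc k) < x" using nat_approx_posE by blast
    then show "x \<in> (\<Union>k. {1 / real (Suc k)..})" by (auto intro: less_imp_le)
  next
    fix x :: real and k assume "1 / real (Suc k) \<le> x"
    then show "0 < x" by (rule less_le_trans[rotated]) simp
  qed
  ultimately have "(\<lambda>k. W.prob {1 / real (Suc k)..}) \<longlonglongrightarrow> 1" using 1 by simp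
  then have "eventually (\<lambda>k. 0 < W.prob {1 / real (Suc k)..}) sequentially"
    by (rule order_tendstoD) simp
  then obtain k where "0 < W.prob {1 / real (Suc k)..}" by (auto simp: eventually_sequentially)
  then show ?thesis by (intro exI[of _ "1 / real (Suc k)"]) auto
qed

definition slow_mixing :: "nat \<Rightarrow> real \<Rightarrow> real \<Rightarrow> (nat \<Rightarrow> (real^'d::finite) \<times> real) set" where
  "slow_mixing n \<theta> t = {\<omega> \<in> space (gtg_space f n). graph_connected n (gtg_graph n \<theta> \<omega>) \<and>
     \<not> (\<exists>m. mix_time n (gtg_graph n \<theta> \<omega>) (1 / real n) = enat m \<and> real m \<le> t)}"

lemma slow_mixing_measurable: "slow_mixing n \<theta> t \<in> sets (gtg_space f n :: (nat \<Rightarrow> (real^'d::finite) \<times> real) measure)"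
  unfolding slow_mixing_def by (rule graph_event_measurable)

lemma measure_Un6_le:
  assumes "finite_measure M" "A1 \<in> sets M" "A2 \<in> sets M" "A3 \<in> sets M" "A4 \<in> sets M" "A5 \<in> sets M" "A6 \<in> sets M"
    and "E \<subseteq> A1 \<union> A2 \<union> A3 \<union> A4 \<union> A5 \<union> A6"
  shows "measure M E \<le> measure M A1 + measure M A2 + measure M A3 + measure M A4 + measure M A5 + measure M A6"
proof -
  have "measure M E \<le> measure M (A1 \<union> A2 \<union> A3 \<union> A4 \<union> A5 \<union> A6)"
    using assms by (intro finite_measure.finite_measure_mono) auto
  also have "\<dots> \<le> measure M (A1 \<union> A2 \<union> A3 \<union> A4 \<union> A5) + measure M A6"
    using assms by (intro measure_Un_le) auto
  also have "measure M (A1 \<union> A2 \<union> A3 \<union> A4 \<union> A5) \<le> measure M (A1 \<union> A2 \<union> A3 \<union> A4) + measure M A5"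
    using assms by (intro measure_Un_le) auto
  also have "measure M (A1 \<union> A2 \<union> A3 \<union> A4) \<le> measure M (A1 \<union> A2 \<union> A3) + measure M A4"
    using assms by (intro measure_Un_le) auto
  also have "measure M (A1 \<union> A2 \<union> A3) \<le> measure M (A1 \<union> A2) + measure M A3"
    using assms by (intro measure_Un_le) auto
  also have "measure M (A1 \<union> A2) \<le> measure M A1 + measure M A2"
    using assms by (intro measure_Un_le) auto
  finally show ?thesis by simp
qed

text \<open>For the Chernoff events the exponent is pushed below -2 ln n, so that a union over order
  n cells still leaves order 1 / n. Only the event of a weight above T keeps its own bound, which
  the tail condition later turns into a power of n.\<close>

lemma slow_mixing_bound:
  fixes n d K M p W R h \<rho> :: nat and T \<delta> \<eta> c pw ws kl ku wb C0 C1 C\<rho> l \<mu> t :: real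
  assumes d: "d = CARD('d::finite)" "2 \<le> d" and M: "M = 2 * K + 1"
    and c: "0 < c" and \<delta>: "0 < \<delta>" and pw: "pw = measure weights {ws..}" "0 < pw"
    and mean: "integrable lborel (\<lambda>x. x * f x)" "\<mu> = (\<integral>x. x * f x \<partial>lborel)" "0 \<le> \<mu>"
    and kl: "kl = c * \<delta>" and ku: "ku = 4 ^ d * c * \<delta> * sqrt (real d) ^ d" and ws: "ku * 2 ^ d \<le> ws"
    and \<eta>: "\<eta> = \<delta> * pw / 8" and K: "8 \<le> (real K + 1) * \<delta> * pw"
    and wb: "wb = ku * (real M + 1) ^ d"
    and R: "2 * wb < kl * real R ^ d" and W: "(K * K + 1) * (R + 2 * M) + 2 * M \<le> W"
    and C\<rho>: "C\<rho> = 2 ^ d * (2 / kl + 1)"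
    and C0: "1 \<le> C0" "2 * 4 ^ d * \<delta> + 2 \<le> C0 * \<eta>"
    and C1: "0 \<le> C1" "2 * (\<mu> + 1) * 4 ^ d * \<delta> * real M ^ d + 4 \<le> C1 * \<eta>"
    and l: "l = ln (real n)" "1 \<le> l" "1 \<le> \<delta> * l" and n: "3 \<le> n"
    and p: "0 < p" "real p ^ (2 * d) \<le> real n / (\<delta> * real M ^ d * l)"
      "real n / (\<delta> * real M ^ d * l) \<le> 4 ^ d * real p ^ (2 * d)"
    and T: "1 \<le> T" "T \<le> (real p)\<^sup>2" and h: "3 \<le> h" "\<eta> * l \<le> real h" "real h \<le> 2 * \<eta> * l" "real h ^ 6 \<le> (real p)\<^sup>2"
    and t: "5 * (gtg_config.gap_const d M W kl wb C0 C1 C\<rho> * real p ^ 4) * l \<le> t"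
  shows "measure (gtg_space f n) (slow_mixing n (c * real n / ln (real n)) t :: (nat \<Rightarrow> (real^'d) \<times> real) set)
    \<le> (3 + 2 ^ ((6 * W + 3) ^ d)) / real n + real n * measure weights {T..}"
proof -
  interpret N: prob_space "node :: ((real^'d) \<times> real) measure" by (rule prob_space_node)
  define m where "m = M * (p * p)"
  define \<theta> where "\<theta> = c * real n / ln (real n)"
  \<comment> \<open>Coincident nodes share a cell at every resolution. With n^2 cells per side the
    bound n^2 / L^d is at most n^-2.\<close>
  define L where "L = n * n"
  have Mp: "0 < M" using M by simp
  have mp: "0 < m" using Mp p by (simp add: m_def)
  have npos: "0 < real n" "1 \<le> real n" using n by auto
  have alg: "2 * x * (1 / P * (a / S)) = 2 * a * Q * (P / S) * (x / (Q * (P * P)))"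
    if "0 < P" "0 < Q" "0 < S" for x P a S Q :: real
    using that by (simp add: field_simps)
  have md: "real m ^ d = real M ^ d * real p ^ (2 * d)"
    by (simp add: m_def power_mult_distrib power_mult power2_eq_square)
  have mdpos: "0 < real m ^ d" using mp by simp
  have pd: "0 < real p ^ (2 * d)" "0 < real M ^ d" using p Mp by auto
  have lp: "0 < l" using l by simp
  \<comment> \<open>The expected number of nodes in a cell lies between \<open>\<delta> * l\<close>
    and \<open>4 ^ d * \<delta> * l\<close>; the factor 4^d stems from rounding p.\<close>
  have lo: "\<delta> * l \<le> real n / real m ^ d"
    using p(2) pd \<delta> lp unfolding md by (simp add: field_simps)
  have hi: "real n / real m ^ d \<le> 4 ^ d * \<delta> * l"
    using p(3) pd \<delta> lp unfolding md by (simp add: field_simps)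
  have mn: "real m ^ d \<le> real n"
  proof -
    have "1 * real m ^ d \<le> (\<delta> * l) * real m ^ d" using l(3) mdpos by (intro mult_right_mono) auto
    also have "\<dots> \<le> real n" using lo mdpos by (simp add: field_simps)
    finally show ?thesis by simp
  qed
  have el: "exp (- (2 * l)) = 1 / (real n)\<^sup>2"
    using npos by (simp add: l(1) exp_minus exp_double power2_eq_square field_simps)
  have small: "B * exp e \<le> C / real n" if "0 \<le> C" "B \<le> real n * C" "e \<le> - (2 * l)" for B C e
  proof -
    have "B * exp e \<le> (real n * C) * exp e" using that by (intro mult_right_mono) auto
    also have "\<dots> \<le> (real n * C) * exp (- (2 * l))" using that npos by (intro mult_left_mono) auto
    also have "\<dots> = C / real n" using npos by (simp add: el power2_eq_square)
    finally show ?thesis .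
  qed
  let ?P = "iid n (node :: ((real^'d) \<times> real) measure)"
  let ?A1 = "ev_outside n :: (nat \<Rightarrow> (real^'d) \<times> real) set"
  let ?A2 = "ev_crowded n m (C0 * real h) :: (nat \<Rightarrow> (real^'d) \<times> real) set"
  let ?A3 = "ev_window n m W K ws (real (K + 1) * real h) :: (nat \<Rightarrow> (real^'d) \<times> real) set"
  let ?A4 = "ev_heavy n T :: (nat \<Rightarrow> (real^'d) \<times> real) set"
  let ?A5 = "ev_mass n m M p T (C1 * real p ^ d * real h / (T + 1)) :: (nat \<Rightarrow> (real^'d) \<times> real) set"
  let ?A6 = "ev_coincide n L :: (nat \<Rightarrow> (real^'d) \<times> real) set"
  let ?E = "slow_mixing n \<theta> t :: (nat \<Rightarrow> (real^'d) \<times> real) set"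
  have Lp: "0 < L" using n by (simp add: L_def)
  have A2: "measure ?P ?A2 \<le> 1 / real n"
  proof -
    have "measure ?P ?A2 \<le> real m ^ d * exp (2 * (real n / real m ^ d) - C0 * real h)"
      using ev_crowded(2)[of n m "C0 * real h", where 'd = 'd] unfolding d(1)[symmetric] .
    also have "\<dots> \<le> 1 / real n"
    proof (rule small)
      have "C0 * (\<eta> * l) \<le> C0 * real h" using h C0 by (intro mult_left_mono) auto
      moreover have "(2 * 4 ^ d * \<delta> + 2) * l \<le> C0 * \<eta> * l" using C0 lp by (intro mult_right_mono) auto
      moreover have "C0 * \<eta> * l = C0 * (\<eta> * l)" "(2 * 4 ^ d * \<delta> + 2) * l = 2 * (4 ^ d * \<delta> * l) + 2 * l"
        by (simp_all add: distrib_right mult.assoc)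
      ultimately show "2 * (real n / real m ^ d) - C0 * real h \<le> - (2 * l)"
        using hi by linarith
    qed (use mn in auto)
    finally show ?thesis .
  qed
  have A3: "measure ?P ?A3 \<le> 2 ^ ((6 * W + 3) ^ d) / real n"
  proof -
    have "measure ?P ?A3 \<le> (real m ^ d * 2 ^ ((6 * W + 3) ^ d))
        * exp (real (K + 1) * real h - real n * (real (K + 1) / real m ^ d * pw) / 2)"
      using ev_window(2)[of n m W K ws "real (K + 1) * real h", where 'd = 'd] unfolding d(1)[symmetric] pw(1)[symmetric] .
    also have "\<dots> \<le> 2 ^ ((6 * W + 3) ^ d) / real n"
    proof (rule small)
      \<comment> \<open>With \<open>\<eta> = \<delta> * pw / 8\<close> the threshold uses up at most
        a quarter of (K + 1) \<open>\<delta>\<close> pw l, while the Chernoff bound supplies half of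
        it. The remaining quarter is at least 2 l by the choice of K.\<close>
      have "real (K + 1) * real h \<le> real (K + 1) * (2 * \<eta> * l)" using h by (intro mult_left_mono) auto
      moreover have "real (K + 1) * (2 * \<eta> * l) = (real K + 1) * \<delta> * pw * l / 4" by (simp add: \<eta>)
      moreover have "(real (K + 1) * pw / 2) * (\<delta> * l) \<le> (real (K + 1) * pw / 2) * (real n / real m ^ d)"
        using lo pw by (intro mult_left_mono) auto
      moreover have "(real (K + 1) * pw / 2) * (\<delta> * l) = (real K + 1) * \<delta> * pw * l / 2" by simp
      moreover have "real n * (real (K + 1) / real m ^ d * pw) / 2 = (real (K + 1) * pw / 2) * (real n / real m ^ d)" by (simp add: mult_ac)
      moreover have "8 * l \<le> (real K + 1) * \<delta> * pw * l" using K lp by (intro mult_right_mono) auto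
      ultimately show "real (K + 1) * real h - real n * (real (K + 1) / real m ^ d * pw) / 2 \<le> - (2 * l)"
        by linarith
    qed (use mn in auto)
    finally show ?thesis .
  qed
  have A4: "measure ?P ?A4 \<le> real n * measure weights {T..}"
    by (rule ev_heavy(2))
  have A5: "measure ?P ?A5 \<le> 1 / real n"
  proof -
    have "measure ?P ?A5 \<le> real p ^ d * exp (2 * real n * (1 / real p ^ d * ((\<mu> + 1) / (T + 1))) - C1 * real p ^ d * real h / (T + 1))"
      using ev_mass(2)[OF T(1) mean(1) Mp p(1) m_def, of n "C1 * real p ^ d * real h / (T + 1)", where 'd = 'd]
      unfolding d(1)[symmetric] mean(2)[symmetric] .
    also have "\<dots> \<le> 1 / real n"
    proof (rule small)
      \<comment> \<open>The Chernoff exponent is of order r l. As T <= p^2 <= p^d, r is at least 1 /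
        2, so the summand 4 in the condition on C1 yields the required 2 l.\<close>
      define r where "r = real p ^ d / (T + 1)"
      have "real p ^ 2 \<le> real p ^ d" using p d by (intro power_increasing) auto
      then have "T + 1 \<le> 2 * real p ^ d" using T by linarith
      then have r: "1 / 2 \<le> r" using T by (simp add: r_def field_simps)
      have ppos: "0 < real p ^ d" using p by simp
      have p2d: "real p ^ (2 * d) = real p ^ d * real p ^ d" by (simp add: power_add[symmetric] mult_2)
      have "2 * real n * (1 / real p ^ d * ((\<mu> + 1) / (T + 1)))
          = 2 * (\<mu> + 1) * real M ^ d * r * (real n / real m ^ d)"
        unfolding md r_def p2d
        by (rule alg) (use ppos pd T in auto)
      also have "\<dots> \<le> 2 * (\<mu> + 1) * real M ^ d * r * (4 ^ d * \<delta> * l)"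
        using hi r mean(3) by (intro mult_left_mono) auto
      finally have 1: "2 * real n * (1 / real p ^ d * ((\<mu> + 1) / (T + 1))) \<le> r * l * (2 * (\<mu> + 1) * 4 ^ d * \<delta> * real M ^ d)"
        by (simp add: mult_ac)
      have "(2 * (\<mu> + 1) * 4 ^ d * \<delta> * real M ^ d + 4) * (r * l) \<le> C1 * \<eta> * (r * l)"
        using C1 r lp by (intro mult_right_mono) auto
      also have "\<dots> = C1 * r * (\<eta> * l)" by (simp add: mult_ac)
      also have "\<dots> \<le> C1 * r * real h" using h C1 r by (intro mult_left_mono) auto
      also have "\<dots> = C1 * real p ^ d * real h / (T + 1)" by (simp add: r_def)
      finally have 2: "r * l * (2 * (\<mu> + 1) * 4 ^ d * \<delta> * real M ^ d) + 4 * (r * l) \<le> C1 * real p ^ d * real h / (T + 1)"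
        by (simp add: algebra_simps)
      have 3: "1 / 2 * l \<le> r * l" using r lp by (intro mult_right_mono) auto
      show "2 * real n * (1 / real p ^ d * ((\<mu> + 1) / (T + 1))) - C1 * real p ^ d * real h / (T + 1) \<le> - (2 * l)"
        using 1 2 3 by linarith
      have "p \<le> m" using Mp p by (simp add: m_def)
      then have "real p ^ d \<le> real m ^ d" by (intro power_mono) auto
      then show "real p ^ d \<le> real n * 1" using mn by linarith
    qed simp
    finally show ?thesis .
  qed
  have A6: "measure ?P ?A6 \<le> 1 / real n"
  proof -
    have "measure ?P ?A6 \<le> (real n)\<^sup>2 / real L ^ d"
      using ev_coincide(2)[OF Lp, where 'd = 'd] unfolding d(1)[symmetric] .
    also have "\<dots> \<le> (real n)\<^sup>2 / real L ^ 2"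
    proof (intro divide_left_mono power_increasing)
      show "1 \<le> real L" using Lp by simp
    qed (use d Lp in auto)
    also have "\<dots> = 1 / (real n * real n)" using npos by (simp add: L_def power2_eq_square)
    also have "\<dots> \<le> 1 / (1 * real n)" using npos by (intro divide_left_mono mult_right_mono) auto
    also have "\<dots> = 1 / real n" by simp
    finally show ?thesis .
  qed
  have sub: "?E \<subseteq> ?A1 \<union> ?A2 \<union> ?A3 \<union> ?A4 \<union> ?A5 \<union> ?A6"
  proof
    fix \<omega> assume w: "\<omega> \<in> ?E"
    then have \<omega>: "\<omega> \<in> space ?P" and conn: "graph_connected n (gtg_graph n \<theta> \<omega>)"
      and slow: "\<not> (\<exists>m. mix_time n (gtg_graph n \<theta> \<omega>) (1 / real n) = enat m \<and> real m \<le> t)"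
      by (auto simp: slow_mixing_def gtg_space_iid)
    show "\<omega> \<in> ?A1 \<union> ?A2 \<union> ?A3 \<union> ?A4 \<union> ?A5 \<union> ?A6"
    proof (rule ccontr)
      assume "\<not> ?thesis"
      then have no: "\<omega> \<notin> ?A1" "\<omega> \<notin> ?A2" "\<omega> \<notin> ?A3" "\<omega> \<notin> ?A4" "\<omega> \<notin> ?A5" "\<omega> \<notin> ?A6" by auto
      have klp: "0 < kl" using c \<delta> by (simp add: kl)
      obtain \<rho> where \<rho>: "1 \<le> \<rho>" "2 * T / kl < real \<rho> ^ d" "real \<rho> ^ d \<le> 2 ^ d * (2 * T / kl + 1)"
        using nat_root_bound[of "2 * T / kl" d] T klp d by auto
      have \<theta>m: "\<theta> / real m ^ d = c * (real n / real m ^ d) / l" by (simp add: \<theta>_def l(1))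
      have "gtg_config n (gtg_graph n \<theta> \<omega>) (\<lambda>i. cell_of m (fst (\<omega> i))) (\<lambda>i. snd (\<omega> i))
          d K M p m W R h \<rho> T kl ku ws wb C0 C1 C\<rho>"
      proof (rule good_realisation_config[OF \<omega> no conn d M m_def _ p(1) h(1) T(1) klp _ C0(1) C1(1) _ Lp _ _ ws wb R W _ _ T(2)])
        show "2 \<le> n" using n by simp
        show "0 \<le> ku" using c \<delta> by (simp add: ku)
        show "0 < \<theta>" using c npos lp l(1) by (simp add: \<theta>_def)
        have "c * (\<delta> * l) / l \<le> c * (real n / real m ^ d) / l"
          using lo c lp by (intro divide_right_mono mult_left_mono) auto
        then show "kl \<le> \<theta> / real m ^ d" using lp by (simp add: \<theta>m kl)
        have "c * (real n / real m ^ d) / l \<le> c * (4 ^ d * \<delta> * l) / l"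
          using hi c lp by (intro divide_right_mono mult_left_mono) auto
        also have "\<dots> = 4 ^ d * c * \<delta>" using lp by simp
        finally have "\<theta> / real m ^ d \<le> 4 ^ d * c * \<delta>" unfolding \<theta>m .
        then have "\<theta> / real m ^ d * sqrt (real d) ^ d \<le> 4 ^ d * c * \<delta> * sqrt (real d) ^ d"
          by (intro mult_right_mono) auto
        then show "\<theta> * sqrt (real d) ^ d / real m ^ d \<le> ku" by (simp add: ku)
        show "2 * T < kl * real \<rho> ^ d" using \<rho>(2) klp by (simp add: field_simps)
        have "2 * T / kl + 1 \<le> (2 / kl + 1) * T" using T by (simp add: algebra_simps)
        then have "2 ^ d * (2 * T / kl + 1) \<le> 2 ^ d * ((2 / kl + 1) * T)" by (intro mult_left_mono) auto
        then show "real \<rho> ^ d \<le> C\<rho> * T" using \<rho>(3) unfolding C\<rho> mult.assoc by linarith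
        have "T * real h ^ 6 \<le> (real p)\<^sup>2 * (real p)\<^sup>2" using T h by (intro mult_mono) auto
        then show "T * real h ^ 6 \<le> real p ^ 4" by (simp add: power4_eq_xxxx power2_eq_square mult.assoc)
      qed
      then interpret G: gtg_config n "gtg_graph n \<theta> \<omega>" "\<lambda>i. cell_of m (fst (\<omega> i))" "\<lambda>i. snd (\<omega> i)"
          d K M p m W R h \<rho> T kl ku ws wb C0 C1 C\<rho> .
      have "exp 1 \<le> (3 :: real)" by (rule exp_le)
      also have "\<dots> \<le> real n" using n by simp
      finally have e: "exp 1 \<le> real n" .
      have "\<exists>mt. mix_time n (gtg_graph n \<theta> \<omega>) (1 / real n) = enat mt \<and>
          real mt \<le> 5 * (G.gap_const * real p ^ 4) * ln (real n)"
      proof (rule G.mix_time_le)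
        show "0 < deg n (gtg_graph n \<theta> \<omega>) i" if "i < n" for i
          using connected_deg_pos[OF conn _ that] n G.vert by auto
      qed (use G.spectral_bounds e in auto)
      then obtain mt where mt: "mix_time n (gtg_graph n \<theta> \<omega>) (1 / real n) = enat mt"
        "real mt \<le> 5 * (G.gap_const * real p ^ 4) * l" unfolding l(1) by blast
      then have "real mt \<le> t" using t by linarith
      then show False using slow mt(1) by blast
    qed
  qed
  have "measure ?P ?E \<le> measure ?P ?A1 + measure ?P ?A2 + measure ?P ?A3 + measure ?P ?A4 + measure ?P ?A5 + measure ?P ?A6"
    by (rule measure_Un6_le[OF N.iid_finite_measure ev_outside(1) ev_crowded(1) ev_window(1) ev_heavy(1)
          ev_mass(1)[OF T(1) mean(1) Mp p(1) m_def] ev_coincide(1)[OF Lp] sub])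
  also have "\<dots> \<le> 0 + 1 / real n + 2 ^ ((6 * W + 3) ^ d) / real n + real n * measure weights {T..} + 1 / real n + 1 / real n"
    using ev_outside(2)[of n, where 'd = 'd] A2 A3 A4 A5 A6 by linarith
  also have "\<dots> = (3 + 2 ^ ((6 * W + 3) ^ d)) / real n + real n * measure weights {T..}"
    by (simp add: add_divide_distrib)
  finally show ?thesis unfolding gtg_space_iid \<theta>_def .
qed


text \<open>p is the integer part of x^(1 / (2 d)) with x = n / (k ln n); rounding loses at most a
  factor 2 in p, hence 4^d. The square of p is then of order x^(1 / d), which dominates
  \<open>n powr \<gamma>\<close> because \<open>\<gamma>\<close> is below 1 / d, and every power of
  ln n.\<close>

lemma eventually_scales:
  fixes d :: nat and k \<gamma> \<eta> \<delta> w0 :: real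
  assumes d: "2 \<le> d" and k: "0 < k" and \<gamma>: "0 < \<gamma>" "\<gamma> < 1 / real d" and \<eta>: "0 < \<eta>" and \<delta>: "0 < \<delta>"
  shows "\<forall>\<^sub>F n in sequentially. 3 \<le> n \<and> 1 \<le> ln (real n) \<and> 1 \<le> \<delta> * ln (real n) \<and> w0 \<le> real n powr \<gamma> \<and> 1 \<le> real n powr \<gamma>
    \<and> (\<exists>p h. 0 < p \<and> real p ^ (2 * d) \<le> real n / (k * ln (real n)) \<and> real n / (k * ln (real n)) \<le> 4 ^ d * real p ^ (2 * d)
      \<and> real n powr \<gamma> \<le> (real p)\<^sup>2 \<and> 3 \<le> h \<and> \<eta> * ln (real n) \<le> real h \<and> real h \<le> 2 * \<eta> * ln (real n)
      \<and> real h ^ 6 \<le> (real p)\<^sup>2)"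
proof -
  define e where "e = 1 / real d"
  have e: "0 < e" "\<gamma> < e" using d \<gamma> by (simp_all add: e_def)
  have 1: "\<forall>\<^sub>F n in sequentially. 4 * real n powr \<gamma> \<le> (real n / (k * ln (real n))) powr e"
    using \<gamma>(1) e k by real_asymp
  have 2: "\<forall>\<^sub>F n in sequentially. 4 * (2 * \<eta> * ln (real n)) ^ 6 \<le> (real n / (k * ln (real n))) powr e"
    using \<eta> e k by real_asymp
  have 3: "\<forall>\<^sub>F n in sequentially. 1 \<le> real n / (k * ln (real n))" using k by real_asymp
  have 4: "\<forall>\<^sub>F n in sequentially. 3 \<le> \<eta> * ln (real n)" using \<eta> by real_asymp
  have 5: "\<forall>\<^sub>F n in sequentially. 1 \<le> \<delta> * ln (real n)" using \<delta> by real_asymp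
  have 6: "\<forall>\<^sub>F n in sequentially. w0 \<le> real n powr \<gamma>" using \<gamma>(1) by real_asymp
  have 7: "\<forall>\<^sub>F n in sequentially. 1 \<le> real n powr \<gamma>" using \<gamma>(1) by real_asymp
  have 8: "\<forall>\<^sub>F n in sequentially. 1 \<le> ln (real n)" by real_asymp
  have 9: "\<forall>\<^sub>F n in sequentially. (3 :: nat) \<le> n" by (rule eventually_ge_at_top)
  show ?thesis
    using 1 2 3 4 5 6 7 8 9
  proof eventually_elim
    case (elim n)
    define x where "x = real n / (k * ln (real n))"
    define y where "y = x powr (1 / (2 * real d))"
    define p where "p = nat \<lfloor>y\<rfloor>"
    define h where "h = nat \<lceil>\<eta> * ln (real n)\<rceil>"
    have x: "1 \<le> x" using elim by (simp add: x_def)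
    have y: "1 \<le> y" using x by (simp add: y_def ge_one_powr_ge_zero)
    have yd: "y ^ (2 * d) = x"
      using x y d by (simp add: y_def powr_realpow[symmetric] powr_powr)
    have y2: "y\<^sup>2 = x powr e"
    proof -
      have "y\<^sup>2 = y powr 2" using y by (simp add: powr_numeral)
      also have "\<dots> = x powr e" using d by (simp add: y_def powr_powr e_def)
      finally show ?thesis .
    qed
    have p: "real p \<le> y" "y < real p + 1" using y by (simp_all add: p_def) 
    have p0: "0 < p" using y by (simp add: p_def) 
    then have p1: "1 \<le> real p" by simp
    have yp: "y \<le> 2 * real p" using p p1 by linarith
    have "real p ^ (2 * d) \<le> x" unfolding yd[symmetric] using p by (intro power_mono) auto
    moreover have "x \<le> 4 ^ d * real p ^ (2 * d)"
    proof -
      have "x \<le> (2 * real p) ^ (2 * d)" unfolding yd[symmetric] using yp y by (intro power_mono) auto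
      also have "\<dots> = 4 ^ d * real p ^ (2 * d)" by (simp add: power_mult power_mult_distrib)
      finally show ?thesis .
    qed
    moreover have p2: "x powr e \<le> 4 * (real p)\<^sup>2"
    proof -
      have "y\<^sup>2 \<le> (2 * real p)\<^sup>2" using yp y by (intro power_mono) auto
      then show ?thesis by (simp add: y2 power_mult_distrib)
    qed
    then have "real n powr \<gamma> \<le> (real p)\<^sup>2" using elim(1) by (simp add: x_def)
    moreover have h: "\<eta> * ln (real n) \<le> real h" "real h \<le> 2 * \<eta> * ln (real n)" "3 \<le> h"
    proof -
      have "0 \<le> \<eta> * ln (real n)" using elim by simp
      then show "\<eta> * ln (real n) \<le> real h" "real h \<le> 2 * \<eta> * ln (real n)" "3 \<le> h"
        unfolding h_def using elim(4) by linarith+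
    qed
    moreover have "real h ^ 6 \<le> (real p)\<^sup>2"
    proof -
      have "4 * real h ^ 6 \<le> 4 * (2 * \<eta> * ln (real n)) ^ 6"
        using h by (intro mult_left_mono power_mono) auto
      also have "\<dots> \<le> x powr e" using elim(2) by (simp add: x_def)
      finally show ?thesis using p2 by simp
    qed
    ultimately show ?case using elim p0 unfolding x_def by blast
  qed
qed

text \<open>The constants are fixed in the order ws, \<open>\<delta>\<close>, \<open>\<eta>\<close>,
  K, M, wb, R, W, each from its predecessors and none from n; then only p, h and T remain to be
  chosen for each n.\<close>

lemma slow_mixing_positive:
  fixes c \<nu> :: real
  assumes d2: "CARD('d::finite) \<ge> 2" and c: "0 < c"
    and f_mean: "integrable lborel (\<lambda>x. x * f x)"
    and \<nu>_pos: "\<nu> > 0"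
    and tail: "\<exists>W0 C. \<forall>x\<ge>W0. measure weights {x..} \<le> C * x powr (-(real CARD('d) + \<nu>))"
  shows "\<exists>Kf. (\<lambda>n. measure (gtg_space f n) (slow_mixing n (c * real n / ln (real n))
      (Kf * real n powr (2 / real CARD('d)) * ln (real n) powr ((real CARD('d) - 2) / real CARD('d)))
      :: (nat \<Rightarrow> (real^'d) \<times> real) set)) \<longlonglongrightarrow> 0"
proof -
  obtain W0 Ct where tail: "\<And>x. W0 \<le> x \<Longrightarrow> measure weights {x..} \<le> Ct * x powr (-(real CARD('d) + \<nu>))"
    using tail by blast
  define d where "d = CARD('d)"
  have d: "2 \<le> d" "d = CARD('d)" using d2 by (auto simp: d_def)
  obtain ws where ws: "0 < ws" "0 < measure weights {ws..}" using weights_positive by blast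
  define pw where "pw = measure weights {ws..}"
  define sd where "sd = sqrt (real d) ^ d"
  have sd: "0 < sd" using d by (simp add: sd_def)
  \<comment> \<open>8^d is the 4^d in \<open>ku\<close>, from rounding p, times 2^d for neighbouring
    cells. It makes \<open>ku * 2 ^ d\<close> equal to ws, so that heavy nodes in neighbouring cells
    are adjacent.\<close>
  define \<delta> where "\<delta> = ws / (8 ^ d * c * sd)"
  have \<delta>: "0 < \<delta>" using ws c sd by (simp add: \<delta>_def)
  define kl where "kl = c * \<delta>"
  define ku where "ku = 4 ^ d * c * \<delta> * sqrt (real d) ^ d"
  have kl: "0 < kl" using c \<delta> by (simp add: kl_def)
  have ku: "0 \<le> ku" using c \<delta> by (simp add: ku_def)
  have ku_ws: "ku * 2 ^ d \<le> ws"
  proof -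
    have "(4 :: real) ^ d * 2 ^ d = 8 ^ d" by (simp add: power_mult_distrib[symmetric])
    then have "ku * 2 ^ d = 8 ^ d * c * sd * \<delta>" unfolding ku_def sd_def by (simp add: mult_ac)
    also have "\<dots> = ws" using c sd by (simp add: \<delta>_def)
    finally show ?thesis by simp
  qed
  define \<eta> where "\<eta> = \<delta> * pw / 8"
  have \<eta>: "0 < \<eta>" using \<delta> ws by (simp add: \<eta>_def pw_def)
  obtain K where K: "8 / (\<delta> * pw) \<le> real K" using real_arch_simple by blast
  have K8: "8 \<le> (real K + 1) * \<delta> * pw"
  proof -
    have dp: "0 < \<delta> * pw" using \<delta> ws by (simp add: pw_def)
    then have "8 \<le> real K * (\<delta> * pw)" using K by (simp add: pos_divide_le_eq)
    then show ?thesis using dp by (simp add: distrib_right mult.assoc)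
  qed
  define M where "M = 2 * K + 1"
  define wb where "wb = ku * (real M + 1) ^ d"
  obtain R where R: "2 * wb / kl < real R ^ d"
    using nat_root_bound[of "2 * wb / kl" d] ku kl d by (auto simp: wb_def)
  then have R: "2 * wb < kl * real R ^ d" using kl by (simp add: pos_divide_less_eq mult.commute)
  define W where "W = (K * K + 1) * (R + 2 * M) + 2 * M"
  define C\<rho> where "C\<rho> = 2 ^ d * (2 / kl + 1)"
  define \<mu> where "\<mu> = (\<integral>x. x * f x \<partial>lborel)"
  have \<mu>: "0 \<le> \<mu>" unfolding \<mu>_def
  proof (rule Bochner_Integration.integral_nonneg)
    show "0 \<le> x * f x" for x using f_nonneg[of x] f_supp[of x] by (cases "x < 0") auto
  qed
  define C0 where "C0 = max 1 ((2 * 4 ^ d * \<delta> + 2) / \<eta>)"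
  have C0: "1 \<le> C0" by (simp add: C0_def)
  have "(2 * 4 ^ d * \<delta> + 2) / \<eta> \<le> C0" by (simp add: C0_def)
  then have C0': "2 * 4 ^ d * \<delta> + 2 \<le> C0 * \<eta>" unfolding pos_divide_le_eq[OF \<eta>] .
  define C1 where "C1 = (2 * (\<mu> + 1) * 4 ^ d * \<delta> * real M ^ d + 4) / \<eta>"
  have C1: "0 \<le> C1" "2 * (\<mu> + 1) * 4 ^ d * \<delta> * real M ^ d + 4 \<le> C1 * \<eta>"
    using \<eta> \<mu> \<delta> by (simp_all add: C1_def)
  define gap where "gap = gtg_config.gap_const d M W kl wb C0 C1 C\<rho>"
  define k where "k = \<delta> * real M ^ d"
  have k: "0 < k" using \<delta> by (simp add: k_def M_def)
  \<comment> \<open>The absolute value is taken because the sign of \<open>gap\<close> is known only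
    inside an instance of the locale.\<close>
  define Kf where "Kf = 5 * \<bar>gap\<bar> / k powr (2 / real d)"
  \<comment> \<open>The midpoint of the admissible interval. Being above 1 / (d +
    \<open>\<nu>\<close>) makes the exponent a of the union bound negative; being below 1 / d keeps
    T below p^2.\<close>
  define \<gamma> where "\<gamma> = (1 / real d + 1 / (real d + \<nu>)) / 2"
  have g0: "1 / (real d + \<nu>) < 1 / real d" using d \<nu>_pos by (simp add: field_simps)
  have \<gamma>: "0 < \<gamma>" "\<gamma> < 1 / real d" "1 / (real d + \<nu>) < \<gamma>"
    using g0 d \<nu>_pos by (simp_all add: \<gamma>_def add_pos_pos)
  define a where "a = 1 - \<gamma> * (real d + \<nu>)"
  have a: "a < 0" using \<gamma>(3) d \<nu>_pos by (simp add: a_def pos_divide_less_eq)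
  define c2 :: real where "c2 = 3 + 2 ^ ((6 * W + 3) ^ d)"
  let ?S = "\<lambda>n. slow_mixing n (c * real n / ln (real n))
      (Kf * real n powr (2 / real CARD('d)) * ln (real n) powr ((real CARD('d) - 2) / real CARD('d)))
      :: (nat \<Rightarrow> (real^'d) \<times> real) set"
  have bound: "\<forall>\<^sub>F n in sequentially. norm (measure (gtg_space f n) (?S n)) \<le> c2 / real n + Ct * real n powr a"
    using eventually_scales[OF d(1) k \<gamma>(1,2) \<eta> \<delta>, of W0]
  proof eventually_elim
    case (elim n)
    then obtain p h where n: "3 \<le> n" "1 \<le> ln (real n)" "1 \<le> \<delta> * ln (real n)" "W0 \<le> real n powr \<gamma>" "1 \<le> real n powr \<gamma>"
      and p: "0 < p" "real p ^ (2 * d) \<le> real n / (k * ln (real n))" "real n / (k * ln (real n)) \<le> 4 ^ d * real p ^ (2 * d)"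
      and Tp: "real n powr \<gamma> \<le> (real p)\<^sup>2"
      and h: "3 \<le> h" "\<eta> * ln (real n) \<le> real h" "real h \<le> 2 * \<eta> * ln (real n)" "real h ^ 6 \<le> (real p)\<^sup>2"
      by blast
    have npos: "0 < real n" using n by simp
    have lpos: "0 < ln (real n)" using n by simp
    let ?x = "real n / (k * ln (real n))"
    have p4: "real p ^ 4 \<le> ?x powr (2 / real d)"
    proof -
      have "real p ^ 4 = (real p ^ (2 * d)) powr (2 / real d)"
      proof -
        have "(real p ^ (2 * d)) powr (2 / real d) = (real p powr (2 * real d)) powr (2 / real d)"
          using p by (simp add: powr_realpow[symmetric])
        also have "\<dots> = real p powr 4" using d by (simp add: powr_powr)
        also have "\<dots> = real p ^ 4" using p by (simp add: powr_numeral)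
        finally show ?thesis by simp
      qed
      also have "\<dots> \<le> ?x powr (2 / real d)" using p d by (intro powr_mono2) auto
      finally show ?thesis .
    qed
    have t: "5 * (gap * real p ^ 4) * ln (real n)
        \<le> Kf * real n powr (2 / real CARD('d)) * ln (real n) powr ((real CARD('d) - 2) / real CARD('d))"
    proof -
      have "5 * (gap * real p ^ 4) * ln (real n) \<le> 5 * (\<bar>gap\<bar> * ?x powr (2 / real d)) * ln (real n)"
        using p4 lpos by (intro mult_right_mono mult_left_mono mult_mono) auto
      also have "?x powr (2 / real d) = real n powr (2 / real d) / (k powr (2 / real d) * ln (real n) powr (2 / real d))"
        using npos lpos k by (simp add: powr_divide powr_mult)
      also have "5 * (\<bar>gap\<bar> * (real n powr (2 / real d) / (k powr (2 / real d) * ln (real n) powr (2 / real d)))) * ln (real n)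
          = Kf * real n powr (2 / real d) * (ln (real n) / ln (real n) powr (2 / real d))"
        by (simp add: Kf_def)
      also have "ln (real n) / ln (real n) powr (2 / real d) = ln (real n) powr ((real d - 2) / real d)"
      proof -
        have "ln (real n) powr ((real d - 2) / real d) = ln (real n) powr (1 - 2 / real d)"
          using d by (simp add: diff_divide_distrib)
        also have "\<dots> = ln (real n) powr 1 / ln (real n) powr (2 / real d)" by (rule powr_diff)
        finally show ?thesis using lpos by simp
      qed
      finally show ?thesis by (simp add: d_def)
    qed
    have kk: "\<delta> * real M ^ d * ln (real n) = k * ln (real n)" by (simp add: k_def)
    have "measure (gtg_space f n) (?S n) \<le> (3 + 2 ^ ((6 * W + 3) ^ d)) / real n + real n * measure weights {real n powr \<gamma>..}"
      by (rule slow_mixing_bound[OF d(2,1) M_def c \<delta> pw_def ws(2)[folded pw_def] f_mean \<mu>_def \<mu> kl_def ku_def ku_ws \<eta>_def K8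
            wb_def R _ C\<rho>_def C0 C0' C1 refl n(2,3,1) p(1) _ _ n(5) Tp h t[unfolded gap_def]])
        (use p in \<open>simp_all add: kk W_def\<close>)
    also have "real n * measure weights {real n powr \<gamma>..} \<le> real n * (Ct * (real n powr \<gamma>) powr (-(real CARD('d) + \<nu>)))"
      by (intro mult_left_mono tail n) simp
    also have "\<dots> = Ct * real n powr a"
    proof -
      have "(real n powr \<gamma>) powr (-(real CARD('d) + \<nu>)) = real n powr (a - 1)"
        by (simp add: powr_powr a_def d_def[symmetric] right_diff_distrib distrib_left)
      moreover have "real n powr a = real n * real n powr (a - 1)"
        using npos powr_add[of "real n" 1 "a - 1"] by simp
      ultimately show ?thesis by simp
    qed
    finally show ?case by (simp add: c2_def)
  qed
  have "(\<lambda>n. c2 / real n) \<longlonglongrightarrow> 0" by real_asymp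
  moreover have "(\<lambda>n. Ct * real n powr a) \<longlonglongrightarrow> 0" using a by real_asymp
  ultimately have "(\<lambda>n. c2 / real n + Ct * real n powr a) \<longlonglongrightarrow> 0" using tendsto_add by fastforce
  then have "(\<lambda>n. measure (gtg_space f n) (?S n)) \<longlonglongrightarrow> 0"
    by (rule Lim_null_comparison[OF bound])
  then show ?thesis by blast
qed

text \<open>For \<open>c \<le> 0\<close> the graph is almost surely complete; this includes coincident nodes because
  \<open>x / 0 = 0\<close>.\<close>

lemma slow_mixing_nonpositive:
  fixes c :: real
  assumes d2: "CARD('d::finite) \<ge> 2" and c: "c \<le> 0"
  shows "(\<lambda>n. measure (gtg_space f n) (slow_mixing n (c * real n / ln (real n))
      (5 * real n powr (2 / real CARD('d)) * ln (real n) powr ((real CARD('d) - 2) / real CARD('d)))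
      :: (nat \<Rightarrow> (real^'d) \<times> real) set)) \<longlonglongrightarrow> 0"
proof -
  interpret N: prob_space "node :: ((real^'d) \<times> real) measure" by (rule prob_space_node)
  let ?S = "\<lambda>n. slow_mixing n (c * real n / ln (real n))
      (5 * real n powr (2 / real CARD('d)) * ln (real n) powr ((real CARD('d) - 2) / real CARD('d)))
      :: (nat \<Rightarrow> (real^'d) \<times> real) set"
  have "\<forall>\<^sub>F n in sequentially. measure (gtg_space f n) (?S n) = 0"
    using eventually_ge_at_top[of "3 :: nat"]
  proof eventually_elim
    case (elim n)
    let ?\<theta> = "c * real n / ln (real n)"
    have n: "0 < real n" "0 < ln (real n)" "ln (real n) \<le> real n"
      using elim ln_le_minus_one[of "real n"] by auto
    have \<theta>: "?\<theta> \<le> 0" using c n by (simp add: divide_nonpos_pos mult_nonpos_nonneg)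
    have "?S n \<subseteq> ev_outside n"
    proof
      fix \<omega> assume w: "\<omega> \<in> ?S n"
      show "\<omega> \<in> ev_outside n"
      proof (rule ccontr)
        assume no: "\<omega> \<notin> ev_outside n"
        have \<omega>: "\<omega> \<in> space (iid n node)" using w by (simp add: slow_mixing_def gtg_space_iid)
        have wn: "0 \<le> snd (\<omega> i)" if "i < n" for i
          using no \<omega> that by (auto simp: ev_outside_def outside_def)
        have "gtg_graph n ?\<theta> \<omega> i j \<longleftrightarrow> i < n \<and> j < n \<and> i \<noteq> j" for i j
        proof -
          have "?\<theta> \<le> (snd (\<omega> i) + snd (\<omega> j)) / torus_dist (fst (\<omega> i)) (fst (\<omega> j)) ^ CARD('d)" if "i < n" "j < n"
            by (rule order_trans[OF \<theta>]) (intro divide_nonneg_nonneg add_nonneg_nonneg zero_le_power torus_dist_nonneg wn that)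
          then show ?thesis unfolding gtg_graph_def gtg_adj_def by blast
        qed
        then obtain mt where mt: "mix_time n (gtg_graph n ?\<theta> \<omega>) (1 / real n) = enat mt" "real mt \<le> 5 * 1 * ln (real n)"
          using complete_mix_time[OF _ elim] by blast
        \<comment> \<open>The complete graph mixes in time of order ln n. Splitting off the power 2
          / d and bounding it by the same power of n brings this into the form of the claim.\<close>
        have "ln (real n) = ln (real n) powr (2 / real CARD('d)) * ln (real n) powr ((real CARD('d) - 2) / real CARD('d))"
          using n d2 by (simp add: powr_add[symmetric] add_divide_distrib[symmetric])
        also have "\<dots> \<le> real n powr (2 / real CARD('d)) * ln (real n) powr ((real CARD('d) - 2) / real CARD('d))"
          using n by (intro mult_right_mono powr_mono2) auto
        finally have "real mt \<le> 5 * real n powr (2 / real CARD('d)) * ln (real n) powr ((real CARD('d) - 2) / real CARD('d))"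
          using mt(2) by simp
        then show False using w mt(1) unfolding slow_mixing_def by blast
      qed
    qed
    then have "measure (gtg_space f n) (?S n) \<le> measure (gtg_space f n) (ev_outside n :: (nat \<Rightarrow> (real^'d) \<times> real) set)"
      unfolding gtg_space_iid by (intro finite_measure.finite_measure_mono[OF N.iid_finite_measure] ev_outside(1))
    also have "\<dots> \<le> 0" unfolding gtg_space_iid by (rule ev_outside(2))
    finally show ?case by (simp add: measure_le_0_iff)
  qed
  then show ?thesis by (rule tendsto_eventually)
qed

end

theorem theorem2:
  fixes f :: "real \<Rightarrow> real" and c \<nu> :: real
  assumes d2: "CARD('d::finite) \<ge> 2"
    and f_meas: "f \<in> borel_measurable borel"
    and f_nonneg: "\<And>x. 0 \<le> f x"
    and f_supp: "\<And>x. x < 0 \<Longrightarrow> f x = 0"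
    and f_prob: "(\<integral>\<^sup>+x. ennreal (f x) \<partial>lborel) = 1"
    and f_mean: "integrable lborel (\<lambda>x. x * f x)"
    and f_var: "integrable lborel (\<lambda>x. x\<^sup>2 * f x)"
    and \<nu>_pos: "\<nu> > 0"
    and tail: "\<exists>W0 C. \<forall>x\<ge>W0. measure (density lborel f) {x..} \<le> C * x powr (-(real CARD('d) + \<nu>))"
    and c_bound: "c \<le> 1 / (real CARD('d) + 3) *
       min (SUP \<alpha>\<in>{0<..1/2}. \<alpha> * weight_quantile f \<alpha>)
           (SUP \<alpha>\<in>{1/2<..<1}. (1 - \<alpha>) * weight_quantile f \<alpha>)"
  shows "\<exists>K. let E = (\<lambda>n. {\<omega> \<in> space (gtg_space f n :: (nat \<Rightarrow> (real^'d) \<times> real) measure).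
              graph_connected n (gtg_graph n (c * real n / ln (real n)) \<omega>) \<and>
              \<not> (\<exists>m. mix_time n (gtg_graph n (c * real n / ln (real n)) \<omega>) (1 / real n) = enat m \<and>
                     real m \<le> K * real n powr (2 / real CARD('d)) *
                                 ln (real n) powr ((real CARD('d) - 2) / real CARD('d)))})
         in (\<forall>n. E n \<in> sets (gtg_space f n)) \<and>
            ((\<lambda>n. measure (gtg_space f n) (E n)) \<longlonglongrightarrow> 0)"
proof -
  interpret weight_density f by unfold_locales (fact f_meas f_nonneg f_supp f_prob)+
  have "\<exists>K. (\<lambda>n. measure (gtg_space f n) (slow_mixing n (c * real n / ln (real n))
      (K * real n powr (2 / real CARD('d)) * ln (real n) powr ((real CARD('d) - 2) / real CARD('d)))
      :: (nat \<Rightarrow> (real^'d) \<times> real) set)) \<longlonglongrightarrow> 0"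
  proof (cases "0 < c")
    case True
    then show ?thesis by (rule slow_mixing_positive[OF d2 _ f_mean \<nu>_pos tail])
  next
    case False
    then show ?thesis using slow_mixing_nonpositive[OF d2, of c] by auto
  qed
  then obtain K where K: "(\<lambda>n. measure (gtg_space f n) (slow_mixing n (c * real n / ln (real n))
      (K * real n powr (2 / real CARD('d)) * ln (real n) powr ((real CARD('d) - 2) / real CARD('d)))
      :: (nat \<Rightarrow> (real^'d) \<times> real) set)) \<longlonglongrightarrow> 0" by blast
  show ?thesis
    unfolding Let_def slow_mixing_def[symmetric]
    using K slow_mixing_measurable by (intro exI[of _ K] conjI allI)
qed

end
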